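(* Let $\mathbf{H}_\nu$ denote the Struve function of the first kind. The following assertions are valid. (a) If $\nu\in\left(0,\frac12\right]$, then $x\mapsto\mathbf{H}_\nu''(x)$ has infinitely many zeros, which are all real and simple. (b) If $\nu\in\left(0,\frac12\right]$, then the positive zeros of the first and second derivative of $\mathbf{H}_\nu$ are interlacing. (c) If $\nu\in\left[-\frac12,\frac12\right]$, then all zeros of $x\mapsto-\nu\mathbf{H}_\nu'(x)+x\mathbf{H}_\nu''(x)$ are real and interlace with the zeros of $x\mapsto\mathbf{H}_\nu'(x)$. Moreover, all zeros of $x\mapsto-(\nu+1)\mathbf{H}_\nu(x)+x\mathbf{H}_\nu'(x)$ are real and interlace with the zeros of $x\mapsto\mathbf{H}_\nu(x)$.
   Context: The Struve function of the first kind is $\mathbf{H}_\nu(x)=\left(\frac{x}{2}\right)^{\nu+1}\sum_{m\ge0}\frac{(-1)^m}{\Gamma\left(m+\frac32\right)\Gamma\left(m+\nu+\frac32\right)}\left(\frac{x}{2}\right)^{2m}$; primes denote derivatives with respect to $x$. "All zeros" refers to zeros in the complex plane. For $n\in\{0,1,2\}$ the function $x\mapsto x^{n-\nu-1}\mathbf{H}_\nu^{(n)}(x)$ is an even real entire function, and the zeros of $\mathbf{H}_\nu^{(n)}$ are understood as the zeros of this entire function. Likewise, for $n\in\{0,1\}$ the zeros of $(n-\nu-1)\mathbf{H}_\nu^{(n)}(x)+x\mathbf{H}_\nu^{(n+1)}(x)$ in (c) are understood as the zeros of the derivative of that entire function, namely of $x\mapsto x^{n-\nu-2}\left[(n-\nu-1)\mathbf{H}_\nu^{(n)}(x)+x\mathbf{H}_\nu^{(n+1)}(x)\right]$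 (so a zero at the origin that comes only from the power factor is disregarded). "Interlace" has its usual meaning throughout, in (b) and in (c) alike: the zeros of the two functions separate each other, that is, between any two consecutive zeros of either function there is exactly one zero of the other.
   Formalization: In the "Moreover" part of (c) at ν=1/2, where the zeros of H_ν are double (H_{1/2} is a multiple of (1−cos x)/√x) and literal interlacing fails between 0 and 2π, zeros are counted with multiplicity; for all other ν interlacing is literal. *)

theory Defs
  imports "HOL-Complex_Analysis.Complex_Analysis"
begin

definition struve_H :: "real \<Rightarrow> real \<Rightarrow> real" where
  "struve_H \<nu> x = (x / 2) powr (\<nu> + 1) *
     (\<Sum>m. (-1) ^ m / (Gamma (real m + 3/2) * Gamma (real m + \<nu> + 3/2)) * (x / 2) ^ (2 * m))"

abbreviation struve_H_deriv :: "nat \<Rightarrow> real \<Rightarrow> real \<Rightarrow> real" where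
  "struve_H_deriv n \<nu> \<equiv> (deriv ^^ n) (struve_H \<nu>)"

text \<open>The non-integer powers of \<open>x\<close> are only used on the positive half-line, where they need no choice of
  a branch; complex zeros are those of the entire function determined by the values there.\<close>

definition entire_extension :: "(real \<Rightarrow> real) \<Rightarrow> complex \<Rightarrow> complex" where
  "entire_extension \<phi> =
     (THE f. f holomorphic_on UNIV \<and> (\<forall>x>0. f (of_real x) = of_real (\<phi> x)))"

definition struve_entire :: "nat \<Rightarrow> real \<Rightarrow> complex \<Rightarrow> complex" where
  "struve_entire n \<nu> =
     entire_extension (\<lambda>x. x powr (real n - \<nu> - 1) * struve_H_deriv n \<nu> x)"

definition struve_comb_entire :: "nat \<Rightarrow> real \<Rightarrow> complex \<Rightarrow> complex" where
  "struve_comb_entire n \<nu> =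
     entire_extension (\<lambda>x. x powr (real n - \<nu> - 2) *
       ((real n - \<nu> - 1) * struve_H_deriv n \<nu> x + x * struve_H_deriv (Suc n) \<nu> x))"

definition all_zeros_real :: "(complex \<Rightarrow> complex) \<Rightarrow> bool" where
  "all_zeros_real f \<longleftrightarrow> (\<forall>z. f z = 0 \<longrightarrow> z \<in> \<real>)"

definition real_zeros :: "(complex \<Rightarrow> complex) \<Rightarrow> real set" where
  "real_zeros f = {x. f (of_real x) = 0}"

definition consecutive :: "('a \<Rightarrow> 'a \<Rightarrow> bool) \<Rightarrow> 'a set \<Rightarrow> 'a \<Rightarrow> 'a \<Rightarrow> bool" where
  "consecutive lt A u v \<longleftrightarrow>
     u \<in> A \<and> v \<in> A \<and> lt u v \<and> \<not> (\<exists>w\<in>A. lt u w \<and> lt w v)"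

definition interlacing :: "('a \<Rightarrow> 'a \<Rightarrow> bool) \<Rightarrow> 'a set \<Rightarrow> 'a set \<Rightarrow> bool" where
  "interlacing lt A B \<longleftrightarrow>
     (\<forall>u v. consecutive lt A u v \<longrightarrow> (\<exists>!w. w \<in> B \<and> lt u w \<and> lt w v)) \<and>
     (\<forall>u v. consecutive lt B u v \<longrightarrow> (\<exists>!w. w \<in> A \<and> lt u w \<and> lt w v))"

text \<open>Interlacing of zeros counted with multiplicity: a real zero \<open>x\<close> of order \<open>p\<close> is listed as the \<open>p\<close>
  consecutive zeros \<open>(x, h)\<close> with \<open>h = 1 - p, 3 - p, \<dots>, p - 1\<close>, ordered lexicographically, i.e. as if it had
  been split symmetrically into \<open>p\<close> infinitely close simple zeros. Simple zeros are all listed with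
  \<open>h = 0\<close>, so for them this is ordinary interlacing on the real line; a double zero of one function
  (\<open>h = -1, 1\<close>) is separated by a simple zero of the other one (\<open>h = 0\<close>) at the same point.
  This is needed for \<open>\<nu> = 1/2\<close>, where \<open>struve_H \<nu> x\<close> is a multiple of \<open>(1 - cos x) / sqrt x\<close> and
  has double zeros.\<close>

definition real_zeros_mult :: "(complex \<Rightarrow> complex) \<Rightarrow> (real \<times> int) set" where
  "real_zeros_mult f = {(x, h). x \<in> real_zeros f \<and>
     (\<exists>i\<in>{0..<zorder f (of_real x)}. h = 2 * i - (zorder f (of_real x) - 1))}"

definition lex_less :: "real \<times> int \<Rightarrow> real \<times> int \<Rightarrow> bool" where
  "lex_less u v \<longleftrightarrow> fst u < fst v \<or> (fst u = fst v \<and> snd u < snd v)"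


subsection \<open>Well-definedness of the entire extensions\<close>

lemma entire_extension_eqI:
  assumes "f holomorphic_on UNIV" "\<And>x. x > 0 \<Longrightarrow> f (of_real x) = of_real (\<phi> x)"
  shows "entire_extension \<phi> = f"
  unfolding entire_extension_def
proof (rule the_equality)
  fix g :: "complex \<Rightarrow> complex"
  assume g: "g holomorphic_on UNIV \<and> (\<forall>x>0. g (of_real x) = of_real (\<phi> x))"
  have lim: "(1::complex) islimpt (of_real ` {0<..} :: complex set)"
    unfolding islimpt_sequential
  proof (intro exI[of _ "\<lambda>n. of_real (1 + inverse (real (Suc n)))"] conjI allI)
    fix n show "complex_of_real (1 + inverse (real (Suc n))) \<in> of_real ` {0<..} - {1}"
      by (auto simp del: of_real_add of_nat_Suc simp: add_pos_pos)
  next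
    have "(\<lambda>n. complex_of_real (1 + inverse (real (Suc n)))) \<longlonglongrightarrow> of_real (1 + 0)"
      by (intro tendsto_of_real tendsto_add tendsto_const LIMSEQ_inverse_real_of_nat)
    thus "(\<lambda>n. complex_of_real (1 + inverse (real (Suc n)))) \<longlonglongrightarrow> 1" by simp
  qed
  show "g = f"
  proof
    fix w
    have "g w - f w = 0"
      by (rule analytic_continuation[of "\<lambda>z. g z - f z" UNIV "of_real ` {0<..}" 1])
         (use g assms lim in \<open>auto intro!: holomorphic_intros\<close>)
    thus "g w = f w" by simp
  qed
qed (use assms in auto)

lemma deriv_real_entire:
  fixes G :: "complex \<Rightarrow> complex"
  assumes "G holomorphic_on UNIV" "\<And>x::real. G (of_real x) \<in> \<real>"
  shows "((\<lambda>x. Re (G (of_real x))) has_real_derivative Re (deriv G (of_real x))) (at x)"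
    and "deriv G (of_real x) \<in> \<real>"
proof -
  have "(G has_field_derivative deriv G (of_real x)) (at (of_real x))"
    using assms(1) by (simp add: holomorphic_derivI)
  hence d: "((\<lambda>t. G (of_real t)) has_vector_derivative deriv G (of_real x)) (at x)"
    by (rule has_vector_derivative_real_field)
  show "((\<lambda>x. Re (G (of_real x))) has_real_derivative Re (deriv G (of_real x))) (at x)"
    using bounded_linear.has_vector_derivative[OF bounded_linear_Re d]
    by (simp add: has_real_derivative_iff_has_vector_derivative)
  have "((\<lambda>x. Im (G (of_real x))) has_real_derivative Im (deriv G (of_real x))) (at x)"
    using bounded_linear.has_vector_derivative[OF bounded_linear_Im d]
    by (simp add: has_real_derivative_iff_has_vector_derivative)
  moreover have "(\<lambda>x. Im (G (of_real x))) = (\<lambda>_. 0)"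
    using assms(2) by (auto simp: complex_is_Real_iff)
  ultimately have "Im (deriv G (of_real x)) = 0"
    using DERIV_unique DERIV_const by metis
  thus "deriv G (of_real x) \<in> \<real>" by (simp add: complex_is_Real_iff)
qed

lemma struve_H_entire_factor:
  assumes "\<nu> > -3/2"
  obtains G where "G holomorphic_on UNIV" "\<And>x::real. G (of_real x) \<in> \<real>"
    "\<And>x. x > 0 \<Longrightarrow> struve_H \<nu> x = x powr (\<nu> + 1) * Re (G (of_real x))"
proof -
  define a where "a m = (-1) ^ m / (Gamma (real m + 3/2) * Gamma (real m + \<nu> + 3/2))" for m :: nat
  define F where "F = Abs_fps (\<lambda>m. complex_of_real (a m))"
  have nz: "a m \<noteq> 0" for m
  proof -
    have "Gamma (real m + 3/2) \<noteq> 0" "Gamma (real m + \<nu> + 3/2) \<noteq> 0"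
      using assms by (intro less_imp_neq[symmetric] Gamma_real_pos; simp)+
    thus ?thesis unfolding a_def by simp
  qed
  have ratio: "\<bar>a m\<bar> / \<bar>a (Suc m)\<bar> = (real m + 3/2) * (real m + \<nu> + 3/2)" for m
  proof -
    have 1: "Gamma (real m + 3/2 + 1) = (real m + 3/2) * Gamma (real m + 3/2)"
      by (rule Gamma_plus1) (auto dest: nonpos_Ints_nonpos)
    have 2: "Gamma (real m + \<nu> + 3/2 + 1) = (real m + \<nu> + 3/2) * Gamma (real m + \<nu> + 3/2)"
      using assms by (intro Gamma_plus1) (auto dest: nonpos_Ints_nonpos)
    have p: "Gamma (real m + 3/2) \<noteq> 0" "Gamma (real m + \<nu> + 3/2) \<noteq> 0"
      using assms by (intro less_imp_neq[symmetric] Gamma_real_pos; simp)+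
    have q: "real m + \<nu> + 3/2 > 0" using assms by simp
    have e: "real (Suc m) + 3/2 = real m + 3/2 + 1" "real (Suc m) + \<nu> + 3/2 = real m + \<nu> + 3/2 + 1"
      by simp_all
    show ?thesis
      unfolding a_def e 1 2 using p q
      by (simp add: abs_mult power_abs)
  qed
  have "filterlim (\<lambda>m. (real m + 3/2) * (real m + \<nu> + 3/2)) at_top sequentially"
    by real_asymp
  hence "(\<lambda>m. ereal (norm (complex_of_real (a m)) / norm (complex_of_real (a (Suc m))))) \<longlonglongrightarrow> \<infinity>"
    by (simp only: norm_of_real real_norm_def ratio tendsto_PInfty_eq_at_top)
  hence "conv_radius (\<lambda>m. complex_of_real (a m)) = \<infinity>"
    using nz by (intro conv_radius_ratio_limit_ereal) auto
  hence rad: "fps_conv_radius F = \<infinity>"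
    by (simp add: fps_conv_radius_def F_def)
  define G where "G = (\<lambda>z. of_real (1 / 2 powr (\<nu> + 1)) * eval_fps F ((z / 2)\<^sup>2))"
  have real: "eval_fps F (of_real y) = of_real (\<Sum>m. a m * y ^ m)" for y :: real
  proof -
    have "summable (\<lambda>m. complex_of_real (a m) * of_real y ^ m)"
      using summable_fps[of "of_real y" F] rad by (simp add: F_def)
    hence "summable (\<lambda>m. complex_of_real (a m * y ^ m))" by simp
    hence "summable (\<lambda>m. a m * y ^ m)" by (rule summable_complex_of_real[THEN iffD1])
    thus ?thesis by (simp add: eval_fps_def F_def suminf_of_real)
  qed
  have Gx: "G (of_real x) = of_real (1 / 2 powr (\<nu> + 1) * (\<Sum>m. a m * ((x/2)\<^sup>2) ^ m))" for x :: real
    using real[of "(x/2)\<^sup>2"] by (simp add: G_def)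
  show thesis
  proof (rule that)
    have "eval_fps F holomorphic_on UNIV"
      using holomorphic_on_eval_fps[of UNIV F] rad by simp
    hence "eval_fps F \<circ> (\<lambda>z. (z / 2)\<^sup>2) holomorphic_on UNIV"
      by (intro holomorphic_on_compose holomorphic_intros)
         (auto simp: rad)
    thus "G holomorphic_on UNIV"
      unfolding G_def o_def by (intro holomorphic_intros)
    show "G (of_real x) \<in> \<real>" for x :: real by (simp only: Gx Reals_of_real)
    show "struve_H \<nu> x = x powr (\<nu> + 1) * Re (G (of_real x))" if "x > 0" for x
      using that unfolding Gx
      by (simp add: struve_H_def a_def powr_divide power_mult)
  qed
qed

lemma struve_H_deriv_entire_factor:
  assumes "\<nu> > -3/2"
  obtains G where "G holomorphic_on UNIV" "\<And>x::real. G (of_real x) \<in> \<real>"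
    "\<And>x. x > 0 \<Longrightarrow> struve_H_deriv n \<nu> x = x powr (\<nu> + 1 - real n) * Re (G (of_real x))"
    "\<And>x. x > 0 \<Longrightarrow> struve_H_deriv (Suc n) \<nu> x =
       x powr (\<nu> - real n) * ((\<nu> + 1 - real n) * Re (G (of_real x)) + x * Re (deriv G (of_real x)))"
proof -
  define P where "P n G \<longleftrightarrow> G holomorphic_on UNIV \<and> (\<forall>x::real. G (of_real x) \<in> \<real>) \<and>
    (\<forall>x>0. struve_H_deriv n \<nu> x = x powr (\<nu> + 1 - real n) * Re (G (of_real x)))"
    for n and G :: "complex \<Rightarrow> complex"
  have step: "struve_H_deriv (Suc n) \<nu> x =
       x powr (\<nu> - real n) * ((\<nu> + 1 - real n) * Re (G (of_real x)) + x * Re (deriv G (of_real x)))"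
    if "P n G" "x > 0" for n G x
  proof -
    have G: "G holomorphic_on UNIV" "\<And>x::real. G (of_real x) \<in> \<real>"
      "\<And>x. x > 0 \<Longrightarrow> struve_H_deriv n \<nu> x = x powr (\<nu> + 1 - real n) * Re (G (of_real x))"
      using that(1) by (auto simp: P_def)
    have d: "((\<lambda>t. t powr (\<nu> + 1 - real n) * Re (G (of_real t))) has_real_derivative
        ((\<nu> + 1 - real n) * x powr (\<nu> + 1 - real n - 1)) * Re (G (of_real x))
        + Re (deriv G (of_real x)) * x powr (\<nu> + 1 - real n)) (at x)"
      using \<open>x > 0\<close> by (intro DERIV_mult has_real_derivative_powr deriv_real_entire G)
    have "eventually (\<lambda>t. t \<in> {0<..}) (nhds x)"
      using \<open>x > 0\<close> by (intro eventually_nhds_in_open) auto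
    hence ev: "eventually (\<lambda>t. t powr (\<nu> + 1 - real n) * Re (G (of_real t)) = struve_H_deriv n \<nu> t) (nhds x)"
      by (rule eventually_mono) (simp add: G(3))
    have "(struve_H_deriv n \<nu> has_real_derivative
        ((\<nu> + 1 - real n) * x powr (\<nu> + 1 - real n - 1)) * Re (G (of_real x))
        + Re (deriv G (of_real x)) * x powr (\<nu> + 1 - real n)) (at x)"
      using DERIV_cong_ev[OF refl ev refl] d by blast
    hence "deriv (struve_H_deriv n \<nu>) x = 
        ((\<nu> + 1 - real n) * x powr (\<nu> + 1 - real n - 1)) * Re (G (of_real x))
        + Re (deriv G (of_real x)) * x powr (\<nu> + 1 - real n)"
      by (rule DERIV_imp_deriv)
    moreover have "x powr (\<nu> + 1 - real n) = x * x powr (\<nu> - real n)"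
      using powr_add[of x 1 "\<nu> - real n"] \<open>x > 0\<close> by (simp add: algebra_simps)
    ultimately show ?thesis by (simp add: algebra_simps)
  qed
  have "\<exists>G. P n G"
  proof (induction n)
    case 0
    obtain G where "G holomorphic_on UNIV" "\<And>x::real. G (of_real x) \<in> \<real>"
      "\<And>x. x > 0 \<Longrightarrow> struve_H \<nu> x = x powr (\<nu> + 1) * Re (G (of_real x))"
      using struve_H_entire_factor[OF assms] by blast
    hence "P 0 G" by (simp add: P_def)
    thus ?case by blast
  next
    case (Suc n)
    then obtain G where G: "P n G" by blast
    define K where "K = (\<lambda>z. of_real (\<nu> + 1 - real n) * G z + z * deriv G z)"
    have hol: "G holomorphic_on UNIV" and re: "G (of_real x) \<in> \<real>" for x :: real
      using G by (auto simp: P_def)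
    have "K holomorphic_on UNIV"
      unfolding K_def using hol by (intro holomorphic_intros) auto
    moreover have "K (of_real x) \<in> \<real>" for x :: real
      unfolding K_def using re deriv_real_entire(2)[OF hol re] by (intro Reals_add Reals_mult) auto
    ultimately have "P (Suc n) K"
      unfolding P_def using step[OF G] by (auto simp: K_def)
    thus ?case by blast
  qed
  then obtain G where "P n G" by blast
  thus thesis using that[of G] step[of n G] by (auto simp: P_def)
qed

lemma
  assumes "\<nu> > -3/2"
  shows holomorphic_struve_entire: "struve_entire n \<nu> holomorphic_on UNIV"
    and struve_entire_of_real: "x > 0 \<Longrightarrow>
      struve_entire n \<nu> (of_real x) = of_real (x powr (real n - \<nu> - 1) * struve_H_deriv n \<nu> x)"
    and struve_comb_entire_eq_deriv: "struve_comb_entire n \<nu> = deriv (struve_entire n \<nu>)"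
    and struve_comb_entire_of_real: "x > 0 \<Longrightarrow>
      struve_comb_entire n \<nu> (of_real x) = of_real (x powr (real n - \<nu> - 2) *
        ((real n - \<nu> - 1) * struve_H_deriv n \<nu> x + x * struve_H_deriv (Suc n) \<nu> x))"
proof -
  obtain G where hol: "G holomorphic_on UNIV" and re: "\<And>x::real. G (of_real x) \<in> \<real>"
    and H: "\<And>x. x > 0 \<Longrightarrow> struve_H_deriv n \<nu> x = x powr (\<nu> + 1 - real n) * Re (G (of_real x))"
    and H': "\<And>x. x > 0 \<Longrightarrow> struve_H_deriv (Suc n) \<nu> x =
       x powr (\<nu> - real n) * ((\<nu> + 1 - real n) * Re (G (of_real x)) + x * Re (deriv G (of_real x)))"
    using struve_H_deriv_entire_factor[OF assms] by blast
  have ReG: "complex_of_real (Re (G (of_real x))) = G (of_real x)" for x :: real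
    using re by (simp add: of_real_Re)
  have ReG': "complex_of_real (Re (deriv G (of_real x))) = deriv G (of_real x)" for x :: real
    using deriv_real_entire(2)[OF hol re] by (simp add: of_real_Re)
  have E: "G (of_real x) = of_real (x powr (real n - \<nu> - 1) * struve_H_deriv n \<nu> x)" if "x > 0" for x
  proof -
    have "x powr (real n - \<nu> - 1) * x powr (\<nu> + 1 - real n) = 1"
      using that by (simp flip: powr_add)
    thus ?thesis using H[OF that] ReG[of x] by (simp flip: mult.assoc)
  qed
  have D: "deriv G (of_real x) = of_real (x powr (real n - \<nu> - 2) *
        ((real n - \<nu> - 1) * struve_H_deriv n \<nu> x + x * struve_H_deriv (Suc n) \<nu> x))"
    if "x > 0" for x
  proof -
    have a: "x powr (\<nu> + 1 - real n) = x * x powr (\<nu> - real n)"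
      using powr_add[of x 1 "\<nu> - real n"] that by (simp add: algebra_simps)
    have b: "x powr (real n - \<nu> - 2) * (x * x powr (\<nu> - real n) * x) = 1"
    proof -
      have "x * x powr (\<nu> - real n) * x = x powr (1 + (\<nu> - real n) + 1)"
        using that by (simp only: powr_add powr_one)
      moreover have "x powr (real n - \<nu> - 2) * x powr (1 + (\<nu> - real n) + 1) = 1"
        using that by (simp flip: powr_add)
      ultimately show ?thesis by (simp only:)
    qed
    have "(real n - \<nu> - 1) * struve_H_deriv n \<nu> x + x * struve_H_deriv (Suc n) \<nu> x
      = (x * x powr (\<nu> - real n) * x) * Re (deriv G (of_real x))"
      unfolding H[OF that] H'[OF that] a by (simp add: algebra_simps)
    hence "x powr (real n - \<nu> - 2) *
        ((real n - \<nu> - 1) * struve_H_deriv n \<nu> x + x * struve_H_deriv (Suc n) \<nu> x)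
      = Re (deriv G (of_real x))" using b by (simp only: mult.assoc[symmetric] mult_1_left)
    thus ?thesis using ReG'[of x] by simp
  qed
  have 1: "struve_entire n \<nu> = G"
    unfolding struve_entire_def using hol E by (rule entire_extension_eqI)
  have 2: "struve_comb_entire n \<nu> = deriv G"
    unfolding struve_comb_entire_def
    by (rule entire_extension_eqI) (use hol D in \<open>auto intro: holomorphic_deriv\<close>)
  show "struve_entire n \<nu> holomorphic_on UNIV" using 1 hol by simp
  show "struve_comb_entire n \<nu> = deriv (struve_entire n \<nu>)" using 1 2 by simp
  show "x > 0 \<Longrightarrow>
      struve_entire n \<nu> (of_real x) = of_real (x powr (real n - \<nu> - 1) * struve_H_deriv n \<nu> x)"
    using 1 E by simp
  show "x > 0 \<Longrightarrow> struve_comb_entire n \<nu> (of_real x) = of_real (x powr (real n - \<nu> - 2) *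
        ((real n - \<nu> - 1) * struve_H_deriv n \<nu> x + x * struve_H_deriv (Suc n) \<nu> x))"
    using 2 D by simp
qed

end

(* A function is called vmono here if its modulus is nondecreasing along vertical rays leaving the
   real axis; for entire functions this says that f'/f maps the upper half-plane to the closed lower
   one.  The property passes to products and pointwise limits, it excludes non-real zeros of f, of f'
   and of c f + z f' (c > 0), and on the real line it yields Laguerre's inequality f f'' < f'^2 where
   f is nonzero.  The latter gives all the interlacing statements, because f'/f is then strictly
   decreasing between zeros.

   H_nu is, up to a power of x, the sine transform of the weight (1 - t^2)^(nu - 1/2), which has
   nonnegative Taylor coefficients in t^2 and hence is increasing.  Riemann sums of such a transform
   are replaced by sums of Chebyshev polynomials U_(k-1)(1 - z^2/(2 n^2)) with increasing
   coefficients; by the arguments of Enestrom-Kakeya and Schur these polynomials have only real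
   zeros.  For nu < 1/2 the zeros of H_nu are simple: at a double zero the Struve differential
   equation forces a positive second derivative, but adding a small constant to the weight stays in
   the class and would violate Laguerre's inequality there.  The functions belonging to H_nu' and
   H_nu'' arise by f -> c f + z f' with c = nu + 1 and then c = nu. *)

theory Submission
  imports Defs "HOL-Computational_Algebra.Fundamental_Theorem_Algebra"
begin

subsection \<open>Entire functions whose modulus grows away from the real axis\<close>

text \<open>Monotonicity of the modulus stands in for reality of the zeros because it is a
  non-strict inequality between values at two points: it survives pointwise limits with no appeal to
  Hurwitz's theorem or to Hadamard factorizations. Strictness is recovered afterwards from the open
  mapping theorem and a local factorization, applied to f'/f, which is not constant for the
  functions at hand.

  A Riemann sum of a sine transform combines functions sin(k z/n), which are not polynomials. With 2
  - 2 cos \<phi> = z^2/n^2 one has \<phi> close to z/n, and sin(k \<phi>)/sin \<phi> is the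
  Chebyshev polynomial in z^2 used instead; the limit is the same, and polynomials split into linear
  factors.

  Both ends of the range of \<nu> are degenerate. At -1/2 the weight is not integrable and is
  replaced by a unit mass at t = 1, whose transform is the sine. At 1/2 the weight is constant and 1
  - cos x has double zeros, so interlacing must count multiplicities. In between, perturbing the
  weight excludes double zeros only where cos x differs from 1; elsewhere the sign of the transform
  decides.\<close>

definition vmono :: "(complex \<Rightarrow> complex) \<Rightarrow> bool" where
  "vmono f \<longleftrightarrow> (\<forall>x y y'. 0 \<le> y \<longrightarrow> y \<le> y' \<longrightarrow> norm (f (Complex x y)) \<le> norm (f (Complex x y')))"

lemma vmonoD: "vmono f \<Longrightarrow> 0 \<le> y \<Longrightarrow> y \<le> y' \<Longrightarrow> norm (f (Complex x y)) \<le> norm (f (Complex x y'))"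
  by (auto simp: vmono_def)

lemma vmono_mult: "vmono f \<Longrightarrow> vmono g \<Longrightarrow> vmono (\<lambda>z. f z * g z)"
  by (auto simp: vmono_def norm_mult intro!: mult_mono)

lemma vmono_const: "vmono (\<lambda>_. c)"
  by (auto simp: vmono_def)

lemma vmono_cmult: "vmono f \<Longrightarrow> vmono (\<lambda>z. c * f z)"
  by (intro vmono_mult vmono_const)

lemma vmono_linear: "vmono (\<lambda>z. z - of_real r)"
  unfolding vmono_def by (auto simp: cmod_def intro!: power_mono)

lemma vmono_limit:
  assumes "\<And>n. vmono (f n)" "\<And>z. (\<lambda>n. f n z) \<longlonglongrightarrow> g z"
  shows "vmono g"
  unfolding vmono_def
proof (intro allI impI)
  fix x y y' :: real assume "0 \<le> y" "y \<le> y'"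
  show "norm (g (Complex x y)) \<le> norm (g (Complex x y'))"
    by (rule LIMSEQ_le[OF tendsto_norm[OF assms(2)] tendsto_norm[OF assms(2)]])
       (use assms(1) \<open>0 \<le> y\<close> \<open>y \<le> y'\<close> in \<open>auto simp: vmono_def\<close>)
qed

lemma Im_of_real_mult: "Im (of_real a * z) = a * Im z"
  by simp

text \<open>Along a vertical ray the derivative of |f|^2 in y is -2 Im (f' cnj f), which cannot be
  negative. Divided by |f|^2 this is the half-plane statement about f'/f.\<close>

lemma vmono_Im_le:
  assumes f: "f holomorphic_on UNIV" "vmono f" and z: "Im z > 0"
  shows "Im (deriv f z * cnj (f z)) \<le> 0"
proof -
  define x y where "x = Re z" "y = Im z"
  have zc: "z = Complex x y" by (simp add: x_y_def)
  define h where "h = (\<lambda>t. f (of_real x + \<i> * of_real t))"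
  have zeq: "of_real x + \<i> * of_real y = z" by (simp add: zc complex_eq_iff)
  have "(f has_field_derivative deriv f z) (at z)"
    using f(1) by (simp add: holomorphic_derivI)
  hence "((\<lambda>w. f (of_real x + \<i> * w)) has_field_derivative deriv f z * \<i>) (at (of_real y))"
    by (intro DERIV_chain2[of f "deriv f z"]) (auto simp: zeq intro!: derivative_eq_intros)
  hence d: "(h has_vector_derivative deriv f z * \<i>) (at y)"
    unfolding h_def by (rule has_vector_derivative_real_field)
  have r: "((\<lambda>t. Re (h t)) has_real_derivative Re (deriv f z * \<i>)) (at y)"
    using bounded_linear.has_vector_derivative[OF bounded_linear_Re d]
    by (simp add: has_real_derivative_iff_has_vector_derivative)
  have i: "((\<lambda>t. Im (h t)) has_real_derivative Im (deriv f z * \<i>)) (at y)"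
    using bounded_linear.has_vector_derivative[OF bounded_linear_Im d]
    by (simp add: has_real_derivative_iff_has_vector_derivative)
  have hy: "h y = f z" by (simp add: h_def zeq)
  have "((\<lambda>t. (Re (h t))\<^sup>2 + (Im (h t))\<^sup>2) has_real_derivative
      - 2 * Im (deriv f z * cnj (f z))) (at y)"
    by (rule derivative_eq_intros r i refl | simp add: hy algebra_simps)+
  moreover have "mono_on {0<..} (\<lambda>t. (Re (h t))\<^sup>2 + (Im (h t))\<^sup>2)"
  proof (rule mono_onI)
    fix s t :: real assume "s \<in> {0<..}" "s \<le> t"
    moreover have e: "of_real x + \<i> * of_real s = Complex x s" for s by (simp add: complex_eq_iff)
    ultimately have "norm (h s) \<le> norm (h t)"
      unfolding h_def e using f(2) by (auto intro!: vmonoD)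
    hence "(norm (h s))\<^sup>2 \<le> (norm (h t))\<^sup>2" by (intro power_mono) auto
    thus "(Re (h s))\<^sup>2 + (Im (h s))\<^sup>2 \<le> (Re (h t))\<^sup>2 + (Im (h t))\<^sup>2" by (simp add: cmod_power2)
  qed
  ultimately have "- 2 * Im (deriv f z * cnj (f z)) \<ge> 0"
    by (intro mono_on_imp_deriv_nonneg[of "{0<..}" _ _ y]) (use z in \<open>auto simp: x_y_def
        interior_open\<close>)
  thus ?thesis by linarith
qed

text \<open>A zero at z would force f to vanish on the whole vertical segment from the real axis up
  to z, hence identically by analytic continuation.\<close>

lemma vmono_nonzero:
  assumes f: "f holomorphic_on UNIV" "vmono f" and w: "f w \<noteq> 0" and z: "Im z > 0"
  shows "f z \<noteq> 0"
proof
  assume fz: "f z = 0"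
  define S where "S = (\<lambda>t. Complex (Re z) (t * Im z)) ` {0..1}"
  have zero: "f s = 0" if "s \<in> S" for s
  proof -
    from that obtain t where t: "0 \<le> t" "t \<le> 1" "s = Complex (Re z) (t * Im z)"
        by (auto simp: S_def)
    have "norm (f s) \<le> norm (f (Complex (Re z) (Im z)))"
      unfolding t(3) using f(2) t z by (intro vmonoD) (auto simp: mult_left_le_one_le)
    thus ?thesis using fz by simp
  qed
  have "z islimpt S"
    unfolding islimpt_sequential
  proof (intro exI[of _ "\<lambda>n. Complex (Re z) ((1 - inverse (real (Suc n))) * Im z)"] conjI allI)
    fix n :: nat
    have "inverse (real (Suc n)) \<le> 1" "inverse (real (Suc n)) > 0" by (auto simp: field_simps)
    thus "Complex (Re z) ((1 - inverse (real (Suc n))) * Im z) \<in> S - {z}"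
      using z unfolding S_def by (auto simp: complex_eq_iff)
  next
    have "(\<lambda>n. (1 - inverse (real (Suc n))) * Im z) \<longlonglongrightarrow> (1 - 0) * Im z"
      by (intro tendsto_intros LIMSEQ_inverse_real_of_nat)
    hence "(\<lambda>n. Complex (Re z) ((1 - inverse (real (Suc n))) * Im z)) \<longlonglongrightarrow> Complex (Re z) (Im z)"
      by (intro tendsto_Complex) auto
    thus "(\<lambda>n. Complex (Re z) ((1 - inverse (real (Suc n))) * Im z)) \<longlonglongrightarrow> z" by simp
  qed
  hence "f w = 0"
    by (intro analytic_continuation[of f UNIV S z w]) (use f(1) zero in auto)
  with w show False by simp
qed

text \<open>A zero would give f'/f = -c/z, whose imaginary part is positive in the upper half-plane,
  against \<open>vmono_Im_le\<close>.\<close>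

lemma vmono_euler_nonzero:
  assumes f: "f holomorphic_on UNIV" "vmono f" and w: "f w \<noteq> 0" and z: "Im z > 0" and c: "c > 0"
  shows "of_real c * f z + z * deriv f z \<noteq> 0"
proof
  assume "of_real c * f z + z * deriv f z = 0"
  moreover have z0: "z \<noteq> 0" using z by auto
  ultimately have d: "deriv f z = - (of_real c * f z) * inverse z"
    by (simp add: field_simps add_eq_0_iff)
  have "deriv f z * cnj (f z) = - of_real c * (f z * cnj (f z)) * inverse z"
    unfolding d by (simp only: mult_ac mult_minus_left mult_minus_right)
  also have "\<dots> = of_real (- c * (norm (f z))\<^sup>2) * inverse z"
    by (simp add: complex_norm_square del: of_real_power)
  finally have "Im (deriv f z * cnj (f z)) = - c * (norm (f z))\<^sup>2 * Im (inverse z)"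
    by (simp only: Im_of_real_mult)
  also have "Im (inverse z) < 0" using z z0 by (simp add: divide_neg_pos complex_neq_0)
  hence "- c * (norm (f z))\<^sup>2 * Im (inverse z) > 0"
    using c vmono_nonzero[OF f w z] by (intro mult_neg_neg) auto
  finally show False using vmono_Im_le[OF f z] by simp
qed

lemma deriv_nonzero_of_Im_nonpos:
  assumes g: "g holomorphic_on S" "open S" "connected S" "of_real x \<in> S" "\<not> g constant_on S"
    and Im: "\<And>z. z \<in> S \<Longrightarrow> Im z > 0 \<Longrightarrow> Im (g z) \<le> 0" and re: "g (of_real x) \<in> \<real>"
  shows "deriv g (of_real x) \<noteq> 0" "Re (deriv g (of_real x)) \<le> 0"
proof -
  \<comment> \<open>If \<open>g z - g x\<close> vanished to order \<open>n \<ge> 2\<close> at \<open>x\<close>, then \<open>(z - x)\<^sup>n\<close> would map the upper half-disc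
     over all directions, so the imaginary part would become positive somewhere.\<close>
  define \<xi> where "\<xi> = complex_of_real x"
  have nc: "\<not> (\<lambda>z. g z - g \<xi>) constant_on S"
    using g(5) by (auto simp: constant_on_def) (metis diff_add_cancel)
  obtain k r n where kr: "0 < n" "0 < r" "ball \<xi> r \<subseteq> S" "k holomorphic_on ball \<xi> r"
      "\<And>w. w \<in> ball \<xi> r \<Longrightarrow> g w - g \<xi> = (w - \<xi>)^n * k w" "\<And>w. w \<in> ball \<xi> r \<Longrightarrow> k w \<noteq> 0"
  proof (rule holomorphic_factor_zero_nonconstant[of "\<lambda>z. g z - g \<xi>" S \<xi>])
    show "(\<lambda>z. g z - g \<xi>) holomorphic_on S" using g by (intro holomorphic_intros)
  qed (use g nc in \<open>auto simp: \<xi>_def\<close>)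
  have kcont: "isCont k \<xi>"
    using kr(2,4) by (metis centre_in_ball continuous_on_eq_continuous_at
        holomorphic_on_imp_continuous_on open_ball)
  \<comment> \<open>Approach \<open>\<xi>\<close> along the direction \<theta>: after division by
    t^n > 0 the leading coefficient inherits the sign of Im g.\<close>
  have key: "Im (cis (real n * \<theta>) * k \<xi>) \<le> 0" if \<theta>: "0 < \<theta>" "\<theta> < pi" for \<theta> :: real
  proof (rule tendsto_upperbound)
    have "((\<lambda>t. \<xi> + of_real t * cis \<theta>) \<longlongrightarrow> \<xi> + of_real 0 * cis \<theta>) (at_right 0)"
      by (intro tendsto_intros)
    hence "((\<lambda>t. k (\<xi> + of_real t * cis \<theta>)) \<longlongrightarrow> k \<xi>) (at_right 0)"
      using kcont by (intro isCont_tendsto_compose[of _ k]) auto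
    thus "((\<lambda>t. Im (cis (real n * \<theta>) * k (\<xi> + of_real t * cis \<theta>))) \<longlongrightarrow> Im (cis (real n * \<theta>) * k \<xi>))
        (at_right 0)"
      by (intro tendsto_intros)
    have "eventually (\<lambda>t. t \<in> {0<..<r}) (at_right (0::real))"
      using kr(2) by (rule eventually_at_right_real)
    thus "eventually (\<lambda>t. Im (cis (real n * \<theta>) * k (\<xi> + of_real t * cis \<theta>)) \<le> 0) (at_right 0)"
    proof eventually_elim
      case (elim t)
      define w where "w = \<xi> + of_real t * cis \<theta>"
      have w: "w \<in> ball \<xi> r" using elim by (simp add: w_def dist_norm norm_mult)
      have "Im w > 0" using elim sin_gt_zero[OF \<theta>] by (simp add: w_def \<xi>_def)
      hence "Im (g w - g \<xi>) \<le> 0"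
        using Im[of w] w kr(3) re by (auto simp: \<xi>_def complex_is_Real_iff)
      also have "g w - g \<xi> = of_real (t ^ n) * (cis (real n * \<theta>) * k w)"
        using kr(5)[OF w] by (simp add: w_def power_mult_distrib Complex.DeMoivre)
      finally have "t ^ n * Im (cis (real n * \<theta>) * k w) \<le> 0" by (simp only: Im_of_real_mult)
      moreover have "t ^ n > 0" using elim by simp
      ultimately have "Im (cis (real n * \<theta>) * k w) \<le> 0" by (metis mult_le_0_iff not_less)
      thus ?case by (simp only: w_def)
    qed
  qed simp
  have n1: "n = 1"
  proof (rule ccontr)
    assume "n \<noteq> 1"
    with kr(1) have n2: "real n \<ge> 2" by simp
    define \<alpha> where "\<alpha> = Arg (k \<xi>)"
    have \<alpha>: "- pi < \<alpha>" "\<alpha> \<le> pi" using Arg_bounded[of "k \<xi>"] by (auto simp: \<alpha>_def)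
    have k0: "k \<xi> = of_real (norm (k \<xi>)) * cis \<alpha>" "norm (k \<xi>) > 0"
      using rcis_cmod_Arg[of "k \<xi>"] kr(2,6) by (auto simp: \<alpha>_def rcis_def)
    \<comment> \<open>With \<beta> = n \<theta>, the directions \<theta> in (0, pi) reach every
      \<beta> in (0, 2 pi), because n \<ge> 2. That is enough room to steer \<beta> + \<alpha> to a
      point with positive sine.\<close>
    have contra: False if b: "0 < \<beta>" "\<beta> < 2 * pi" "sin (\<beta> + \<alpha>) > 0" for \<beta> :: real
    proof -
      have "\<beta> < pi * real n" using b(2) mult_left_mono[OF n2, of pi] pi_ge_zero by linarith
      hence "Im (cis (real n * (\<beta> / real n)) * k \<xi>) \<le> 0"
        using n2 b by (intro key) (auto simp: field_simps)
      also have "real n * (\<beta> / real n) = \<beta>" using n2 by simp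
      also have "cis \<beta> * k \<xi> = of_real (norm (k \<xi>)) * cis (\<beta> + \<alpha>)"
        by (subst k0(1)) (simp add: cis_mult mult.left_commute)
      also have "Im \<dots> = norm (k \<xi>) * sin (\<beta> + \<alpha>)" by simp
      finally show False using k0(2) b(3) by (simp add: mult_le_0_iff)
    qed
    show False
    \<comment> \<open>The target \<beta> + \<alpha> = pi/2 requires \<alpha> < pi/2. For \<alpha> in
      [pi/2, pi] the target is pi/4 + 2 pi, which puts \<beta> between 5 pi/4 and 7 pi/4.\<close>
    proof (cases "\<alpha> < pi / 2")
      case True
      show ?thesis using contra[of "pi / 2 - \<alpha>"] \<alpha> True by simp
    next
      case False
      have e: "9 * pi / 4 - \<alpha> + \<alpha> = pi / 4 + 2 * pi" by simp
      have "sin (9 * pi / 4 - \<alpha> + \<alpha>) > 0" unfolding e sin_periodic by (simp add: sin_45)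
      thus ?thesis using contra[of "9 * pi / 4 - \<alpha>"] \<alpha> False pi_gt_zero by linarith
    qed
  qed
  have "((\<lambda>w. g \<xi> + (w - \<xi>) * k w) has_field_derivative
      (1 * k \<xi> + deriv k \<xi> * (\<xi> - \<xi>))) (at \<xi>)"
    using holomorphic_derivI[OF kr(4), of \<xi>] kr(2)
    by (auto intro!: derivative_eq_intros)
  hence "(g has_field_derivative k \<xi>) (at \<xi>)"
  proof (subst (asm) DERIV_cong_ev[OF refl _ refl, of _ g])
    have "eventually (\<lambda>w. w \<in> ball \<xi> r) (nhds \<xi>)"
      using kr(2) by (intro eventually_nhds_in_open) auto
    thus "eventually (\<lambda>w. g \<xi> + (w - \<xi>) * k w = g w) (nhds \<xi>)"
      by eventually_elim (use kr(5) n1 in \<open>auto simp: algebra_simps\<close>)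
  qed auto
  hence d: "deriv g \<xi> = k \<xi>" by (rule DERIV_imp_deriv)
  show "deriv g (of_real x) \<noteq> 0" using d kr(2,6) by (auto simp: \<xi>_def)
  \<comment> \<open>The vertical direction multiplies \<open>k \<xi>\<close> by \<i>, and the
    imaginary part of the product is Re (\<open>k \<xi>\<close>).\<close>
  show "Re (deriv g (of_real x)) \<le> 0" using key[of "pi / 2"] n1 d by (simp add: \<xi>_def)
qed

section \<open>Even entire functions of the class: real zeros and Laguerre's inequality\<close>

locale even_vmono =
  fixes f :: "complex \<Rightarrow> complex"
  assumes hol: "f holomorphic_on UNIV"
    and mono: "vmono f"
    and even: "f (- z) = f z"
    and real: "f (of_real x) \<in> \<real>"
    and zero: "f 0 \<noteq> 0"
    and deriv2_zero: "deriv (deriv f) 0 \<noteq> 0"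
begin

lemma hol': "deriv f holomorphic_on UNIV"
  using hol by (intro holomorphic_deriv) auto

lemma has_deriv: "(f has_field_derivative deriv f z) (at z)"
  using hol by (simp add: holomorphic_derivI)

lemma has_deriv2: "(deriv f has_field_derivative deriv (deriv f) z) (at z)"
  using hol' by (simp add: holomorphic_derivI)

lemma deriv_odd: "deriv f (- z) = - deriv f z"
proof -
  have "((\<lambda>w. f (- w)) has_field_derivative deriv f (- z) * (- 1)) (at z)"
    by (intro DERIV_chain2[of f] has_deriv) (auto intro!: derivative_eq_intros)
  moreover have "(\<lambda>w. f (- w)) = f" by (simp add: even)
  ultimately show ?thesis using DERIV_unique[OF has_deriv[of z]] by fastforce
qed

lemma deriv_zero: "deriv f 0 = 0"
  using deriv_odd[of 0] by simp

text \<open>A constant quotient c gives f' = c f everywhere. At 0, where f' vanishes by oddness and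
  f does not, this yields c = 0, so f' = 0, against the nonzero second derivative at 0.\<close>

lemma logderiv_not_constant:
  assumes "open S" "S \<noteq> {}" "\<And>z. z \<in> S \<Longrightarrow> f z \<noteq> 0"
  shows "\<not> (\<lambda>z. deriv f z / f z) constant_on S"
proof
  assume "(\<lambda>z. deriv f z / f z) constant_on S"
  then obtain c where c: "\<And>z. z \<in> S \<Longrightarrow> deriv f z = c * f z"
    using assms(3) unfolding constant_on_def by (metis nonzero_eq_divide_eq)
  have "(\<lambda>z. deriv f z - c * f z) w = 0" for w
  proof -
    obtain s where s: "s \<in> S" using assms(2) by auto
    show ?thesis
      by (rule analytic_continuation[of "\<lambda>z. deriv f z - c * f z" UNIV S s])
         (use hol hol' c s assms(1) in \<open>auto intro!: holomorphic_intros interior_limit_point simp: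
             interior_open\<close>)
  qed
  hence e: "deriv f w = c * f w" for w by simp
  hence "c = 0" using deriv_zero zero by (metis mult_eq_0_iff)
  hence "deriv f = (\<lambda>_. 0)" using e by auto
  thus False using deriv2_zero by simp
qed

lemma nonzero: "Im z > 0 \<Longrightarrow> f z \<noteq> 0"
  using vmono_nonzero[OF hol mono zero] .

lemma real_zero: "f z = 0 \<Longrightarrow> z \<in> \<real>"
  using nonzero[of z] nonzero[of "- z"] even[of z] by (cases "Im z" "0::real" rule: linorder_cases)
      (auto simp: complex_is_Real_iff)

lemma Im_logderiv: "Im z > 0 \<Longrightarrow> Im (deriv f z / f z) \<le> 0"
proof -
  assume z: "Im z > 0"
  have "Im (deriv f z / f z) = Im (deriv f z * cnj (f z)) / (norm (f z))\<^sup>2"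
    by (subst complex_div_cnj) (simp only: Im_divide_of_real flip: of_real_power)
  thus ?thesis using vmono_Im_le[OF hol mono z] by (simp add: divide_nonpos_nonneg)
qed

text \<open>By the open mapping theorem a value 0 of f'/f in the upper half-plane would come with
  nearby values of positive imaginary part.\<close>

lemma deriv_nonzero: "Im z > 0 \<Longrightarrow> deriv f z \<noteq> 0"
proof
  assume z: "Im z > 0" and d: "deriv f z = 0"
  define U where "U = {z. Im z > 0}"
  have U: "open U" "connected U" "z \<in> U"
    using z by (auto simp: U_def open_halfspace_Im_gt intro!: convex_connected
        convex_halfspace_Im_gt)
  define g where "g = (\<lambda>z. deriv f z / f z)"
  have "open (g ` U)"
  proof (rule open_mapping_thm[of g U])
    show "g holomorphic_on U" unfolding g_def U_def
      by (intro holomorphic_intros holomorphic_on_subset[OF hol] holomorphic_on_subset[OF hol'])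
         (auto simp: nonzero)
    show "\<not> g constant_on U" unfolding g_def
      by (rule logderiv_not_constant) (use U in \<open>auto simp: nonzero U_def\<close>)
  qed (use U in auto)
  moreover have "0 \<in> g ` U" using U(3) d by (auto simp: g_def image_iff intro!: bexI[of _ z])
  ultimately obtain e where e: "e > 0" "ball 0 e \<subseteq> g ` U" by (metis open_contains_ball)
  have "\<i> * of_real (e / 2) \<in> ball 0 e" using e(1) by (simp add: norm_mult)
  then obtain w where w: "w \<in> U" "g w = \<i> * of_real (e / 2)" using e(2) by (metis imageE subsetD)
  have "Im (g w) \<le> 0" using Im_logderiv[of w] w(1) by (simp add: U_def g_def)
  thus False using w(2) e(1) by simp
qed

lemma deriv_real_zero: "deriv f z = 0 \<Longrightarrow> z \<in> \<real>"
  using deriv_nonzero[of z] deriv_nonzero[of "- z"] deriv_odd[of z]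
  by (cases "Im z" "0::real" rule: linorder_cases) (auto simp: complex_is_Real_iff)

lemma euler_real_zero:
  assumes "c > 0" "of_real c * f z + z * deriv f z = 0"
  shows "z \<in> \<real>"
proof -
  have "\<not> Im z > 0" using vmono_euler_nonzero[OF hol mono zero _ assms(1)] assms(2) by blast
  moreover have "of_real c * f (- z) + (- z) * deriv f (- z) = 0"
    using assms(2) by (simp add: even deriv_odd)
  hence "\<not> Im (- z) > 0" using vmono_euler_nonzero[OF hol mono zero _ assms(1), of "- z"] by blast
  ultimately show ?thesis by (simp add: complex_is_Real_iff)
qed

definition u :: "real \<Rightarrow> real" where "u x = Re (f (of_real x))"
definition u' :: "real \<Rightarrow> real" where "u' x = Re (deriv f (of_real x))"
definition u'' :: "real \<Rightarrow> real" where "u'' x = Re (deriv (deriv f) (of_real x))"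

lemma u_deriv: "(u has_real_derivative u' x) (at x)"
  using deriv_real_entire(1)[OF hol real] by (simp add: u_def[abs_def] u'_def)

lemma deriv_real: "deriv f (of_real x) \<in> \<real>"
  using deriv_real_entire(2)[OF hol real] .

lemma u'_deriv: "(u' has_real_derivative u'' x) (at x)"
  using deriv_real_entire(1)[OF hol' deriv_real] by (simp add: u'_def[abs_def] u''_def)

lemma deriv2_real: "deriv (deriv f) (of_real x) \<in> \<real>"
  using deriv_real_entire(2)[OF hol' deriv_real] .

lemma of_u: "f (of_real x) = of_real (u x)" "deriv f (of_real x) = of_real (u' x)"
    "deriv (deriv f) (of_real x) = of_real (u'' x)"
  using real[of x] deriv_real[of x] deriv2_real[of x] by (auto simp: u_def u'_def u''_def)

text \<open>The derivative of f'/f at a real point is (f f'' - f'^2)/f^2. Since f'/f is real on the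
  axis and has nonpositive imaginary part above it, \<open>deriv_nonzero_of_Im_nonpos\<close> makes
  this derivative nonpositive and nonzero; the strictness comes from the second property.\<close>

lemma laguerre:
  assumes "u x \<noteq> 0"
  shows "u x * u'' x < u' x * u' x"
proof -
  have fx: "f (of_real x) \<noteq> 0" using assms by (simp add: of_u)
  have "isCont f (of_real x)" using has_deriv DERIV_isCont by blast
  then obtain r where r: "r > 0" "\<And>w. w \<in> ball (of_real x) r \<Longrightarrow> f w \<noteq> 0"
    using continuous_at_avoid[of "of_real x" f 0] fx by (auto simp: dist_commute)
  define S where "S = ball (complex_of_real x) r"
  define g where "g = (\<lambda>z. deriv f z / f z)"
  have g: "g holomorphic_on S" unfolding g_def S_def
    by (intro holomorphic_intros holomorphic_on_subset[OF hol] holomorphic_on_subset[OF hol'])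
       (use r in auto)
  have nc: "\<not> g constant_on S" unfolding g_def
    by (rule logderiv_not_constant) (use r in \<open>auto simp: S_def\<close>)
  have re: "g (of_real x) \<in> \<real>" unfolding g_def of_u by (intro Reals_divide) auto
  have Im: "Im (g z) \<le> 0" if "Im z > 0" for z using Im_logderiv[OF that] by (simp add: g_def)
  have "(g has_field_derivative (deriv (deriv f) (of_real x) * f (of_real x) - deriv f (of_real x)
      * deriv f (of_real x))
      / (f (of_real x) * f (of_real x))) (at (of_real x))"
    unfolding g_def by (rule DERIV_divide[OF has_deriv2 has_deriv fx])
  hence d: "deriv g (of_real x) = of_real ((u'' x * u x - u' x * u' x) / (u x * u x))"
    by (simp add: of_u DERIV_imp_deriv)
  have "deriv g (of_real x) \<noteq> 0" "Re (deriv g (of_real x)) \<le> 0"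
    using deriv_nonzero_of_Im_nonpos[OF g _ _ _ nc Im re] r(1) by (auto simp: S_def)
  hence "(u'' x * u x - u' x * u' x) / (u x * u x) \<noteq> 0" "(u'' x * u x - u' x * u' x) / (u x * u x)
      \<le> 0"
    unfolding d of_real_eq_0_iff Re_complex_of_real .
  hence "(u'' x * u x - u' x * u' x) / (u x * u x) < 0" by linarith
  moreover have "u x * u x > 0" using assms by (simp add: zero_less_mult_iff) linarith
  ultimately show ?thesis by (simp add: field_simps)
qed

end

subsection \<open>Interlacing of real zeros\<close>

lemma rolle_has_deriv:
  fixes u :: "real \<Rightarrow> real"
  assumes "a < b" "u a = 0" "u b = 0" "\<And>x. a \<le> x \<Longrightarrow> x \<le> b \<Longrightarrow> (u has_real_derivative u' x) (at x)"
  shows "\<exists>z. a < z \<and> z < b \<and> u' z = 0"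
  using MVT2[OF assms(1) assms(4)] assms(1-3) by auto

text \<open>Rolle's theorem for x^c u(x), whose derivative is x^(c-1) (c u + x u'). Positivity of
  the interval makes the real power differentiable.\<close>

lemma rolle_euler:
  fixes u :: "real \<Rightarrow> real"
  assumes ab: "0 < a" "a < b" "u a = 0" "u b = 0" and d: "\<And>x. (u has_real_derivative u' x) (at x)"
  shows "\<exists>z. a < z \<and> z < b \<and> c * u z + z * u' z = 0"
proof -
  have "\<exists>z. a < z \<and> z < b \<and> (c * z powr (c - 1)) * u z + u' z * z powr c = 0"
  proof (rule rolle_has_deriv[of a b "\<lambda>x. x powr c * u x"])
    fix x assume "a \<le> x" "x \<le> b"
    thus "((\<lambda>x. x powr c * u x) has_real_derivative (c * x powr (c - 1)) * u x + u' x * x powr c)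
        (at x)"
      using ab by (intro DERIV_mult has_real_derivative_powr d) auto
  qed (use ab in auto)
  then obtain z where z: "a < z" "z < b" "(c * z powr (c - 1)) * u z + u' z * z powr c = 0" by blast
  have "z powr c = z powr (c - 1) * z" using z(1) ab(1) powr_add[of z "c - 1" 1] by simp
  with z(3) have "z powr (c - 1) * (c * u z + z * u' z) = 0" by (simp add: algebra_simps)
  thus ?thesis using z(1,2) ab(1) by auto
qed

lemma no_two_zeros_decreasing:
  fixes q :: "real \<Rightarrow> real"
  assumes "a < b" "q a = 0" "q b = 0" "\<And>x. a \<le> x \<Longrightarrow> x \<le> b \<Longrightarrow> \<exists>D. (q has_real_derivative D) (at x) \<and>
      D < 0"
  shows False
  using DERIV_neg_imp_decreasing[OF assms(1), of q] assms by force

lemma interlacing_sym: "interlacing lt A B \<Longrightarrow> interlacing lt B A"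
  by (auto simp: interlacing_def)

text \<open>The function q stands for v/u up to a positive factor. Being strictly decreasing where u
  has no zero, it cannot vanish twice there, so two zeros of v enclose a zero of u, and
  \<open>simple\<close> keeps that zero off the endpoints. \<open>rolle\<close> is the converse.
  Uniqueness on either side follows by applying the other direction to two candidates.\<close>

lemma interlacing_of_decreasing_quotient:
  fixes u v q :: "real \<Rightarrow> real" and I :: "real set"
  assumes conv: "\<And>a b x. a \<in> I \<Longrightarrow> b \<in> I \<Longrightarrow> a \<le> x \<Longrightarrow> x \<le> b \<Longrightarrow> x \<in> I"
    and rolle: "\<And>a b. a \<in> I \<Longrightarrow> b \<in> I \<Longrightarrow> a < b \<Longrightarrow> u a = 0 \<Longrightarrow> u b = 0 \<Longrightarrow> \<exists>z. a < z \<and> z < b \<and> v z = 0"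
    and simple: "\<And>x. x \<in> I \<Longrightarrow> u x = 0 \<Longrightarrow> v x \<noteq> 0"
    and q0: "\<And>x. x \<in> I \<Longrightarrow> u x \<noteq> 0 \<Longrightarrow> v x = 0 \<Longrightarrow> q x = 0"
    and q: "\<And>x. x \<in> I \<Longrightarrow> u x \<noteq> 0 \<Longrightarrow> \<exists>D. (q has_real_derivative D) (at x) \<and> D < 0"
  shows "interlacing (<) {x \<in> I. v x = 0} {x \<in> I. u x = 0}"
proof -
  have between: "\<exists>w. a \<le> w \<and> w \<le> b \<and> u w = 0" if "a \<in> I" "b \<in> I" "a < b" "v a = 0" "v b = 0" for a b
  proof (rule ccontr)
    assume "\<not> (\<exists>w. a \<le> w \<and> w \<le> b \<and> u w = 0)"
    hence nz: "u w \<noteq> 0" if "a \<le> w" "w \<le> b" for w using that by blast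
    show False
    proof (rule no_two_zeros_decreasing[OF \<open>a < b\<close>])
      show "q a = 0" "q b = 0" using q0 nz that by auto
    qed (use q nz conv that in blast)
  qed
  show ?thesis unfolding interlacing_def
  proof (intro conjI allI impI)
    fix a b assume "consecutive (<) {x \<in> I. v x = 0} a b"
    hence ab: "a \<in> I" "b \<in> I" "v a = 0" "v b = 0" "a < b" and no: "\<And>w. w \<in> I \<Longrightarrow> a < w \<Longrightarrow> w < b \<Longrightarrow>
        v w \<noteq> 0"
      by (auto simp: consecutive_def)
    have inI: "w \<in> I" if "a \<le> w" "w \<le> b" for w using conv ab that by blast
    obtain w where w: "a \<le> w" "w \<le> b" "u w = 0" using between ab by blast
    have "w \<noteq> a" "w \<noteq> b" using simple ab w by auto
    hence w': "a < w" "w < b" using w by auto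
    have uniq: "y = w" if y: "a < y" "y < b" "u y = 0" for y
    proof (rule ccontr)
      assume "y \<noteq> w"
      then consider "y < w" | "w < y" by linarith
      thus False
      proof cases
        case 1
        then obtain z where "y < z" "z < w" "v z = 0" using rolle[of y w] inI y w w' by auto
        thus False using no[of z] inI[of z] y w' by simp
      next
        case 2
        then obtain z where "w < z" "z < y" "v z = 0" using rolle[of w y] inI y w w' by auto
        thus False using no[of z] inI[of z] y w' by simp
      qed
    qed
    show "\<exists>!w. w \<in> {x \<in> I. u x = 0} \<and> a < w \<and> w < b"
    proof (rule ex1I[of _ w])
      show "w \<in> {x \<in> I. u x = 0} \<and> a < w \<and> w < b" using w w' inI[of w] by auto
    qed (use uniq in blast)
  next
    fix a b assume "consecutive (<) {x \<in> I. u x = 0} a b"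
    hence ab: "a \<in> I" "b \<in> I" "u a = 0" "u b = 0" "a < b" and no: "\<And>w. w \<in> I \<Longrightarrow> a < w \<Longrightarrow> w < b \<Longrightarrow>
        u w \<noteq> 0"
      by (auto simp: consecutive_def)
    have inI: "w \<in> I" if "a \<le> w" "w \<le> b" for w using conv ab that by blast
    obtain w where w: "a < w" "w < b" "v w = 0" using rolle ab by blast
    have uniq: "y = w" if y: "a < y" "y < b" "v y = 0" for y
    proof (rule ccontr)
      assume "y \<noteq> w"
      then consider "y < w" | "w < y" by linarith
      thus False
      proof cases
        case 1
        then obtain z where "y \<le> z" "z \<le> w" "u z = 0" using between[of y w] inI y w by auto
        thus False using no[of z] inI[of z] y w by simp
      next
        case 2
        then obtain z where "w \<le> z" "z \<le> y" "u z = 0" using between[of w y] inI y w by auto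
        thus False using no[of z] inI[of z] y w by simp
      qed
    qed
    show "\<exists>!w. w \<in> {x \<in> I. v x = 0} \<and> a < w \<and> w < b"
    proof (rule ex1I[of _ w])
      show "w \<in> {x \<in> I. v x = 0} \<and> a < w \<and> w < b" using w inI[of w] by auto
    qed (use uniq in blast)
  qed
qed

text \<open>A double zero of u always carries a zero of v at the same point, so real zeros alone
  cannot separate each other strictly. In the split listing, the zero of v sits between the two
  copies, and between consecutive zeros of v lies exactly one copy, at one of the two
  endpoints.\<close>

lemma interlacing_double_zeros:
  fixes u v :: "real \<Rightarrow> real"
  assumes rolle: "\<And>a b. a < b \<Longrightarrow> u a = 0 \<Longrightarrow> u b = 0 \<Longrightarrow> \<exists>z. a < z \<and> z < b \<and> v z = 0"
    and double: "\<And>x. u x = 0 \<Longrightarrow> v x = 0"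
    and between: "\<And>a b. a < b \<Longrightarrow> v a = 0 \<Longrightarrow> v b = 0 \<Longrightarrow> \<exists>w. a \<le> w \<and> w \<le> b \<and> u w = 0"
  shows "interlacing lex_less {(x, h). v x = 0 \<and> h = 0} {(x, h). u x = 0 \<and> (h = -1 \<or> h = 1)}"
    (is "interlacing _ ?A ?B")
  unfolding interlacing_def
proof (intro conjI allI impI)
  fix p q assume "consecutive lex_less ?A p q"
  then obtain a b where pq: "p = (a, 0)" "q = (b, 0)" "v a = 0" "v b = 0" "a < b"
    and no': "\<not> (\<exists>w\<in>?A. lex_less p w \<and> lex_less w q)"
    by (auto simp: consecutive_def lex_less_def)
  have no: "v w \<noteq> 0" if "a < w" "w < b" for w
  proof
    assume "v w = 0"
    hence "(w, 0) \<in> ?A" "lex_less p (w, 0)" "lex_less (w, 0) q" using that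
        by (auto simp: pq lex_less_def)
    thus False using no' by blast
  qed
  obtain w where w: "a \<le> w" "w \<le> b" "u w = 0" using between pq by blast
  \<comment> \<open>If both endpoints were zeros of u, Rolle would give a further zero of v between
    them; this is why only one copy lies between the two zeros of v.\<close>
  have "\<not> (u a = 0 \<and> u b = 0)" using rolle[of a b] pq no by blast
  moreover have "w = a \<or> w = b" using no[of w] double[of w] w by force
  ultimately consider "u a = 0" "u b \<noteq> 0" | "u a \<noteq> 0" "u b = 0" using w by blast
  thus "\<exists>!w. w \<in> ?B \<and> lex_less p w \<and> lex_less w q"
  proof cases
    case 1
    show ?thesis
    proof (rule ex1I[of _ "(a, 1)"])
      fix y assume "y \<in> ?B \<and> lex_less p y \<and> lex_less y q"
      thus "y = (a, 1)" using 1 no[of "fst y"] double[of "fst y"] by (auto simp: pq lex_less_def)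
    qed (use 1 pq in \<open>auto simp: lex_less_def\<close>)
  next
    case 2
    show ?thesis
    proof (rule ex1I[of _ "(b, -1)"])
      fix y assume "y \<in> ?B \<and> lex_less p y \<and> lex_less y q"
      thus "y = (b, -1)" using 2 no[of "fst y"] double[of "fst y"] by (auto simp: pq lex_less_def)
    qed (use 2 pq in \<open>auto simp: lex_less_def\<close>)
  qed
next
  fix p q assume c: "consecutive lex_less ?B p q"
  obtain a h where p: "p = (a, h)" by (cases p)
  obtain b k where q: "q = (b, k)" by (cases q)
  have uab: "u a = 0" "u b = 0" "h = -1 \<or> h = 1" "k = -1 \<or> k = 1" and lt: "lex_less p q"
    and no': "\<not> (\<exists>w\<in>?B. lex_less p w \<and> lex_less w q)"
    using c by (auto simp: consecutive_def p q)
  show "\<exists>!w. w \<in> ?A \<and> lex_less p w \<and> lex_less w q"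
  proof (cases "a = b")
    case True
    hence hk: "h = -1" "k = 1" using lt uab by (auto simp: lex_less_def p q)
    show ?thesis
      by (rule ex1I[of _ "(a, 0)"]) (use True hk double uab in \<open>auto simp: lex_less_def p q\<close>)
  next
    case False
    hence ab: "a < b" using lt by (auto simp: lex_less_def p q)
    \<comment> \<open>At distinct points the neighbours are the right copy at a and the left copy at
      b; any other choice leaves a copy in between.\<close>
    have h: "h = 1"
    proof (rule ccontr)
      assume "h \<noteq> 1"
      hence "(a, 1) \<in> ?B" "lex_less p (a, 1)" "lex_less (a, 1) q" using uab ab
          by (auto simp: lex_less_def p q)
      thus False using no' by blast
    qed
    have k: "k = -1"
    proof (rule ccontr)
      assume "k \<noteq> -1"
      hence "(b, -1) \<in> ?B" "lex_less p (b, -1)" "lex_less (b, -1) q" using uab ab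
          by (auto simp: lex_less_def p q)
      thus False using no' by blast
    qed
    have no: "u w \<noteq> 0" if "a < w" "w < b" for w
    proof
      assume "u w = 0"
      hence "(w, 1) \<in> ?B" "lex_less p (w, 1)" "lex_less (w, 1) q" using that
          by (auto simp: p q lex_less_def)
      thus False using no' by blast
    qed
    obtain w where w: "a < w" "w < b" "v w = 0" using rolle ab uab by blast
    have uniq: "y = w" if y: "a < y" "y < b" "v y = 0" for y
    proof (rule ccontr)
      assume "y \<noteq> w"
      then consider "y < w" | "w < y" by linarith
      thus False
      proof cases
        case 1
        then obtain z where "y \<le> z" "z \<le> w" "u z = 0" using between[of y w] y w by auto
        thus False using no[of z] y w by simp
      next
        case 2
        then obtain z where "w \<le> z" "z \<le> y" "u z = 0" using between[of w y] y w by auto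
        thus False using no[of z] y w by simp
      qed
    qed
    show ?thesis
    proof (rule ex1I[of _ "(w, 0)"])
      fix y assume "y \<in> ?A \<and> lex_less p y \<and> lex_less y q"
      thus "y = (w, 0)" using uniq[of "fst y"] by (auto simp: p q h k lex_less_def)
    qed (use w ab in \<open>auto simp: p q lex_less_def\<close>)
  qed
qed

section \<open>Orders of zeros and interlacing with the derivative\<close>

context even_vmono
begin

lemma quotient_decreasing:
  assumes "u x \<noteq> 0"
  shows "\<exists>D. ((\<lambda>x. u' x / u x) has_real_derivative D) (at x) \<and> D < 0"
proof (intro exI conjI)
  show "((\<lambda>x. u' x / u x) has_real_derivative (u'' x * u x - u' x * u' x) / (u x * u x)) (at x)"
    by (rule DERIV_divide[OF u'_deriv u_deriv assms])
  have "u x * u x > 0" using assms not_real_square_gt_zero by blast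
  thus "(u'' x * u x - u' x * u' x) / (u x * u x) < 0"
    using laguerre[OF assms] by (intro divide_neg_pos) (simp add: mult.commute)
qed

lemma real_zeros_eq: "real_zeros f = {x. u x = 0}" "real_zeros (deriv f) = {x. u' x = 0}"
  by (auto simp: real_zeros_def of_u)

lemma rolle_u: "a < b \<Longrightarrow> u a = 0 \<Longrightarrow> u b = 0 \<Longrightarrow> \<exists>z. a < z \<and> z < b \<and> u' z = 0"
  using rolle_has_deriv[of a b u u'] u_deriv by blast

lemma interlacing_deriv:
  assumes "\<And>x. u x = 0 \<Longrightarrow> u' x \<noteq> 0"
  shows "interlacing (<) (real_zeros (deriv f)) (real_zeros f)"
  using interlacing_of_decreasing_quotient[of UNIV u u' "\<lambda>x. u' x / u x"] assms rolle_u
      quotient_decreasing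
  by (auto simp: real_zeros_eq)

lemma u_0: "u 0 \<noteq> 0"
  using zero of_u(1)[of 0] by auto

lemma u_minus: "u (- x) = u x" "u' (- x) = - u' x"
  using even[of "of_real x"] deriv_odd[of "of_real x"] by (simp_all add: u_def u'_def)

lemma all_zeros_real: "all_zeros_real f" "all_zeros_real (deriv f)"
  by (auto simp: all_zeros_real_def real_zero deriv_real_zero)

text \<open>At a common zero of c u + x u' and its derivative with u \<noteq> 0, one gets x^2 u u''
  = c (c + 1) u^2 and x^2 u'^2 = c^2 u^2, which violates Laguerre's inequality because c > 0. Where
  u = 0, both equations reduce to u' = u'' = 0; the point x = 0 is not a zero since c u(0) \<noteq>
  0.\<close>

lemma euler_simple:
  assumes c: "c > 0" and nz: "\<And>x. u x = 0 \<Longrightarrow> u' x = 0 \<Longrightarrow> u'' x \<noteq> 0" and 0: "c * u x + x * u' x = 0"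
  shows "(c + 1) * u' x + x * u'' x \<noteq> 0"
proof
  assume 1: "(c + 1) * u' x + x * u'' x = 0"
  have x0: "x \<noteq> 0" using 0 c u_0 by auto
  show False
  proof (cases "u x = 0")
    case True
    thus False using 0 1 x0 nz[of x] by auto
  next
    case False
    have a: "x * u' x = - c * u x" "x * u'' x = - (c + 1) * u' x" using 0 1 by linarith+
    have "x * x * (u x * u'' x) = x * u x * (x * u'' x)" by simp
    also have "\<dots> = - (c + 1) * u x * (x * u' x)" unfolding a(2) by simp
    also have "\<dots> = (c + 1) * c * (u x * u x)" unfolding a(1) by (simp add: algebra_simps)
    finally have l: "x * x * (u x * u'' x) = (c + 1) * c * (u x * u x)" .
    have "x * x * (u' x * u' x) = (x * u' x) * (x * u' x)" by simp
    also have "\<dots> = c * c * (u x * u x)" unfolding a(1) by simp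
    finally have r: "x * x * (u' x * u' x) = c * c * (u x * u x)" .
    have "x * x > 0" using x0 not_real_square_gt_zero by blast
    hence "x * x * (u x * u'' x) < x * x * (u' x * u' x)"
      using laguerre[OF False] by (rule mult_strict_left_mono[rotated])
    hence "c * (u x * u x) < 0" unfolding l r by (simp add: algebra_simps)
    moreover have "u x * u x > 0" using False not_real_square_gt_zero by blast
    ultimately show False using c by (simp add: mult_less_0_iff)
  qed
qed

text \<open>Here every zero of f has order exactly two, and every zero of f' is simple: at zeros of
  f by hypothesis, elsewhere by Laguerre's inequality.\<close>

lemma interlacing_double:
  assumes "\<And>x. u x = 0 \<Longrightarrow> u' x = 0" "\<And>x. u x = 0 \<Longrightarrow> u'' x \<noteq> 0"
  shows "interlacing lex_less (real_zeros_mult (deriv f)) (real_zeros_mult f)"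
proof -
  have z2: "zorder f (of_real x) = 2" if "u x = 0" for x
  proof (rule zorder_zero_eqI[OF hol])
    show "(deriv ^^ nat 2) f (of_real x) \<noteq> 0" using assms(2)[OF that]
        by (simp add: numeral_2_eq_2 of_u)
    fix i assume "i < nat 2"
    hence "i = 0 \<or> i = 1" by auto
    thus "(deriv ^^ i) f (of_real x) = 0" using that assms(1) by (auto simp: of_u)
  qed auto
  have "u'' x \<noteq> 0" if "u' x = 0" for x
    using assms(2)[of x] laguerre[of x] that by (cases "u x = 0") auto
  hence z1: "zorder (deriv f) (of_real x) = 1" if "u' x = 0" for x
    using that by (intro zorder_zero_eqI[OF hol']) (auto simp: of_u)
  have "real_zeros_mult f = {(x, h). u x = 0 \<and> (h = -1 \<or> h = 1)}"
  proof -
    have "{0..<2} = {0, 1 :: int}" by auto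
    hence "(x, h) \<in> real_zeros_mult f \<longleftrightarrow> u x = 0 \<and> (h = -1 \<or> h = 1)" for x h
      by (cases "u x = 0") (simp_all add: real_zeros_mult_def real_zeros_eq(1) z2)
    thus ?thesis by auto
  qed
  moreover have "real_zeros_mult (deriv f) = {(x, h). u' x = 0 \<and> h = 0}"
  proof -
    have "{0..<1} = {0 :: int}" by auto
    hence "(x, h) \<in> real_zeros_mult (deriv f) \<longleftrightarrow> u' x = 0 \<and> h = 0" for x h
      by (cases "u' x = 0") (simp_all add: real_zeros_mult_def real_zeros_eq(2) z1)
    thus ?thesis by auto
  qed
  moreover have "\<exists>w. a \<le> w \<and> w \<le> b \<and> u w = 0" if "a < b" "u' a = 0" "u' b = 0" for a b
  proof (rule ccontr)
    assume nz: "\<not> (\<exists>w. a \<le> w \<and> w \<le> b \<and> u w = 0)"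
    show False
      by (rule no_two_zeros_decreasing[OF \<open>a < b\<close>, of "\<lambda>x. u' x / u x"]) (use that nz
          quotient_decreasing in auto)
  qed
  ultimately show ?thesis using interlacing_double_zeros[of u u'] rolle_u assms(1) by simp
qed

end

text \<open>If p = g(x) were positive, Laguerre's inequality for f + \<epsilon> g at the double zero
  would read \<epsilon> p (f'' + \<epsilon> p'') < \<epsilon>^2 p'^2. The left side is of first
  order in \<epsilon> and positive, so this fails for small \<epsilon>.\<close>

lemma laguerre_perturb:
  assumes f: "even_vmono f" and g: "g holomorphic_on UNIV" "\<And>x::real. g (of_real x) \<in> \<real>"
    and fg: "\<And>\<epsilon>. \<epsilon> > 0 \<Longrightarrow> even_vmono (\<lambda>z. f z + of_real \<epsilon> * g z)"
    and zero: "even_vmono.u f x = 0" "even_vmono.u' f x = 0" and pos: "even_vmono.u'' f x > 0"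
  shows "Re (g (of_real x)) \<le> 0"
proof (rule ccontr)
  interpret f: even_vmono f by (rule f)
  define p where "p = Re (g (of_real x))"
  define p' where "p' = Re (deriv g (of_real x))"
  define p'' where "p'' = Re (deriv (deriv g) (of_real x))"
  assume "\<not> Re (g (of_real x)) \<le> 0"
  hence p: "p > 0" by (simp add: p_def)
  \<comment> \<open>Chosen to make \<epsilon> times the denominator equal to p f''(x); the summand 1
    keeps the denominator positive and the final comparison strict.\<close>
  define \<epsilon> where "\<epsilon> = p * f.u'' x / (\<bar>p' * p' - p * p''\<bar> + 1)"
  have e: "\<epsilon> > 0" using p pos by (auto simp: \<epsilon>_def intro!: divide_pos_pos)
  interpret h: even_vmono "\<lambda>z. f z + of_real \<epsilon> * g z" by (rule fg[OF e])
  have gd: "(g has_field_derivative deriv g z) (at z)" "(deriv g has_field_derivative deriv (deriv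
      g) z) (at z)" for z
    using g(1) holomorphic_deriv[OF g(1)] by (auto simp: holomorphic_derivI)
  have d1: "deriv (\<lambda>z. f z + of_real \<epsilon> * g z) = (\<lambda>z. deriv f z + of_real \<epsilon> * deriv g z)"
    by (rule ext, rule DERIV_imp_deriv) (intro DERIV_add DERIV_cmult f.has_deriv gd)
  have d2: "deriv (deriv (\<lambda>z. f z + of_real \<epsilon> * g z)) = (\<lambda>z. deriv (deriv f) z + of_real \<epsilon> * deriv
      (deriv g) z)"
    unfolding d1 by (rule ext, rule DERIV_imp_deriv) (intro DERIV_add DERIV_cmult f.has_deriv2 gd)
  have d2': "deriv (\<lambda>z. deriv f z + of_real \<epsilon> * deriv g z) =
      (\<lambda>z. deriv (deriv f) z + of_real \<epsilon> * deriv (deriv g) z)"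
    using d2 unfolding d1 .
  have u: "h.u x = \<epsilon> * p" "h.u' x = \<epsilon> * p'" "h.u'' x = f.u'' x + \<epsilon> * p''"
    using zero unfolding h.u_def h.u'_def h.u''_def f.u_def f.u'_def f.u''_def d1 d2' p_def p'_def
        p''_def by simp_all
  have "\<epsilon> * p * (f.u'' x + \<epsilon> * p'') < \<epsilon> * p' * (\<epsilon> * p')"
    using h.laguerre[of x] e p unfolding u by simp
  hence "\<epsilon> * (p * f.u'' x) < \<epsilon> * (\<epsilon> * (p' * p' - p * p''))" by (simp add: algebra_simps)
  hence "p * f.u'' x < \<epsilon> * (p' * p' - p * p'')" using e by simp
  also have "\<dots> \<le> \<epsilon> * \<bar>p' * p' - p * p''\<bar>" using e by (intro mult_left_mono) auto
  also have "\<dots> < \<epsilon> * (\<bar>p' * p' - p * p''\<bar> + 1)" using e by simp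
  also have "\<dots> = p * f.u'' x" unfolding \<epsilon>_def by simp
  finally show False by simp
qed

context even_vmono
begin

lemma deriv_euler:
  "deriv (\<lambda>z. of_real c * f z + z * deriv f z) z = of_real (c + 1) * deriv f z + z * deriv (deriv
      f) z"
proof -
  have "((\<lambda>z. of_real c * f z + z * deriv f z) has_field_derivative
      of_real c * deriv f z + (1 * deriv f z + deriv (deriv f) z * z)) (at z)"
    by (intro DERIV_add DERIV_cmult DERIV_mult DERIV_ident has_deriv has_deriv2)
  from DERIV_imp_deriv[OF this] show ?thesis by (simp add: algebra_simps)
qed

end

subsection \<open>Even power series\<close>

definition even_series :: "(nat \<Rightarrow> complex) \<Rightarrow> complex \<Rightarrow> complex" where
  "even_series a z = (\<Sum>j. a j * (z\<^sup>2) ^ j)"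

lemma even_series_eval_fps: "even_series a z = eval_fps (Abs_fps a) (z\<^sup>2)"
  by (simp add: even_series_def eval_fps_def)

text \<open>The operator z d/dz multiplies z^(2j) by 2j. It therefore acts diagonally on
  coefficients and is compatible with coefficientwise limits.\<close>

definition theta_seq :: "(nat \<Rightarrow> complex) \<Rightarrow> nat \<Rightarrow> complex" where
  "theta_seq a j = 2 * of_nat j * a j"

lemma Abs_fps_theta: "Abs_fps (theta_seq a) = fps_const 2 * (fps_X * fps_deriv (Abs_fps a))"
  by (rule fps_ext) (simp add: theta_seq_def mult_ac)

lemma even_series_has_field_derivative:
  assumes "conv_radius a = \<infinity>"
  shows "(even_series a has_field_derivative (2 * z) * eval_fps (fps_deriv (Abs_fps a)) (z\<^sup>2)) (at
      z)"
proof -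
  have r: "fps_conv_radius (Abs_fps a) = \<infinity>" using assms by (simp add: fps_conv_radius_def)
  have "((\<lambda>z. eval_fps (Abs_fps a) (z\<^sup>2)) has_field_derivative eval_fps (fps_deriv (Abs_fps a))
      (z\<^sup>2) * (2 * z)) (at z)"
    by (rule DERIV_chain2[OF has_field_derivative_eval_fps])
       (auto simp: r intro!: derivative_eq_intros)
  thus ?thesis by (simp add: even_series_eval_fps[abs_def] mult_ac)
qed

lemma holomorphic_even_series:
  assumes "conv_radius a = \<infinity>"
  shows "even_series a holomorphic_on A"
  using even_series_has_field_derivative[OF assms]
  by (meson field_differentiable_at_within field_differentiable_def holomorphic_onI)

lemma conv_radius_theta: "conv_radius a = \<infinity> \<Longrightarrow> conv_radius (theta_seq a) = \<infinity>"
proof -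
  assume a: "conv_radius a = \<infinity>"
  have "fps_conv_radius (fps_deriv (Abs_fps a)) = \<infinity>"
    using fps_conv_radius_deriv[of "Abs_fps a"] a by (simp add: fps_conv_radius_def)
  hence "fps_conv_radius (fps_X * fps_deriv (Abs_fps a)) = \<infinity>"
    using fps_conv_radius_mult[of fps_X "fps_deriv (Abs_fps a)"] by simp
  hence "fps_conv_radius (fps_const 2 * (fps_X * fps_deriv (Abs_fps a))) = \<infinity>"
    using fps_conv_radius_mult[of "fps_const 2" "fps_X * fps_deriv (Abs_fps a)"] by simp
  thus ?thesis by (simp flip: Abs_fps_theta add: fps_conv_radius_def)
qed

lemma even_series_theta:
  assumes a: "conv_radius a = \<infinity>"
  shows "even_series (theta_seq a) z = z * deriv (even_series a) z"
proof -
  have r: "fps_conv_radius (fps_deriv (Abs_fps a)) = \<infinity>"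
    using fps_conv_radius_deriv[of "Abs_fps a"] a by (simp add: fps_conv_radius_def)
  hence r': "fps_conv_radius (fps_X * fps_deriv (Abs_fps a)) = \<infinity>"
    using fps_conv_radius_mult[of fps_X "fps_deriv (Abs_fps a)"] by simp
  have "even_series (theta_seq a) z = 2 * (z\<^sup>2 * eval_fps (fps_deriv (Abs_fps a)) (z\<^sup>2))"
    unfolding even_series_eval_fps Abs_fps_theta using r r' by (simp add: eval_fps_mult)
  also have "\<dots> = z * deriv (even_series a) z"
    using DERIV_imp_deriv[OF even_series_has_field_derivative[OF a, of z]]
        by (simp add: power2_eq_square)
  finally show ?thesis .
qed

lemma summable_even_series:
  fixes w :: complex
  shows "conv_radius a = \<infinity> \<Longrightarrow> summable (\<lambda>j. a j * w ^ j)"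
  by (rule summable_in_conv_radius) auto

lemma even_series_lincomb:
  assumes "conv_radius a = \<infinity>" "conv_radius b = \<infinity>"
  shows "even_series (\<lambda>j. \<alpha> * a j + \<beta> * b j) z = \<alpha> * even_series a z + \<beta> * even_series b z"
proof -
  have "even_series (\<lambda>j. \<alpha> * a j + \<beta> * b j) z = (\<Sum>j. \<alpha> * (a j * (z\<^sup>2) ^ j) + \<beta> * (b j * (z\<^sup>2) ^ j))"
    unfolding even_series_def by (intro suminf_cong) (simp add: algebra_simps)
  also have "\<dots> = \<alpha> * even_series a z + \<beta> * even_series b z"
    unfolding even_series_def using summable_even_series[OF assms(1)] summable_even_series[OF
        assms(2)]
    by (simp add: suminf_add suminf_mult summable_mult flip: suminf_mult suminf_add)
  finally show ?thesis .
qed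

lemma even_series_cmult: "even_series (\<lambda>j. \<alpha> * a j) z = \<alpha> * even_series a z" if "conv_radius a = \<infinity>"
  using even_series_lincomb[OF that that, of \<alpha> 0] by simp

lemma conv_radius_lincomb:
  fixes a b :: "nat \<Rightarrow> complex"
  assumes "conv_radius a = \<infinity>" "conv_radius b = \<infinity>"
  shows "conv_radius (\<lambda>j. \<alpha> * a j + \<beta> * b j) = \<infinity>"
proof (rule conv_radius_inftyI'')
  fix w show "summable (\<lambda>j. (\<alpha> * a j + \<beta> * b j) * w ^ j)"
    using summable_add[OF summable_mult[OF summable_even_series[OF assms(1)]] summable_mult[OF
        summable_even_series[OF assms(2)]], of \<alpha> w \<beta> w]
    by (simp add: algebra_simps)
qed

definition euler_seq :: "real \<Rightarrow> (nat \<Rightarrow> complex) \<Rightarrow> nat \<Rightarrow> complex" where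
  "euler_seq c a j = of_real (c + 2 * real j) * a j"

lemma euler_seq_eq: "euler_seq c a = (\<lambda>j. of_real c * a j + 1 * theta_seq a j)"
  by (auto simp: euler_seq_def theta_seq_def algebra_simps)

lemma conv_radius_euler: "conv_radius a = \<infinity> \<Longrightarrow> conv_radius (euler_seq c a) = \<infinity>"
  unfolding euler_seq_eq by (intro conv_radius_lincomb conv_radius_theta)

lemma even_series_euler: "conv_radius a = \<infinity> \<Longrightarrow> even_series (euler_seq c a) z =
    of_real c * even_series a z + z * deriv (even_series a) z"
  unfolding euler_seq_eq by (subst even_series_lincomb) (auto intro: conv_radius_theta simp:
      even_series_theta)

lemma conv_radius_fact_bound:
  fixes a :: "nat \<Rightarrow> complex"
  assumes "\<And>j. norm (a j) \<le> M / fact j"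
  shows "conv_radius a = \<infinity>"
proof (rule conv_radius_inftyI'')
  fix w :: complex
  show "summable (\<lambda>j. a j * w ^ j)"
  proof (rule summable_comparison_test')
    show "summable (\<lambda>j. M * (inverse (fact j) * norm w ^ j))"
      by (intro summable_mult summable_exp)
    show "norm (a j * w ^ j) \<le> M * (inverse (fact j) * norm w ^ j)" for j
      using mult_right_mono[OF assms, of "norm w ^ j" j]
          by (simp add: norm_mult norm_power field_simps)
  qed
qed

text \<open>Tannery's theorem with the summable majorant M |z|^(2j) / j!.\<close>

lemma even_series_tendsto:
  assumes "\<And>n j. norm (a n j) \<le> M / fact j" "\<And>j. (\<lambda>n. a n j) \<longlonglongrightarrow> b j"
  shows "(\<lambda>n. even_series (a n) z) \<longlonglongrightarrow> even_series b z"
proof -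
  have s: "summable (\<lambda>j. M * (inverse (fact j) * (norm z ^ 2) ^ j))"
    by (intro summable_mult summable_exp)
  have bd: "norm (a n j * (z\<^sup>2) ^ j) \<le> M * (inverse (fact j) * (norm z ^ 2) ^ j)" for n j
    using mult_right_mono[OF assms(1), of "(norm z ^ 2) ^ j" n j]
        by (simp add: norm_mult norm_power field_simps)
  have lim: "((\<lambda>n. a n j * (z\<^sup>2) ^ j) \<longlongrightarrow> b j * (z\<^sup>2) ^ j) sequentially" for j
    by (intro tendsto_intros assms(2))
  have "eventually (\<lambda>(j, n). norm (a n j * (z\<^sup>2) ^ j) \<le> M * (inverse (fact j) * (norm z ^ 2) ^ j))
      (at_top \<times>\<^sub>F sequentially)"
    using bd by (intro always_eventually) (simp only: split_paired_All prod.case simp_thms)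
  from tannerys_theorem[OF lim this s] show ?thesis by (simp add: even_series_def)
qed

text \<open>Only for polynomials with nonnegative roots is it easy to see that the Euler transforms
  \<open>c f + z f'\<close> are again \<open>vmono\<close>; carrying this along makes it survive limits.\<close>

definition euler_vmono :: "(nat \<Rightarrow> complex) \<Rightarrow> bool" where
  "euler_vmono a \<longleftrightarrow> vmono (even_series a) \<and> (\<forall>c>0. vmono (even_series (euler_seq c a)))"

text \<open>The Euler factor c + 2j is at most (c + 1)(2j + 1), and 2j + 1 cancels against (2j +
  1)!. Coefficients bounded by a multiple of 1/(2j + 1)! thus still have a summable majorant after
  the transform.\<close>

lemma fact_bound_euler:
  assumes "norm (a j) \<le> M / fact (2 * j + 1)" "c > 0"
  shows "norm (euler_seq c a j) \<le> (c + 1) * M / fact j" "norm (a j) \<le> M / fact j"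
proof -
  have "0 \<le> M / fact (2 * j + 1)" using order.trans[OF norm_ge_zero assms(1)] .
  hence M: "M \<ge> 0" by (metis fact_gt_zero not_less zero_le_divide_iff)
  have j: "c + 2 * real j \<le> (c + 1) * (2 * real j + 1)" using assms(2) by (simp add: algebra_simps)
  have "norm (euler_seq c a j) = (c + 2 * real j) * norm (a j)"
    using assms(2) by (simp add: euler_seq_def norm_mult del: of_real_add)
  also have "\<dots> \<le> ((c + 1) * (2 * real j + 1)) * (M / fact (2 * j + 1))"
    using j assms by (intro mult_mono) auto
  also have "\<dots> = (c + 1) * M * ((2 * real j + 1) / fact (2 * j + 1))" by simp
  also have "(2 * real j + 1) / fact (2 * j + 1) = 1 / fact (2 * j)"
  proof -
    have "fact (2 * j + 1) = (2 * real j + 1) * fact (2 * j)" by simp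
    moreover have "2 * real j + 1 \<noteq> 0" by linarith
    ultimately show ?thesis by (simp only: nonzero_divide_mult_cancel_left not_False_eq_True)
  qed
  also have "(c + 1) * M * (1 / fact (2 * j)) = (c + 1) * M / fact (2 * j)" by simp
  also have "\<dots> \<le> (c + 1) * M / fact j"
    using M assms(2) by (intro divide_left_mono fact_mono) auto
  finally show "norm (euler_seq c a j) \<le> (c + 1) * M / fact j" .
  have "M / fact (2 * j + 1) \<le> M / fact j"
    using M by (intro divide_left_mono fact_mono) auto
  thus "norm (a j) \<le> M / fact j" using assms(1) by linarith
qed

lemma euler_vmono_limit:
  assumes "\<And>n. euler_vmono (a n)" "\<And>n j. norm (a n j) \<le> M / fact (2 * j + 1)" "\<And>j. (\<lambda>n. a n j) \<longlonglongrightarrow> b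
      j"
  shows "euler_vmono b"
  unfolding euler_vmono_def
proof (intro conjI allI impI)
  show "vmono (even_series b)"
  proof (rule vmono_limit[of "\<lambda>n. even_series (a n)"])
    show "vmono (even_series (a n))" for n using assms(1) by (auto simp: euler_vmono_def)
    show "(\<lambda>n. even_series (a n) z) \<longlonglongrightarrow> even_series b z" for z
    proof (rule even_series_tendsto)
      show "norm (a n j) \<le> M / fact j" for n j
        by (rule fact_bound_euler(2)[OF assms(2) zero_less_one])
    qed (rule assms(3))
  qed
  fix c :: real assume c: "c > 0"
  show "vmono (even_series (euler_seq c b))"
  proof (rule vmono_limit[of "\<lambda>n. even_series (euler_seq c (a n))"])
    show "vmono (even_series (euler_seq c (a n)))" for n using assms(1) c
        by (auto simp: euler_vmono_def)
    show "(\<lambda>n. even_series (euler_seq c (a n)) z) \<longlonglongrightarrow> even_series (euler_seq c b) z" for z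
    proof (rule even_series_tendsto)
      show "norm (euler_seq c (a n) j) \<le> ((c + 1) * M) / fact j" for n j
        by (rule fact_bound_euler(1)[OF assms(2) c])
      show "(\<lambda>n. euler_seq c (a n) j) \<longlonglongrightarrow> euler_seq c b j" for j
        unfolding euler_seq_def by (intro tendsto_intros assms(3))
    qed
  qed
qed

lemma euler_vmono_cmult: "euler_vmono a \<Longrightarrow> conv_radius a = \<infinity> \<Longrightarrow> euler_vmono (\<lambda>j. \<alpha> * a j)"
proof -
  assume a: "euler_vmono a" "conv_radius a = \<infinity>"
  have "euler_seq c (\<lambda>j. \<alpha> * a j) = (\<lambda>j. \<alpha> * euler_seq c a j)" for c by (auto simp: euler_seq_def)
  moreover have "even_series (\<lambda>j. \<alpha> * a j) = (\<lambda>z. \<alpha> * even_series a z)" using even_series_cmult[OF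
      a(2)] by auto
  moreover have "even_series (\<lambda>j. \<alpha> * euler_seq c a j) = (\<lambda>z. \<alpha> * even_series (euler_seq c a) z)"
      for c
    using even_series_cmult[OF conv_radius_euler[OF a(2)]] by auto
  ultimately show ?thesis using a(1) by (auto simp: euler_vmono_def intro: vmono_cmult)
qed

subsection \<open>Polynomials with increasing Chebyshev coefficients\<close>

definition nonneg_roots :: "complex poly \<Rightarrow> bool" where
  "nonneg_roots P \<longleftrightarrow> (\<forall>w. poly P w = 0 \<longrightarrow> Im w = 0 \<and> Re w \<ge> 0)"

lemma poly_root_factor:
  fixes P :: "complex poly"
  assumes "degree P > 0"
  obtains r Q where "P = [:- r, 1:] * Q" "degree Q < degree P" "poly P r = 0"
proof -
  have "\<not> constant (poly P)" using assms by (simp add: constant_degree)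
  then obtain r where r: "poly P r = 0" using fundamental_theorem_of_algebra by blast
  then obtain Q where Q: "P = [:- r, 1:] * Q" by (metis dvdE poly_eq_0_iff_dvd)
  have "Q \<noteq> 0" using assms Q by auto
  hence "degree P = degree [:- r, 1:] + degree Q" unfolding Q by (intro degree_mult_eq) auto
  thus ?thesis using that[OF Q _ r] by simp
qed

text \<open>A root r \<ge> 0 in the variable z^2 contributes (z - s)(z + s) with s = sqrt r, and a
  linear factor with a real root has this property because its modulus is the distance to that
  root.\<close>

lemma vmono_poly: "nonneg_roots P \<Longrightarrow> vmono (\<lambda>z. poly P (z\<^sup>2))"
proof (induction "degree P" arbitrary: P rule: less_induct)
  case less
  show ?case
  proof (cases "degree P = 0")
    case True
    then obtain c where "P = [:c:]" by (metis degree_eq_zeroE)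
    thus ?thesis by (simp add: vmono_const)
  next
    case False
    then obtain r Q where Q: "P = [:- r, 1:] * Q" "degree Q < degree P" "poly P r = 0"
      using poly_root_factor by blast
    have r: "Im r = 0" "Re r \<ge> 0" using less.prems Q(3) by (auto simp: nonneg_roots_def)
    define s where "s = sqrt (Re r)"
    have rs: "r = of_real s ^ 2" using r by (simp add: s_def complex_eq_iff flip: of_real_power)
    have "nonneg_roots Q" using less.prems by (auto simp: nonneg_roots_def Q(1))
    hence "vmono (\<lambda>z. poly Q (z\<^sup>2))" using less.hyps Q(2) by blast
    hence "vmono (\<lambda>z. (z - of_real s) * (z - of_real (- s)) * poly Q (z\<^sup>2))"
      by (intro vmono_mult vmono_linear)
    also have "(\<lambda>z. (z - of_real s) * (z - of_real (- s)) * poly Q (z\<^sup>2)) = (\<lambda>z. poly P (z\<^sup>2))"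
      by (simp add: Q(1) rs power2_eq_square algebra_simps)
    finally show ?thesis .
  qed
qed

lemma even_series_coeff: "even_series (coeff P) z = poly P (z\<^sup>2)"
proof -
  have "even_series (coeff P) z = (\<Sum>j\<in>{..degree P}. coeff P j * (z\<^sup>2) ^ j)"
    unfolding even_series_def by (intro suminf_finite) (auto simp: not_le coeff_eq_0)
  thus ?thesis by (simp add: poly_altdef)
qed

text \<open>In the variable w = z^2 the Euler transform of P is c P + 2 w P'. By
  \<open>vmono_euler_nonzero\<close> its zeros in z are real, so its roots in w are nonnegative and
  \<open>vmono_poly\<close> applies once more.\<close>

lemma euler_vmono_coeff:
  assumes "nonneg_roots P"
  shows "euler_vmono (coeff P)"
  unfolding euler_vmono_def
proof (intro conjI allI impI)
  have even_series: "even_series (coeff P) = (\<lambda>z. poly P (z\<^sup>2))" for P using even_series_coeff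
      by auto
  show "vmono (even_series (coeff P))" unfolding even_series using assms by (rule vmono_poly)
  fix c :: real assume c: "c > 0"
  define Q where "Q = smult (of_real c) P + smult 2 (pCons 0 (pderiv P))"
  have "coeff Q = euler_seq c (coeff P)"
    by (rule ext) (auto simp: Q_def euler_seq_def coeff_pCons coeff_pderiv algebra_simps split:
        nat.splits)
  moreover have "nonneg_roots Q"
    unfolding nonneg_roots_def
  proof (intro allI impI)
    fix w assume w: "poly Q w = 0"
    obtain z where z: "z\<^sup>2 = w" "Im z \<ge> 0"
    proof (cases "Im (csqrt w) \<ge> 0")
      case True thus ?thesis using that[of "csqrt w"] by simp
    next
      case False thus ?thesis using that[of "- csqrt w"] by simp
    qed
    define f where "f = (\<lambda>z. poly P (z\<^sup>2))"
    have d: "(f has_field_derivative poly (pderiv P) (z\<^sup>2) * (2 * z)) (at z)" for z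
      unfolding f_def by (rule DERIV_chain2[OF poly_DERIV]) (auto intro!: derivative_eq_intros)
    have "Im z = 0"
    proof (rule ccontr)
      assume "Im z \<noteq> 0"
      hence "of_real c * f z + z * deriv f z \<noteq> 0"
      proof (intro vmono_euler_nonzero[of f \<i>])
        show "f holomorphic_on UNIV" unfolding f_def by (intro holomorphic_intros)
        show "vmono f" unfolding f_def using assms by (rule vmono_poly)
        show "f \<i> \<noteq> 0" using assms by (auto simp: f_def nonneg_roots_def)
      qed (use c z in auto)
      moreover have "of_real c * f z + z * deriv f z = poly Q w"
        using DERIV_imp_deriv[OF d[of z]] z(1) by (simp add: Q_def f_def power2_eq_square
            algebra_simps)
      ultimately show False using w by simp
    qed
    thus "Im w = 0 \<and> Re w \<ge> 0" by (simp flip: z(1) add: power2_eq_square)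
  qed
  ultimately show "vmono (even_series (euler_seq c (coeff P)))" using vmono_poly[of Q]
      even_series[of Q] by simp
qed

section \<open>Roots in the closed unit disc: the theorems of Enestrom-Kakeya and Schur\<close>

text \<open>The left side is the modulus at z of the reciprocal polynomial. Root by root, |1 - r cnj
  z| \<le> |z - r|, since the squares differ by (|z|^2 - 1)(1 - |r|^2).\<close>

lemma reflected_norm_le:
  fixes A :: "complex poly"
  assumes "\<And>r. poly A r = 0 \<Longrightarrow> norm r \<le> 1" and z: "norm z > 1"
  shows "norm z ^ degree A * norm (poly A (1 / cnj z)) \<le> norm (poly A z)"
  using assms(1)
proof (induction "degree A" arbitrary: A rule: less_induct)
  case less
  show ?case
  proof (cases "degree A = 0")
    case True
    then obtain c where "A = [:c:]" by (metis degree_eq_zeroE)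
    thus ?thesis by simp
  next
    case False
    then obtain r Q where Q: "A = [:- r, 1:] * Q" "degree Q < degree A" "poly A r = 0"
      using poly_root_factor by blast
    have "Q \<noteq> 0" using False Q(1) by auto
    hence deg: "degree A = Suc (degree Q)" unfolding Q(1) by (subst degree_mult_eq) auto
    have IH: "norm z ^ degree Q * norm (poly Q (1 / cnj z)) \<le> norm (poly Q z)"
      using less.hyps[OF Q(2)] less.prems by (auto simp: Q(1))
    have r: "norm r \<le> 1" using less.prems Q(3) .
    have z0: "z \<noteq> 0" using z by auto
    have "norm z * norm (1 / cnj z - r) = norm (cnj z * (1 / cnj z - r))"
        by (simp only: norm_mult complex_mod_cnj)
    also have "cnj z * (1 / cnj z - r) = 1 - r * cnj z" using z0 by (simp add: field_simps)
    also have "norm (1 - r * cnj z) \<le> norm (z - r)"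
    proof (rule power2_le_imp_le)
      have "norm r ^ 2 \<le> 1" "norm z ^ 2 \<ge> 1" using r z by (auto simp: power_le_one)
      hence "(norm z ^ 2 - 1) * (1 - norm r ^ 2) \<ge> 0" by simp
      moreover have "norm (z - r) ^ 2 - norm (1 - r * cnj z) ^ 2 =
          (norm z ^ 2 - 1) * (1 - norm r ^ 2)"
        unfolding cmod_power2 by (simp add: power2_eq_square algebra_simps)
      ultimately show "norm (1 - r * cnj z) ^ 2 \<le> norm (z - r) ^ 2" by linarith
    qed simp
    finally have "(norm z * norm (1 / cnj z - r)) * (norm z ^ degree Q * norm (poly Q (1 / cnj z)))
        \<le> norm (z - r) * norm (poly Q z)"
      using IH by (intro mult_mono) auto
    moreover have "norm (poly A w) = norm (w - r) * norm (poly Q w)" for w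
      by (simp add: Q(1) norm_mult[symmetric] algebra_simps)
    ultimately show ?thesis unfolding deg by (simp add: mult_ac)
  qed
qed

text \<open>Multiplication by z - 1 turns the coefficients into the leading one and differences that
  are nonnegative with total \<open>a n\<close>; outside the disc the leading term outweighs
  them.\<close>

lemma enestrom_kakeya:
  fixes a :: "nat \<Rightarrow> real"
  assumes a0: "a 0 = 0" and inc: "\<And>k. k < n \<Longrightarrow> a k \<le> a (Suc k)" and an: "a n > 0" and z: "norm z > 1"
  shows "(\<Sum>k\<le>n. of_real (a k) * z ^ k) \<noteq> (0 :: complex)"
proof
  assume 0: "(\<Sum>k\<le>n. of_real (a k) * z ^ k) = 0"
  have tele: "(z - 1) * (\<Sum>k\<le>m. of_real (a k) * z ^ k) =
      of_real (a m) * z ^ Suc m - (\<Sum>k<m. of_real (a (Suc k) - a k) * z ^ Suc k)" for m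
    by (induction m) (auto simp: a0 algebra_simps)
  have "of_real (a n) * z ^ Suc n = (\<Sum>k<n. of_real (a (Suc k) - a k) * z ^ Suc k)"
    using tele[of n] unfolding 0 mult_zero_right by (metis right_minus_eq)
  hence "norm (of_real (a n) * z ^ Suc n) = norm (\<Sum>k<n. of_real (a (Suc k) - a k) * z ^ Suc k)"
      by simp
  also have "\<dots> \<le> (\<Sum>k<n. norm (of_real (a (Suc k) - a k) * z ^ Suc k))" by (rule norm_sum)
  also have "\<dots> \<le> (\<Sum>k<n. (a (Suc k) - a k) * norm z ^ n)"
  proof (intro sum_mono)
    fix k assume k: "k \<in> {..<n}"
    have "norm (of_real (a (Suc k) - a k) * z ^ Suc k) = (a (Suc k) - a k) * norm z ^ Suc k"
      using inc[of k] k by (simp only: norm_mult norm_power norm_of_real) simp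
    also have "\<dots> \<le> (a (Suc k) - a k) * norm z ^ n"
      using inc[of k] k z by (intro mult_left_mono power_increasing) auto
    finally show "norm (of_real (a (Suc k) - a k) * z ^ Suc k) \<le> (a (Suc k) - a k) * norm z ^ n" .
  qed
  also have "\<dots> = (\<Sum>k<n. a (Suc k) - a k) * norm z ^ n" by (simp only: sum_distrib_right)
  also have "(\<Sum>k<n. a (Suc k) - a k) = a n" by (subst sum_lessThan_telescope) (simp add: a0)
  finally have "a n * norm z ^ Suc n \<le> a n * norm z ^ n" using an
      by (simp add: norm_mult norm_power)
  hence "norm z * norm z ^ n \<le> 1 * norm z ^ n" using an by simp
  moreover have "norm z ^ n > 0" using z by (intro zero_less_power) linarith
  ultimately have "norm z \<le> 1" by (metis mult_le_cancel_right_pos)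
  with z show False by simp
qed

text \<open>Since A has real coefficients, |A(1/z)| = |A(1/cnj z)|. Equality of A(z) and A(1/z)
  would turn \<open>reflected_norm_le\<close> into |z|^(deg A) \<le> 1, while A has positive degree
  because \<open>a 0\<close> and \<open>a n\<close> differ.\<close>

lemma schur_nonzero:
  fixes a :: "nat \<Rightarrow> real" and z :: complex
  assumes a0: "a 0 = 0" and inc: "\<And>k. k < n \<Longrightarrow> a k \<le> a (Suc k)" and an: "a n > 0" and z: "norm z > 1"
  shows "(\<Sum>k\<le>n. of_real (a k) * z ^ k) \<noteq> (\<Sum>k\<le>n. of_real (a k) * (1 / z) ^ k)"
proof
  assume eq: "(\<Sum>k\<le>n. of_real (a k) * z ^ k) = (\<Sum>k\<le>n. of_real (a k) * (1 / z) ^ k)"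
  define A :: "complex poly" where "A = (\<Sum>k\<le>n. monom (of_real (a k)) k)"
  have pA: "poly A w = (\<Sum>k\<le>n. of_real (a k) * w ^ k)" for w
    by (simp add: A_def poly_sum poly_monom)
  have n0: "n > 0" using a0 an by (cases n) auto
  have "coeff A n \<noteq> 0" using an by (simp add: A_def coeff_sum)
  hence deg: "degree A \<ge> n" by (rule le_degree)
  have roots: "norm r \<le> 1" if "poly A r = 0" for r
    using enestrom_kakeya[of a n r, OF a0 inc an] that by (force simp: pA)
  have "cnj (poly A (1 / z)) = poly A (1 / cnj z)" by (simp add: pA)
  hence "norm z ^ degree A * norm (poly A (1 / z)) \<le> norm (poly A z)"
    using reflected_norm_le[OF roots z] by (metis complex_mod_cnj)
  also have "poly A z = poly A (1 / z)" using eq by (simp add: pA)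
  finally have "norm z ^ degree A * norm (poly A (1 / z)) \<le> 1 * norm (poly A (1 / z))" by simp
  moreover have "norm (poly A (1 / z)) > 0"
    using enestrom_kakeya[of a n z, OF a0 inc an z] eq by (simp add: pA)
  ultimately have "norm z ^ degree A \<le> 1" by (metis mult_le_cancel_right_pos)
  moreover have "norm z ^ degree A > 1" using z deg n0 by (intro one_less_power) auto
  ultimately show False by simp
qed

text \<open>In terms of Chebyshev polynomials of the second kind, \<open>poly (cheb_U k) x\<close> is
  \<open>U\<^sub>k\<^sub>-\<^sub>1(1 - x / 2)\<close>, and \<open>x = 2 - z - 1 / z\<close> is the parametrisation
  \<open>1 - x / 2 = cos \<phi>\<close>, \<open>z = exp (i \<phi>)\<close>.\<close>

definition cheb_U :: "nat \<Rightarrow> complex poly" where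
  "cheb_U k = (\<Sum>j\<le>k. monom ((-1) ^ j * of_nat ((k + j) choose (2 * j + 1))) j)"

lemma coeff_cheb_U: "coeff (cheb_U k) j = (-1) ^ j * of_nat ((k + j) choose (2 * j + 1))"
proof (cases "j \<le> k")
  case False
  hence "(k + j) choose (2 * j + 1) = 0" by (intro binomial_eq_0) auto
  with False show ?thesis by (simp add: cheb_U_def coeff_sum)
qed (simp add: cheb_U_def coeff_sum)

text \<open>The three-term Chebyshev recurrence with 2 - x in place of twice the argument; on
  coefficients it is Pascal's rule, applied several times.\<close>

lemma cheb_U_rec: "cheb_U (Suc (Suc k)) = [:2, -1:] * cheb_U (Suc k) - cheb_U k"
proof (rule poly_eqI)
  fix j
  show "coeff (cheb_U (Suc (Suc k))) j = coeff ([:2, -1:] * cheb_U (Suc k) - cheb_U k) j"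
  proof (cases j)
    case 0
    thus ?thesis by (simp add: coeff_cheb_U)
  next
    case (Suc i)
    define m where "m = k + i"
    have c: "coeff (cheb_U (Suc (Suc k))) j = (-1) ^ j * of_nat ((Suc (Suc (Suc m))) choose (2 * i
        + 3))"
      "coeff (cheb_U (Suc k)) j = (-1) ^ j * of_nat ((Suc (Suc m)) choose (2 * i + 3))"
      "coeff (cheb_U k) j = (-1) ^ j * of_nat ((Suc m) choose (2 * i + 3))"
      "coeff (cheb_U (Suc k)) i = (-1) ^ i * of_nat ((Suc m) choose (2 * i + 1))"
      by (simp_all add: coeff_cheb_U m_def Suc numeral_3_eq_3 del: binomial_Suc_Suc)
    have d: "coeff ([:2, -1:] * cheb_U (Suc k)) j = 2 * coeff (cheb_U (Suc k)) j - coeff (cheb_U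
        (Suc k)) i"
      by (simp add: Suc)
    have r: "int ((Suc (Suc (Suc m))) choose (2 * i + 3)) =
        2 * int ((Suc (Suc m)) choose (2 * i + 3)) - int ((Suc m) choose (2 * i + 3))
        + int ((Suc m) choose (2 * i + 1))"
      by (simp add: numeral_3_eq_3)
    have r': "(of_nat ((Suc (Suc (Suc m))) choose (2 * i + 3)) :: complex) =
        2 * of_nat ((Suc (Suc m)) choose (2 * i + 3)) - of_nat ((Suc m) choose (2 * i + 3))
        + of_nat ((Suc m) choose (2 * i + 1))"
      using arg_cong[OF r, of of_int] by (simp only: of_int_add of_int_diff of_int_mult
          of_int_numeral of_int_of_nat_eq)
    show ?thesis
      unfolding coeff_diff d c r' by (simp add: Suc algebra_simps del: binomial_Suc_Suc)
  qed
qed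

text \<open>The identity sin \<phi> U_(k-1)(cos \<phi>) = sin(k \<phi>), continued from the unit
  circle to all z \<noteq> 0.\<close>

lemma poly_cheb_U:
  assumes "z \<noteq> 0"
  shows "(z - 1 / z) * poly (cheb_U k) (2 - z - 1 / z) = z ^ k - (1 / z) ^ k"
proof (induction k rule: induct_nat_012)
  case 0 show ?case by (simp add: cheb_U_def)
next
  case 1 show ?case using assms by (simp add: cheb_U_def binomial_eq_0)
next
  case (ge2 k)
  have "(z - 1 / z) * poly (cheb_U (Suc (Suc k))) (2 - z - 1 / z) =
      (z + 1 / z) * ((z - 1 / z) * poly (cheb_U (Suc k)) (2 - z - 1 / z)) - (z - 1 / z) * poly
          (cheb_U k) (2 - z - 1 / z)"
  proof -
    define w where "w = 2 - z - 1 / z"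
    have "poly (cheb_U (Suc (Suc k))) w = (2 - w) * poly (cheb_U (Suc k)) w - poly (cheb_U k) w"
      by (simp add: cheb_U_rec algebra_simps)
    moreover have "2 - w = z + 1 / z" by (simp add: w_def)
    ultimately show ?thesis unfolding w_def[symmetric] by (simp only: right_diff_distrib mult_ac)
  qed
  also have "\<dots> = (z + 1 / z) * (z ^ Suc k - (1 / z) ^ Suc k) - (z ^ k - (1 / z) ^ k)"
    using ge2 by simp
  also have "\<dots> = z ^ Suc (Suc k) - (1 / z) ^ Suc (Suc k)"
    using assms by (simp add: field_simps)
  finally show ?case .
qed

text \<open>For x = 2 - z - 1/z the sum times z - 1/z equals A(z) - A(1/z), which
  \<open>schur_nonzero\<close> keeps away from 0 when |z| > 1. Since z and 1/z give the same x, a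
  root forces |z| = 1, and then x = 2 - 2 Re z.\<close>

lemma nonneg_roots_cheb_U_sum:
  fixes a :: "nat \<Rightarrow> real"
  assumes a0: "a 0 = 0" and inc: "\<And>k. k < n \<Longrightarrow> a k \<le> a (Suc k)" and an: "a n > 0"
  shows "nonneg_roots (\<Sum>k\<le>n. smult (of_real (a k)) (cheb_U k))"
  unfolding nonneg_roots_def
proof (intro allI impI)
  fix x assume x: "poly (\<Sum>k\<le>n. smult (of_real (a k)) (cheb_U k)) x = 0"
  define s where "s = (2 - x) / 2"
  \<comment> \<open>A solution of z + 1/z = 2 - x; the other choice of the square root gives its
    inverse.\<close>
  define z where "z = s + csqrt (s\<^sup>2 - 1)"
  have zz: "z * (s - csqrt (s\<^sup>2 - 1)) = 1"
    by (simp add: z_def algebra_simps flip: power2_eq_square)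
  hence z0: "z \<noteq> 0" by auto
  hence iz: "1 / z = s - csqrt (s\<^sup>2 - 1)" using zz by (simp add: field_simps)
  have xz: "x = 2 - z - 1 / z" unfolding iz by (simp add: z_def s_def)
  have no: False if w: "norm w > 1" "x = 2 - w - 1 / w" for w
  proof -
    have "w \<noteq> 0" using w by auto
    have "(w - 1 / w) * poly (\<Sum>k\<le>n. smult (of_real (a k)) (cheb_U k)) x =
        (\<Sum>k\<le>n. of_real (a k) * ((w - 1 / w) * poly (cheb_U k) x))"
      by (simp add: poly_sum sum_distrib_left mult_ac)
    also have "\<dots> = (\<Sum>k\<le>n. of_real (a k) * w ^ k) - (\<Sum>k\<le>n. of_real (a k) * (1 / w) ^ k)"
      unfolding w(2) poly_cheb_U[OF \<open>w \<noteq> 0\<close>] by (simp add: algebra_simps sum_subtractf)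
    finally show False using x schur_nonzero[of a n w, OF a0 inc an w(1)] by simp
  qed
  have "\<not> norm z > 1" using no[of z] xz by blast
  moreover have "x = 2 - 1 / z - 1 / (1 / z)" using xz by simp
  hence "\<not> norm (1 / z) > 1" using no[of "1 / z"] by blast
  ultimately have n1: "norm z = 1" using z0 by (auto simp: norm_divide field_simps)
  hence "1 / z = cnj z" by (simp add: divide_conv_cnj)
  moreover have "Re z \<le> 1" using complex_Re_le_cmod[of z] n1 by simp
  ultimately show "Im x = 0 \<and> Re x \<ge> 0" unfolding xz by simp
qed

lemma euler_vmono_cheb_U_sum:
  fixes a :: "nat \<Rightarrow> real" and s :: real
  assumes a0: "a 0 = 0" and inc: "\<And>k. k < n \<Longrightarrow> a k \<le> a (Suc k)" and an: "a n > 0" and s: "s > 0"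
  shows "euler_vmono (\<lambda>j. of_real (s ^ j * ((-1) ^ j * (\<Sum>k\<le>n. a k * real ((k + j) choose (2 * j +
      1))))))"
proof -
  define P where "P = (\<Sum>k\<le>n. smult (of_real (a k)) (cheb_U k))"
  have P: "nonneg_roots P" unfolding P_def using a0 inc an by (rule nonneg_roots_cheb_U_sum)
  have "nonneg_roots (pcompose P [:0, of_real s:])"
    unfolding nonneg_roots_def
  proof (intro allI impI)
    fix w assume "poly (pcompose P [:0, of_real s:]) w = 0"
    hence "poly P (of_real s * w) = 0" by (simp add: poly_pcompose mult.commute)
    hence "Im (of_real s * w) = 0 \<and> Re (of_real s * w) \<ge> 0" using P by (auto simp: nonneg_roots_def)
    thus "Im w = 0 \<and> Re w \<ge> 0" using s by (simp add: zero_le_mult_iff)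
  qed
  hence "euler_vmono (coeff (pcompose P [:0, of_real s:]))" by (rule euler_vmono_coeff)
  also have "coeff (pcompose P [:0, of_real s:]) = (\<lambda>j. of_real (s ^ j * ((-1) ^ j * (\<Sum>k\<le>n. a k *
      real ((k + j) choose (2 * j + 1))))))"
    by (rule ext, subst coeff_pcompose_linear) (simp add: P_def coeff_sum coeff_cheb_U
        sum_distrib_left mult_ac)
  finally show ?thesis .
qed

subsection \<open>Sine transforms of increasing weights\<close>

text \<open>The product (k - j) ... (k + j) equals (2j + 1)! times the binomial coefficient; passing
  to j + 1 multiplies it by (k + j + 1)(k - j - 1) = k^2 - (j + 1)^2. It replaces k^(2j+1) when
  sines are replaced by Chebyshev polynomials.\<close>

lemma fact_choose_step:
  "fact (2 * Suc j + 1) * real ((k + Suc j) choose (2 * Suc j + 1)) =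
     (real k + real j + 1) * (real k - real j - 1) * (fact (2 * j + 1) * real ((k + j) choose (2 *
         j + 1)))"
proof -
  have 1: "real (2 * j + 3) * real (Suc (k + j) choose Suc (2 * j + 2)) =
      real (Suc (k + j)) * real ((k + j) choose (2 * j + 2))"
    using Suc_times_binomial_eq[of "k + j" "2 * j + 2"] by (metis of_nat_mult mult.commute
        add_Suc_right numeral_3_eq_3 numeral_2_eq_2 Suc_eq_plus1)
  have 2: "real (2 * j + 2) * real ((k + j) choose (2 * j + 2)) =
      (real k - real j - 1) * real ((k + j) choose (2 * j + 1))"
  proof (cases "k > j")
    case True
    have "(2 * j + 2) * ((k + j) choose (2 * j + 2)) = (k + j - (2 * j + 1)) * ((k + j) choose (2 *
        j + 1))"
      using binomial_absorb_comp[of "k + j" "2 * j + 1"] Suc_times_binomial_eq[of "k + j - 1" "2 *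
          j + 1"]
        binomial_absorption[of "2 * j + 1" "k + j"] by simp
    hence "real (2 * j + 2) * real ((k + j) choose (2 * j + 2)) =
        real (k + j - (2 * j + 1)) * real ((k + j) choose (2 * j + 1))"
      by (simp only: flip: of_nat_mult)
    also have "real (k + j - (2 * j + 1)) = real k - real j - 1" using True
        by (simp add: of_nat_diff)
    finally show ?thesis .
  next
    case False
    thus ?thesis by (simp add: binomial_eq_0)
  qed
  have f: "fact (2 * Suc j + 1) = real (2 * j + 3) * (real (2 * j + 2) * fact (2 * j + 1))"
    by (simp add: algebra_simps)
  have "fact (2 * Suc j + 1) * real ((k + Suc j) choose (2 * Suc j + 1))
      = real (2 * j + 2) * fact (2 * j + 1) * (real (2 * j + 3) * real (Suc (k + j) choose Suc (2 *
          j + 2)))"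
    unfolding f by (simp add: mult_ac del: binomial_Suc_Suc)
  also have "\<dots> = fact (2 * j + 1) * real (Suc (k + j)) * (real (2 * j + 2) * real ((k + j) choose
      (2 * j + 2)))"
    unfolding 1 by (simp only: mult_ac)
  finally show ?thesis unfolding 2 by (simp add: mult_ac add_ac)
qed

lemma fact_choose_le: "fact (2 * j + 1) * real ((k + j) choose (2 * j + 1)) \<le> real k ^ (2 * j + 1)"
proof (induction j)
  case (Suc j)
  show ?case
  proof (cases "k > j")
    case True
    have "(real k + real j + 1) * (real k - real j - 1) = real k ^ 2 - (real j + 1) ^ 2"
      by (simp add: power2_eq_square algebra_simps)
    hence "(real k + real j + 1) * (real k - real j - 1) \<le> real k ^ 2" by simp
    hence "(real k + real j + 1) * (real k - real j - 1) * (fact (2 * j + 1) * real ((k + j) choose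
        (2 * j + 1)))
        \<le> real k ^ 2 * real k ^ (2 * j + 1)"
      using Suc.IH True by (intro mult_mono) auto
    also have "\<dots> = real k ^ (2 * Suc j + 1)" by (simp flip: power_add)
    finally show ?thesis unfolding fact_choose_step .
  next
    case False
    thus ?thesis by (simp add: binomial_eq_0)
  qed
qed simp

text \<open>Each of the 2j + 1 factors k - j, ..., k + j is at least k - j; for k \<le> j truncated
  subtraction makes the left side 0.\<close>

lemma fact_choose_ge: "real (k - j) ^ (2 * j + 1) \<le> fact (2 * j + 1) * real ((k + j) choose (2 * j
    + 1))"
proof (induction j)
  case (Suc j)
  show ?case
  proof (cases "k > j")
    case True
    hence e: "real (k - Suc j) = real k - real j - 1" by (simp add: of_nat_diff)
    have "real (k - Suc j) ^ (2 * Suc j + 1) = (real (k - Suc j) * real (k - Suc j)) * real (k -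
        Suc j) ^ (2 * j + 1)"
      by simp
    also have "\<dots> \<le> ((real k + real j + 1) * (real k - real j - 1)) * (fact (2 * j + 1) * real ((k +
        j) choose (2 * j + 1)))"
    proof (intro mult_mono)
      have "real (k - Suc j) ^ (2 * j + 1) \<le> real (k - j) ^ (2 * j + 1)" by (intro power_mono) auto
      also note Suc.IH
      finally show "real (k - Suc j) ^ (2 * j + 1) \<le> fact (2 * j + 1) * real ((k + j) choose (2 * j
          + 1))" .
    qed (use True e in auto)
    finally show ?thesis unfolding fact_choose_step .
  qed simp
qed simp

lemma power_Suc_diff_bounds:
  fixes x :: real assumes "x \<ge> 0"
  shows "(x + 1) ^ Suc p - x ^ Suc p \<le> real (Suc p) * (x + 1) ^ p"
    and "real (Suc p) * x ^ p \<le> (x + 1) ^ Suc p - x ^ Suc p"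
proof -
  have e: "(x + 1) ^ Suc p - x ^ Suc p = (\<Sum>q<Suc p. (x + 1) ^ q * x ^ (p - q))"
    by (subst diff_power_eq_sum) simp
  have "(\<Sum>q<Suc p. (x + 1) ^ q * x ^ (p - q)) \<le> (\<Sum>q<Suc p. (x + 1) ^ q * (x + 1) ^ (p - q))"
    using assms by (intro sum_mono mult_left_mono power_mono) auto
  also have "\<dots> = (\<Sum>q<Suc p. (x + 1) ^ p)" by (intro sum.cong) (auto simp flip: power_add)
  finally show "(x + 1) ^ Suc p - x ^ Suc p \<le> real (Suc p) * (x + 1) ^ p" unfolding e by simp
  have "(\<Sum>q<Suc p. x ^ p) = (\<Sum>q<Suc p. x ^ q * x ^ (p - q))"
      by (intro sum.cong) (auto simp flip: power_add)
  also have "\<dots> \<le> (\<Sum>q<Suc p. (x + 1) ^ q * x ^ (p - q))"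
    using assms by (intro sum_mono mult_right_mono power_mono) auto
  finally show "real (Suc p) * x ^ p \<le> (x + 1) ^ Suc p - x ^ Suc p" unfolding e by simp
qed

text \<open>Obtained by adding up the bounds on differences of consecutive (p + 1)-st powers; this
  is the discrete form of comparison with the integral of t^p.\<close>

lemma sum_power_bounds:
  shows "real n ^ Suc p \<le> real (Suc p) * (\<Sum>k\<le>n. real k ^ p)"
    and "real (Suc p) * (\<Sum>k\<le>n. real k ^ p) \<le> real (Suc n) ^ Suc p"
proof (induction n)
  case 0
  { case 1 show ?case by simp }
  { case 2 show ?case by (cases p) auto }
next
  case (Suc n)
  { case 1
    show ?case using Suc.IH(1) power_Suc_diff_bounds(1)[of "real n" p]
        by (simp add: algebra_simps) }
  { case 2
    show ?case using Suc.IH(2) power_Suc_diff_bounds(2)[of "real (Suc n)" p]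
        by (simp add: algebra_simps) }
qed

text \<open>A Riemann sum with mesh 1/n for the integral of t^(2i) t^(2j+1) over [0, 1], with the
  product of \<open>fact_choose_step\<close> in place of k^(2j+1).\<close>

definition riemann_ratio :: "nat \<Rightarrow> nat \<Rightarrow> nat \<Rightarrow> real" where
  "riemann_ratio i j n = (\<Sum>k\<le>n. real k ^ (2 * i) * (fact (2 * j + 1) * real ((k + j) choose (2 * j
      + 1)))) /
     real n ^ (2 * i + 2 * j + 2)"

lemma riemann_ratio_upper_aux:
  "(\<Sum>k\<le>n. real k ^ (2 * i) * (fact (2 * j + 1) * real ((k + j) choose (2 * j + 1)))) \<le>
     (\<Sum>k\<le>n. real k ^ (2 * i + 2 * j + 1))"
proof (intro sum_mono)
  fix k
  have "real k ^ (2 * i) * (fact (2 * j + 1) * real ((k + j) choose (2 * j + 1))) \<le>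
      real k ^ (2 * i) * real k ^ (2 * j + 1)"
    by (intro mult_left_mono fact_choose_le) auto
  thus "real k ^ (2 * i) * (fact (2 * j + 1) * real ((k + j) choose (2 * j + 1))) \<le>
      real k ^ (2 * i + 2 * j + 1)"
    by (simp only: power_add mult.assoc)
qed

lemma riemann_ratio_nonneg: "riemann_ratio i j n \<ge> 0"
  unfolding riemann_ratio_def by (intro divide_nonneg_nonneg sum_nonneg) auto

text \<open>This bound, uniform in n and j, supplies the majorant for the passage to the limit in
  the power series.\<close>

lemma riemann_ratio_le_1: "riemann_ratio i j (Suc n) \<le> 1"
proof -
  have "(\<Sum>k\<le>Suc n. real k ^ (2 * i + 2 * j + 1)) = (\<Sum>k\<in>{1..Suc n}. real k ^ (2 * i + 2 * j + 1))"
    by (intro sum.mono_neutral_right) auto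
  also have "\<dots> \<le> (\<Sum>k\<in>{1..Suc n}. real (Suc n) ^ (2 * i + 2 * j + 1))"
    by (intro sum_mono power_mono) auto
  also have "\<dots> = real (Suc n) ^ (2 * i + 2 * j + 2)" by simp
  finally have "(\<Sum>k\<le>Suc n. real k ^ (2 * i) * (fact (2 * j + 1) * real ((k + j) choose (2 * j +
      1)))) \<le> real (Suc n) ^ (2 * i + 2 * j + 2)"
    using riemann_ratio_upper_aux[of i j "Suc n"] by linarith
  thus ?thesis unfolding riemann_ratio_def by (subst divide_le_eq_1_pos) auto
qed

text \<open>With p = 2i + 2j + 1 the ratio lies between ((n - j)/n)^(p+1) and ((n + 1)/n)^(p+1),
  each divided by p + 1; the index \<open>Suc n\<close> avoids division by 0.\<close>

lemma riemann_ratio_tendsto: "(\<lambda>n. riemann_ratio i j (Suc n)) \<longlonglongrightarrow> 1 / real (2 * i + 2 * j + 2)"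
proof -
  define p where "p = 2 * i + 2 * j + 1"
  have sp: "2 * i + 2 * j + 2 = Suc p" by (simp add: p_def)
  have up: "riemann_ratio i j n \<le> (real (Suc n) / real n) ^ Suc p / real (Suc p)" for n
  proof -
    have "riemann_ratio i j n \<le> (\<Sum>k\<le>n. real k ^ p) / real n ^ Suc p"
      unfolding riemann_ratio_def sp using riemann_ratio_upper_aux[of i j n]
          by (intro divide_right_mono) (auto simp: p_def)
    also have "\<dots> \<le> (real (Suc n) ^ Suc p / real (Suc p)) / real n ^ Suc p"
      using sum_power_bounds(2)[of p n]
      by (intro divide_right_mono) (auto simp: field_simps simp del: of_nat_Suc power_Suc)
    finally show ?thesis by (simp add: power_divide divide_divide_eq_left mult.commute del:
        power_Suc of_nat_Suc)
  qed
  have lo: "(real (n - j) / real n) ^ Suc p / real (Suc p) \<le> riemann_ratio i j n" for n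
  proof (cases "j \<le> n")
    case True
    have "(\<Sum>k\<le>n - j. real k ^ p) = (\<Sum>k\<in>{j..n}. real (k - j) ^ p)"
      using True by (intro sum.reindex_bij_witness[of _ "\<lambda>k. k - j" "\<lambda>k. k + j"]) auto
    also have "\<dots> \<le> (\<Sum>k\<le>n. real (k - j) ^ p)" by (intro sum_mono2) auto
    also have "\<dots> \<le> (\<Sum>k\<le>n. real k ^ (2 * i) * (fact (2 * j + 1) * real ((k + j) choose (2 * j +
        1))))"
    proof (intro sum_mono)
      fix k
      have "real (k - j) ^ p = real (k - j) ^ (2 * i) * real (k - j) ^ (2 * j + 1)"
        by (simp add: p_def power_add)
      also have "\<dots> \<le> real k ^ (2 * i) * (fact (2 * j + 1) * real ((k + j) choose (2 * j + 1)))"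
        by (intro mult_mono fact_choose_ge power_mono) auto
      finally show "real (k - j) ^ p \<le> \<dots>" .
    qed
    finally have s: "(\<Sum>k\<le>n - j. real k ^ p) / real n ^ Suc p \<le> riemann_ratio i j n"
      unfolding riemann_ratio_def sp by (intro divide_right_mono) auto
    have "(real (n - j) ^ Suc p / real (Suc p)) / real n ^ Suc p \<le>
        (\<Sum>k\<le>n - j. real k ^ p) / real n ^ Suc p"
      using sum_power_bounds(1)[of "n - j" p]
      by (intro divide_right_mono) (auto simp: field_simps simp del: of_nat_Suc power_Suc)
    also note s
    finally show ?thesis by (simp add: power_divide divide_divide_eq_left mult.commute del:
        power_Suc of_nat_Suc)
  qed (use riemann_ratio_nonneg[of i j n] in auto)
  show ?thesis unfolding sp
  proof (rule tendsto_sandwich)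
    have "(\<lambda>n. (real (Suc n) - real j) / real (Suc n)) \<longlonglongrightarrow> 1" by real_asymp
    moreover have "eventually (\<lambda>n. (real (Suc n) - real j) / real (Suc n) =
        real (Suc n - j) / real (Suc n)) sequentially"
      using eventually_ge_at_top[of j] by eventually_elim (simp add: of_nat_diff)
    ultimately have "(\<lambda>n. real (Suc n - j) / real (Suc n)) \<longlonglongrightarrow> 1" by (rule Lim_transform_eventually)
    hence "(\<lambda>n. (real (Suc n - j) / real (Suc n)) ^ Suc p / real (Suc p)) \<longlonglongrightarrow> 1 ^ Suc p / real (Suc
        p)"
      by (intro tendsto_intros) auto
    thus "(\<lambda>n. (real (Suc n - j) / real (Suc n)) ^ Suc p / real (Suc p)) \<longlonglongrightarrow> 1 / real (Suc p)" by simp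
    have "(\<lambda>n. real (Suc (Suc n)) / real (Suc n)) \<longlonglongrightarrow> 1" by real_asymp
    hence "(\<lambda>n. (real (Suc (Suc n)) / real (Suc n)) ^ Suc p / real (Suc p)) \<longlonglongrightarrow> 1 ^ Suc p / real (Suc
        p)"
      by (intro tendsto_intros) auto
    thus "(\<lambda>n. (real (Suc (Suc n)) / real (Suc n)) ^ Suc p / real (Suc p)) \<longlonglongrightarrow> 1 / real (Suc p)"
        by simp
  qed (rule always_eventually, rule allI, rule lo up)+
qed

text \<open>If \<open>m j\<close> is the moment of order \<open>2 j + 1\<close> of a weight on \<open>[0, 1]\<close>, then
  \<open>z * even_series (sine_coeff m) z\<close> is the sine transform of that weight.\<close>

definition sine_coeff :: "(nat \<Rightarrow> real) \<Rightarrow> nat \<Rightarrow> complex" where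
  "sine_coeff m j = of_real ((-1) ^ j * m j / fact (2 * j + 1))"

lemma norm_sine_coeff_le: "\<bar>m j\<bar> \<le> M \<Longrightarrow> norm (sine_coeff m j) \<le> M / fact (2 * j + 1)"
  by (simp add: sine_coeff_def abs_mult norm_divide norm_mult divide_right_mono del: of_real_divide
      of_real_mult fact_Suc)

lemma conv_radius_sine_coeff:
  assumes "\<And>j. \<bar>m j\<bar> \<le> M"
  shows "conv_radius (sine_coeff m) = \<infinity>"
  using fact_bound_euler(2)[OF norm_sine_coeff_le[OF assms] zero_less_one]
      by (rule conv_radius_fact_bound)

lemma tendsto_sine_coeff:
  assumes "(\<lambda>n. m n j) \<longlonglongrightarrow> l j"
  shows "(\<lambda>n. sine_coeff (m n) j) \<longlonglongrightarrow> sine_coeff l j"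
  unfolding sine_coeff_def by (intro tendsto_intros assms) auto

lemma euler_vmono_sine_coeff_limit:
  assumes "\<And>n. euler_vmono (sine_coeff (m n))" "\<And>n j. \<bar>m n j\<bar> \<le> M" "\<And>j. (\<lambda>n. m n j) \<longlonglongrightarrow> l j"
  shows "euler_vmono (sine_coeff l)"
proof (rule euler_vmono_limit[where a = "\<lambda>n. sine_coeff (m n)"])
  show "norm (sine_coeff (m n) j) \<le> M / fact (2 * j + 1)" for n j
    using assms(2) by (rule norm_sine_coeff_le)
  show "(\<lambda>n. sine_coeff (m n) j) \<longlonglongrightarrow> sine_coeff l j" for j
    using assms(3) by (rule tendsto_sine_coeff)
qed (rule assms(1))

text \<open>A polynomial weight in t^2 with nonnegative coefficients increases on [0, 1], so its
  samples at k/(n + 1) are admissible Chebyshev coefficients. The limit of the resulting polynomials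
  is the transform of the weight.\<close>

lemma euler_vmono_moment_finite:
  assumes d: "\<And>i. d i \<ge> 0" and i0: "i0 \<le> N" "d i0 > 0"
  shows "euler_vmono (sine_coeff (\<lambda>j. \<Sum>i\<le>N. d i / real (2 * i + 2 * j + 2)))"
proof (rule euler_vmono_sine_coeff_limit)
  fix n
  define s where "s = 1 / real (Suc n) ^ 2"
  \<comment> \<open>One factor 1/(n + 1) in s is the mesh; the other offsets 1/sin \<phi>, which is
    close to (n + 1)/z. The value at k = 0 is set to 0, as the root criterion demands, and this does
    not change the sum because \<open>cheb_U 0\<close> is 0.\<close>
  define a where "a k = (if k = 0 then 0 else \<Sum>i\<le>N. d i * (real k / real (Suc n)) ^ (2 * i) * s)"
      for k
  have s: "s > 0" by (simp add: s_def)
  have "euler_vmono (\<lambda>j. of_real (s ^ j * ((-1) ^ j * (\<Sum>k\<le>Suc n. a k * real ((k + j) choose (2 * j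
      + 1))))))"
  proof (rule euler_vmono_cheb_U_sum)
    show "a 0 = 0" by (simp add: a_def)
    fix k assume "k < Suc n"
    show "a k \<le> a (Suc k)"
    proof (cases "k = 0")
      case True
      thus ?thesis using d s by (auto simp: a_def intro!: sum_nonneg mult_nonneg_nonneg)
    next
      case False
      thus ?thesis using d s by (auto simp: a_def intro!: sum_mono mult_right_mono mult_left_mono
          power_mono divide_right_mono)
    qed
  next
    have "0 < d i0 * (real (Suc n) / real (Suc n)) ^ (2 * i0) * s" using i0 s by simp
    also have "\<dots> \<le> a (Suc n)" unfolding a_def using d s i0
      by (auto intro!: member_le_sum mult_nonneg_nonneg)
    finally show "a (Suc n) > 0" .
  qed (rule s)
  also have "(\<lambda>j. of_real (s ^ j * ((-1) ^ j * (\<Sum>k\<le>Suc n. a k * real ((k + j) choose (2 * j +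
      1)))))) =
      sine_coeff (\<lambda>j. \<Sum>i\<le>N. d i * riemann_ratio i j (Suc n))"
  proof
    fix j
    have "s ^ j * (\<Sum>k\<le>Suc n. a k * real ((k + j) choose (2 * j + 1))) =
        (\<Sum>k\<le>Suc n. \<Sum>i\<le>N. s ^ j * (d i * (real k / real (Suc n)) ^ (2 * i) * s * real ((k + j)
            choose (2 * j + 1))))"
      unfolding sum_distrib_left
    proof (intro sum.cong refl)
      fix k
      show "s ^ j * (a k * real ((k + j) choose (2 * j + 1))) =
          (\<Sum>i\<le>N. s ^ j * (d i * (real k / real (Suc n)) ^ (2 * i) * s * real ((k + j) choose (2 * j
              + 1))))"
        by (cases "k = 0") (auto simp: a_def binomial_eq_0 sum_distrib_left sum_distrib_right)
    qed
    also have "\<dots> = (\<Sum>i\<le>N. \<Sum>k\<le>Suc n. s ^ j * (d i * (real k / real (Suc n)) ^ (2 * i) * s * real ((k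
        + j) choose (2 * j + 1))))"
      by (rule sum.swap)
    also have "\<dots> = (\<Sum>i\<le>N. d i * riemann_ratio i j (Suc n) / fact (2 * j + 1))"
    proof (intro sum.cong refl)
      fix i
      have s': "s ^ j * (1 / real (Suc n)) ^ (2 * i) * s = 1 / real (Suc n) ^ (2 * i + 2 * j + 2)"
        by (simp add: s_def power_add power_mult power_divide power2_eq_square del: of_nat_Suc)
      have "(\<Sum>k\<le>Suc n. s ^ j * (d i * (real k / real (Suc n)) ^ (2 * i) * s * real ((k + j) choose
          (2 * j + 1))))
         = (\<Sum>k\<le>Suc n. d i * (s ^ j * (1 / real (Suc n)) ^ (2 * i) * s) * (real k ^ (2 * i) * (fact
             (2 * j + 1) * real ((k + j) choose (2 * j + 1)))) / fact (2 * j + 1))"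
        by (intro sum.cong refl) (simp add: power_divide mult_ac del: of_nat_Suc fact_Suc)
      also have "\<dots> = d i * riemann_ratio i j (Suc n) / fact (2 * j + 1)"
        unfolding s' riemann_ratio_def by (simp add: sum_distrib_left sum_divide_distrib del:
            of_nat_Suc fact_Suc sum.atMost_Suc)
      finally show "(\<Sum>k\<le>Suc n. s ^ j * (d i * (real k / real (Suc n)) ^ (2 * i) * s * real ((k + j)
          choose (2 * j + 1))))
         = d i * riemann_ratio i j (Suc n) / fact (2 * j + 1)" .
    qed
    finally have "s ^ j * (\<Sum>k\<le>Suc n. a k * real ((k + j) choose (2 * j + 1))) =
        (\<Sum>i\<le>N. d i * riemann_ratio i j (Suc n)) / fact (2 * j + 1)"
      by (simp only: sum_divide_distrib)
    hence "(-1) ^ j * (s ^ j * (\<Sum>k\<le>Suc n. a k * real ((k + j) choose (2 * j + 1)))) =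
        (-1) ^ j * ((\<Sum>i\<le>N. d i * riemann_ratio i j (Suc n)) / fact (2 * j + 1))"
      by (simp only:)
    thus "of_real (s ^ j * ((-1) ^ j * (\<Sum>k\<le>Suc n. a k * real ((k + j) choose (2 * j + 1))))) =
      sine_coeff (\<lambda>j. \<Sum>i\<le>N. d i * riemann_ratio i j (Suc n)) j"
      unfolding sine_coeff_def by (simp only: mult_ac times_divide_eq_right)
  qed
  finally show "euler_vmono (sine_coeff (\<lambda>j. \<Sum>i\<le>N. d i * riemann_ratio i j (Suc n)))" .
next
  fix n j
  have "\<bar>\<Sum>i\<le>N. d i * riemann_ratio i j (Suc n)\<bar> \<le> (\<Sum>i\<le>N. \<bar>d i * riemann_ratio i j (Suc n)\<bar>)"
      by (rule sum_abs)
  also have "\<dots> \<le> (\<Sum>i\<le>N. d i)"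
    using d riemann_ratio_nonneg riemann_ratio_le_1 by (intro sum_mono) (simp add: abs_mult
        mult_left_le)
  finally show "\<bar>\<Sum>i\<le>N. d i * riemann_ratio i j (Suc n)\<bar> \<le> (\<Sum>i\<le>N. d i)" .
next
  fix j
  have "(\<lambda>n. \<Sum>i\<le>N. d i * riemann_ratio i j (Suc n)) \<longlonglongrightarrow> (\<Sum>i\<le>N. d i * (1 / real (2 * i + 2 * j + 2)))"
    by (intro tendsto_intros riemann_ratio_tendsto)
  thus "(\<lambda>n. \<Sum>i\<le>N. d i * riemann_ratio i j (Suc n)) \<longlonglongrightarrow> (\<Sum>i\<le>N. d i / real (2 * i + 2 * j + 2))"
      by simp
qed

text \<open>The moments of order \<open>2 j + 1\<close> of the weight \<open>\<Sum>i. d i * t ^ (2 * i)\<close>.\<close>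

definition weight_moment :: "(nat \<Rightarrow> real) \<Rightarrow> nat \<Rightarrow> real" where
  "weight_moment d j = (\<Sum>i. d i / real (2 * i + 2 * j + 2))"

text \<open>Summability is asked only of the first moment, so that weights unbounded at t = 1 are
  covered, such as (1 - t^2) powr (b - 1) with b < 1.\<close>

lemma weight_moment_facts:
  assumes d: "\<And>i. d i \<ge> 0" and s: "summable (\<lambda>i. d i / real (2 * i + 2))"
  shows summable_weight_moment: "summable (\<lambda>i. d i / real (2 * i + 2 * j + 2))"
    and weight_moment_bound: "\<bar>weight_moment d j\<bar> \<le> weight_moment d 0"
    and weight_moment_partial_bound: "\<bar>\<Sum>i\<le>N. d i / real (2 * i + 2 * j + 2)\<bar> \<le> weight_moment d 0"
    and weight_moment_pos: "d i0 > 0 \<Longrightarrow> weight_moment d j > 0"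
proof -
  have le: "d i / real (2 * i + 2 * j + 2) \<le> d i / real (2 * i + 2)" for i
    using d by (intro divide_left_mono) auto
  show sj: "summable (\<lambda>i. d i / real (2 * i + 2 * j + 2))"
    using s by (rule summable_comparison_test_ev[rotated]) (use le d in \<open>auto intro!:
        always_eventually\<close>)
  have nn: "weight_moment d j \<ge> 0" unfolding weight_moment_def using d sj
      by (intro suminf_nonneg) auto
  have m0: "weight_moment d 0 = (\<Sum>i. d i / real (2 * i + 2))" by (simp add: weight_moment_def)
  have "weight_moment d j \<le> weight_moment d 0" unfolding m0 unfolding weight_moment_def using le sj
      s by (intro suminf_le) auto
  thus "\<bar>weight_moment d j\<bar> \<le> weight_moment d 0" using nn by simp
  have "(\<Sum>i\<le>N. d i / real (2 * i + 2 * j + 2)) \<le> weight_moment d j"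
    unfolding weight_moment_def using d sj by (intro sum_le_suminf) auto
  moreover have "(\<Sum>i\<le>N. d i / real (2 * i + 2 * j + 2)) \<ge> 0" using d by (intro sum_nonneg) auto
  ultimately show "\<bar>\<Sum>i\<le>N. d i / real (2 * i + 2 * j + 2)\<bar> \<le> weight_moment d 0"
    using \<open>weight_moment d j \<le> weight_moment d 0\<close> by linarith
  show "weight_moment d j > 0" if "d i0 > 0"
    unfolding weight_moment_def using d sj that by (intro suminf_pos2[of _ i0]) auto
qed

lemma tendsto_weight_moment_partial:
  assumes d: "\<And>i. d i \<ge> 0" and s: "summable (\<lambda>i. d i / real (2 * i + 2))"
  shows "(\<lambda>N. \<Sum>i\<le>N. d i / real (2 * i + 2 * j + 2)) \<longlonglongrightarrow> weight_moment d j"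
  using summable_LIMSEQ'[OF summable_weight_moment[OF d s]] unfolding weight_moment_def .

lemma euler_vmono_weight_moment:
  assumes d: "\<And>i. d i \<ge> 0" and s: "summable (\<lambda>i. d i / real (2 * i + 2))" and i0: "d i0 > 0"
  shows "euler_vmono (sine_coeff (weight_moment d))"
proof (rule euler_vmono_sine_coeff_limit)
  \<comment> \<open>Every partial sum reaches at least \<open>i0\<close>, so each finite weight has
    a positive coefficient.\<close>
  show "euler_vmono (sine_coeff (\<lambda>j. \<Sum>i\<le>N + i0. d i / real (2 * i + 2 * j + 2)))" for N
    by (rule euler_vmono_moment_finite[of d i0]) (use d i0 in auto)
  show "\<bar>\<Sum>i\<le>N + i0. d i / real (2 * i + 2 * j + 2)\<bar> \<le> weight_moment d 0" for N j
    using d s by (rule weight_moment_partial_bound)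
  show "(\<lambda>N. \<Sum>i\<le>N + i0. d i / real (2 * i + 2 * j + 2)) \<longlonglongrightarrow> weight_moment d j" for j
    using LIMSEQ_ignore_initial_segment[OF tendsto_weight_moment_partial[OF d s, of j], of i0] .
qed

text \<open>The weights (2n + 2) t^(2n) concentrate at t = 1 and all their moments tend to 1; the
  limit function is sin z / z.\<close>

lemma euler_vmono_sin: "euler_vmono (sine_coeff (\<lambda>_. 1))"
proof (rule euler_vmono_sine_coeff_limit)
  fix n
  have "euler_vmono (sine_coeff (\<lambda>j. \<Sum>i\<le>n. (if i = n then real (2 * n + 2) else 0) / real (2 * i +
      2 * j + 2)))"
    by (rule euler_vmono_moment_finite[of "\<lambda>i. if i = n then real (2 * n + 2) else 0" n]) auto
  also have "(\<lambda>j. \<Sum>i\<le>n. (if i = n then real (2 * n + 2) else 0) / real (2 * i + 2 * j + 2)) =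
      (\<lambda>j. real (2 * n + 2) / real (2 * n + 2 * j + 2))"
  proof
    fix j
    have "(\<Sum>i\<le>n. (if i = n then real (2 * n + 2) else 0) / real (2 * i + 2 * j + 2)) =
        (\<Sum>i\<le>n. if i = n then real (2 * n + 2) / real (2 * i + 2 * j + 2) else 0)"
      by (intro sum.cong) auto
    thus "(\<Sum>i\<le>n. (if i = n then real (2 * n + 2) else 0) / real (2 * i + 2 * j + 2)) =
        real (2 * n + 2) / real (2 * n + 2 * j + 2)"
      by simp
  qed
  finally show "euler_vmono (sine_coeff (\<lambda>j. real (2 * n + 2) / real (2 * n + 2 * j + 2)))" .
  show "\<bar>real (2 * n + 2) / real (2 * n + 2 * j + 2)\<bar> \<le> 1" for j by (simp add: divide_le_eq_1)
next
  show "(\<lambda>n. real (2 * n + 2) / real (2 * n + 2 * j + 2)) \<longlonglongrightarrow> 1" for j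
    by real_asymp
qed

lemma even_series_zero: "even_series a 0 = a 0"
  unfolding even_series_def using powser_zero[of a] by simp

lemma even_series_even: "even_series a (- z) = even_series a z"
  by (simp add: even_series_def)

lemma even_series_of_real:
  assumes "conv_radius a = \<infinity>" "\<And>j. a j = of_real (r j)"
  shows "even_series a (of_real x) = of_real (\<Sum>j. r j * (x\<^sup>2) ^ j)" "summable (\<lambda>j. r j * (x\<^sup>2) ^ j)"
proof -
  have "summable (\<lambda>j. complex_of_real (r j * (x\<^sup>2) ^ j))"
    using summable_even_series[OF assms(1), of "of_real (x\<^sup>2)"] by (simp add: assms(2))
  thus s: "summable (\<lambda>j. r j * (x\<^sup>2) ^ j)" by (rule summable_complex_of_real[THEN iffD1])
  show "even_series a (of_real x) = of_real (\<Sum>j. r j * (x\<^sup>2) ^ j)"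
    by (simp add: even_series_def assms(2) suminf_of_real[OF s])
qed

lemma deriv2_even_series_zero:
  assumes "conv_radius a = \<infinity>"
  shows "deriv (deriv (even_series a)) 0 = 2 * a 1"
proof -
  have r: "fps_conv_radius (fps_deriv (Abs_fps a)) = \<infinity>"
    using fps_conv_radius_deriv[of "Abs_fps a"] assms by (simp add: fps_conv_radius_def)
  define g where "g = eval_fps (fps_deriv (Abs_fps a))"
  have g: "(g has_field_derivative deriv g w) (at w)" for w
    unfolding g_def by (rule holomorphic_derivI[of _ UNIV]) (auto intro!: holomorphic_intros simp:
        r)
  have "deriv (even_series a) = (\<lambda>z. 2 * z * g (z\<^sup>2))"
    using DERIV_imp_deriv[OF even_series_has_field_derivative[OF assms]] by (auto simp: g_def)
  moreover have "((\<lambda>z. 2 * z * g (z\<^sup>2)) has_field_derivative (2 * g (0\<^sup>2) + deriv g (0\<^sup>2) * (2 * 0)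
      * (2 * 0))) (at 0)"
    by (rule derivative_eq_intros DERIV_chain2[OF g] refl | simp)+
  ultimately have "deriv (deriv (even_series a)) 0 = 2 * g 0" by (simp add: DERIV_imp_deriv)
  also have "g 0 = a 1" by (simp add: g_def eval_fps_at_0)
  finally show ?thesis .
qed

lemma even_vmono_even_series:
  assumes a: "conv_radius a = \<infinity>" "\<And>j. a j = of_real (r j)" and v: "vmono (even_series a)"
      and nz: "r 0 \<noteq> 0" "r 1 \<noteq> 0"
  shows "even_vmono (even_series a)"
proof
  show "even_series a (of_real x) \<in> \<real>" for x using even_series_of_real(1)[OF a]
      by (simp del: of_real_power)
qed (use assms in \<open>auto simp: even_series_even even_series_zero deriv2_even_series_zero intro:
    holomorphic_even_series\<close>)

lemma even_vmono_euler_vmono: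
  assumes a: "conv_radius a = \<infinity>" "\<And>j. a j = of_real (r j)" and v: "euler_vmono a"
      and nz: "r 0 \<noteq> 0" "r 1 \<noteq> 0"
  shows "even_vmono (even_series a)" "c > 0 \<Longrightarrow> even_vmono (even_series (euler_seq c a))"
proof -
  show "even_vmono (even_series a)" using v by (intro even_vmono_even_series[OF a] nz) (auto simp:
      euler_vmono_def)
  show "even_vmono (even_series (euler_seq c a))" if "c > 0"
  proof (rule even_vmono_even_series[of _ "\<lambda>j. (c + 2 * real j) * r j"])
    show "conv_radius (euler_seq c a) = \<infinity>" using a(1) by (rule conv_radius_euler)
    show "euler_seq c a j = of_real ((c + 2 * real j) * r j)" for j
        by (simp add: euler_seq_def a(2))
  qed (use v nz that in \<open>auto simp: euler_vmono_def\<close>)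
qed

section \<open>Sine transforms of even powers and their signs at multiples of pi\<close>

definition power_moment :: "nat \<Rightarrow> nat \<Rightarrow> real" where "power_moment i j =
    1 / real (2 * i + 2 * j + 2)"
text \<open>This is 1/x times the integral of t^(2i) sin(x t) over [0, 1], or x^(-2i-2) times the
  integral of s^(2i) sin s over [0, x].\<close>

definition power_sine :: "nat \<Rightarrow> real \<Rightarrow> real" where "power_sine i x =
    Re (even_series (sine_coeff (power_moment i)) (of_real x))"

lemma conv_radius_power_moment: "conv_radius (sine_coeff (power_moment i)) = \<infinity>"
  by (rule conv_radius_sine_coeff[of _ 1]) (simp add: power_moment_def)

lemma even_series_sine_coeff_real: "conv_radius (sine_coeff m) = \<infinity> \<Longrightarrow>
    even_series (sine_coeff m) (of_real x) \<in> \<real>"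
  using even_series_of_real(1)[of "sine_coeff m" "\<lambda>j. (-1) ^ j * m j / fact (2 * j + 1)" x]
      by (simp add: sine_coeff_def)

lemma sin_even_series: "x * Re (even_series (sine_coeff (\<lambda>_. 1)) (of_real x)) = sin x"
proof -
  have c: "conv_radius (sine_coeff (\<lambda>_. 1)) = \<infinity>" by (rule conv_radius_sine_coeff[of _ 1]) simp
  have e: "sine_coeff (\<lambda>_. 1) j = of_real ((-1) ^ j / fact (2 * j + 1))" for j
      by (simp add: sine_coeff_def)
  have e1: "Re (even_series (sine_coeff (\<lambda>_. 1)) (of_real x)) =
      (\<Sum>j. (-1) ^ j / fact (2 * j + 1) * (x\<^sup>2) ^ j)"
    using even_series_of_real(1)[OF c e, of x] by (simp only: Re_complex_of_real)
  have s1: "(\<lambda>j. x * ((-1) ^ j / fact (2 * j + 1) * (x\<^sup>2) ^ j)) sums (x * (\<Sum>j. (-1) ^ j / fact (2 *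
      j + 1) * (x\<^sup>2) ^ j))"
    by (intro sums_mult summable_sums even_series_of_real(2)[OF c e])
  have s2: "(\<lambda>j. x * ((-1) ^ j / fact (2 * j + 1) * (x\<^sup>2) ^ j)) sums sin x"
  proof -
    have "x * ((-1) ^ j / fact (2 * j + 1) * (x\<^sup>2) ^ j) =
        (-1) ^ j / fact (2 * j + 1) * x ^ (2 * j + 1)" for j
      by (simp add: power_mult del: fact_Suc)
    thus ?thesis using sin_paired[of x] by (simp only:)
  qed
  show ?thesis unfolding e1 by (rule sums_unique2[OF s1 s2])
qed

lemma Re_of_real_mult: "Re (of_real a * z) = a * Re z"
  by simp

text \<open>The Euler transform with c = 2i + 2 cancels the denominators 2i + 2j + 2 and leaves the
  series of sin x / x; on the other hand c g + x g' is x^(1-c) times the derivative of x^c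
  g.\<close>

lemma power_sine_deriv: "((\<lambda>x. x ^ (2 * i + 2) * power_sine i x) has_real_derivative x ^ (2 * i) *
    sin x) (at x)"
proof -
  define f where "f = even_series (sine_coeff (power_moment i))"
  have hol: "f holomorphic_on UNIV" unfolding f_def by (intro holomorphic_even_series
      conv_radius_power_moment)
  have re: "f (of_real x) \<in> \<real>" for x unfolding f_def by (intro even_series_sine_coeff_real
      conv_radius_power_moment)
  have "euler_seq (real (2 * i + 2)) (sine_coeff (power_moment i)) = sine_coeff (\<lambda>_. 1)"
  proof
    fix j
    have "real (2 * i + 2) + 2 * real j = real (2 * i + 2 * j + 2)" by simp
    moreover have "real (2 * i + 2 * j + 2) \<noteq> 0" by linarith
    ultimately show "euler_seq (real (2 * i + 2)) (sine_coeff (power_moment i)) j =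
        sine_coeff (\<lambda>_. 1) j"
      unfolding euler_seq_def sine_coeff_def power_moment_def
          by (simp only: flip: of_real_mult) simp
  qed
  hence "even_series (sine_coeff (\<lambda>_. 1)) (of_real x) = of_real (real (2 * i + 2)) * f (of_real x)
      + of_real x * deriv f (of_real x)"
    using even_series_euler[OF conv_radius_power_moment[of i], of "real (2 * i + 2)" "of_real x"]
        by (simp only: f_def)
  hence "Re (even_series (sine_coeff (\<lambda>_. 1)) (of_real x)) =
      real (2 * i + 2) * power_sine i x + x * Re (deriv f (of_real x))"
    by (simp only: plus_complex.sel Re_of_real_mult power_sine_def f_def)
  hence sin: "sin x = x * (real (2 * i + 2) * power_sine i x + x * Re (deriv f (of_real x)))"
    using sin_even_series[of x] by simp
  have "(power_sine i has_real_derivative Re (deriv f (of_real x))) (at x)"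
    using deriv_real_entire(1)[OF hol re, of x] by (simp add: power_sine_def[abs_def] f_def)
  moreover have "((\<lambda>x. x ^ (2 * i + 2)) has_real_derivative real (2 * i + 2) * x ^ (2 * i + 1)) (at
      x)"
    using DERIV_pow[of "2 * i + 2" x] by simp
  ultimately have "((\<lambda>x. x ^ (2 * i + 2) * power_sine i x) has_real_derivative
      real (2 * i + 2) * x ^ (2 * i + 1) * power_sine i x + Re (deriv f (of_real x)) * x ^ (2 * i +
          2)) (at x)"
    by (intro DERIV_mult)
  also have "real (2 * i + 2) * x ^ (2 * i + 1) * power_sine i x + Re (deriv f (of_real x)) * x ^
      (2 * i + 2) = x ^ (2 * i) * sin x"
    unfolding sin by (simp add: algebra_simps power2_eq_square)
  finally show ?thesis .
qed

lemma power_sine_0: "x\<^sup>2 * power_sine 0 x = 1 - cos x"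
proof -
  have "((\<lambda>x. x\<^sup>2 * power_sine 0 x + cos x) has_real_derivative 0) (at x)" for x
    using DERIV_add[OF power_sine_deriv[of 0 x] DERIV_cos[of x]] by (simp flip: numeral_2_eq_2)
  hence "x\<^sup>2 * power_sine 0 x + cos x = 0\<^sup>2 * power_sine 0 0 + cos 0"
    using DERIV_isconst_all[of "\<lambda>x. x\<^sup>2 * power_sine 0 x + cos x" x 0] by blast
  thus ?thesis by simp
qed

text \<open>Integration by parts in \<open>\<integral> s ^ (2 * i) * sin s\<close> over \<open>[0, x]\<close>.\<close>

lemma power_sine_upper:
  assumes i: "i > 0" and x: "x > 0"
  shows "x\<^sup>2 * power_sine i x < 1 - cos x"
proof -
  define G where "G = (\<lambda>x. x ^ (2 * i + 2) * power_sine i x)"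
  have G: "(G has_real_derivative x ^ (2 * i) * sin x) (at x)" for x
    unfolding G_def by (rule power_sine_deriv)
  define H where "H x = x ^ (2 * i) * (1 - cos x) - G x" for x
  have d: "(H has_real_derivative real (2 * i) * x ^ (2 * i - 1) * (1 - cos x)) (at x)" for x
    unfolding H_def by (rule derivative_eq_intros G refl | simp)+
  \<comment> \<open>The derivative of H can vanish at later multiples of 2 pi. Strict growth is
    taken from an initial interval inside (0, pi), and beyond it monotonicity suffices.\<close>
  define y where "y = min x 1"
  have y: "0 < y" "y \<le> x" "y \<le> 1" using x by (auto simp: y_def)
  have "H 0 < H y"
  proof (rule DERIV_pos_imp_increasing_open[OF y(1)])
    fix t assume t: "0 < t" "t < y"
    have "cos t < 1" using cos_monotone_0_pi[of 0 t] t y pi_gt3 by simp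
    hence "real (2 * i) * t ^ (2 * i - 1) * (1 - cos t) > 0" using t i by simp
    thus "\<exists>D. (H has_real_derivative D) (at t) \<and> D > 0" using d[of t] by blast
  next
    show "continuous_on {0..y} H" using d by (meson DERIV_isCont continuous_at_imp_continuous_on)
  qed
  also have "H y \<le> H x"
  proof (rule DERIV_nonneg_imp_nondecreasing[OF y(2)])
    fix t assume "y \<le> t" "t \<le> x"
    hence "real (2 * i) * t ^ (2 * i - 1) * (1 - cos t) \<ge> 0" using y(1) by simp
    thus "\<exists>D. (H has_real_derivative D) (at t) \<and> D \<ge> 0" using d[of t] by blast
  qed
  finally have "x ^ (2 * i) * (x\<^sup>2 * power_sine i x) < x ^ (2 * i) * (1 - cos x)"
    using i by (simp add: H_def G_def power_add power2_eq_square mult_ac)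
  thus ?thesis using x by simp
qed

text \<open>Integration by parts with the primitive -(1 + cos s) of sin s, for which the remaining
  integral is nonnegative.\<close>

lemma power_sine_lower:
  assumes x: "x > 0"
  shows "x\<^sup>2 * power_sine i x \<ge> - (1 + cos x)"
proof (cases "i = 0")
  case True thus ?thesis using power_sine_0[of x] by simp
next
  case False
  hence i: "i > 0" by simp
  define G where "G = (\<lambda>x. x ^ (2 * i + 2) * power_sine i x)"
  have G: "(G has_real_derivative x ^ (2 * i) * sin x) (at x)" for x
    unfolding G_def by (rule power_sine_deriv)
  define H where "H x = x ^ (2 * i) * (1 + cos x) + G x" for x
  have d: "(H has_real_derivative real (2 * i) * x ^ (2 * i - 1) * (1 + cos x)) (at x)" for x
    unfolding H_def by (rule derivative_eq_intros G refl | simp)+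
  have "H 0 \<le> H x"
  proof (rule DERIV_nonneg_imp_nondecreasing[of 0])
    fix t :: real assume "0 \<le> t" "t \<le> x"
    moreover have "1 + cos t \<ge> 0" using cos_ge_minus_one[of t] by linarith
    ultimately have "real (2 * i) * t ^ (2 * i - 1) * (1 + cos t) \<ge> 0" by simp
    thus "\<exists>D. (H has_real_derivative D) (at t) \<and> D \<ge> 0" using d[of t] by blast
  qed (use x in auto)
  moreover have "H 0 = 0" using i by (simp add: H_def G_def power_0_left)
  moreover have "H x = x ^ (2 * i) * (x\<^sup>2 * power_sine i x + (1 + cos x))"
    by (simp add: H_def G_def power_add power2_eq_square algebra_simps)
  ultimately have "0 \<le> x ^ (2 * i) * (x\<^sup>2 * power_sine i x + (1 + cos x))" by (simp only:)
  moreover have "x ^ (2 * i) > 0" using x by (rule zero_less_power)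
  ultimately have "x\<^sup>2 * power_sine i x + (1 + cos x) \<ge> 0" by (metis zero_le_mult_iff not_less)
  thus ?thesis by linarith
qed

text \<open>The radius of convergence is carried through the induction because
  \<open>even_series_lincomb\<close> asks for it at each step.\<close>

lemma even_series_sine_coeff_partial:
  "even_series (sine_coeff (\<lambda>j. \<Sum>i\<le>N. d i / real (2 * i + 2 * j + 2))) z =
      (\<Sum>i\<le>N. of_real (d i) * even_series (sine_coeff (power_moment i)) z) \<and>
   conv_radius (sine_coeff (\<lambda>j. \<Sum>i\<le>N. d i / real (2 * i + 2 * j + 2))) = \<infinity>"
proof (induction N)
  case 0
  have "sine_coeff (\<lambda>j. \<Sum>i\<le>0. d i / real (2 * i + 2 * j + 2)) =
      (\<lambda>j. of_real (d 0) * sine_coeff (power_moment 0) j + 0 * sine_coeff (power_moment 0) j)"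
    by (auto simp: sine_coeff_def power_moment_def)
  thus ?case
    using even_series_lincomb[OF conv_radius_power_moment conv_radius_power_moment, of "of_real (d
        0)" 0 0 0 z]
      conv_radius_lincomb[OF conv_radius_power_moment conv_radius_power_moment, of "of_real (d 0)"
          0 0 0] by simp
next
  case (Suc N)
  have e: "sine_coeff (\<lambda>j. \<Sum>i\<le>Suc N. d i / real (2 * i + 2 * j + 2)) =
      (\<lambda>j. 1 * sine_coeff (\<lambda>j. \<Sum>i\<le>N. d i / real (2 * i + 2 * j + 2)) j + of_real (d (Suc N)) *
          sine_coeff (power_moment (Suc N)) j)"
    by (auto simp: sine_coeff_def power_moment_def add_divide_distrib algebra_simps simp del:
        fact_Suc)
  show ?case
    unfolding e even_series_lincomb[OF Suc.IH[THEN conjunct2] conv_radius_power_moment] Suc.IH[THEN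
        conjunct1]
    by (intro conjI conv_radius_lincomb conv_radius_power_moment Suc.IH[THEN conjunct2]) simp
qed

lemma even_series_weight_moment_tendsto:
  assumes d: "\<And>i. d i \<ge> 0" and s: "summable (\<lambda>i. d i / real (2 * i + 2))"
  shows "(\<lambda>N. \<Sum>i\<le>N. d i * power_sine i x) \<longlonglongrightarrow> Re (even_series (sine_coeff (weight_moment d)) (of_real
      x))"
proof -
  have "(\<lambda>N. even_series (sine_coeff (\<lambda>j. \<Sum>i\<le>N. d i / real (2 * i + 2 * j + 2))) (of_real x)) \<longlonglongrightarrow>
      even_series (sine_coeff (weight_moment d)) (of_real x)"
  proof (rule even_series_tendsto)
    show "norm (sine_coeff (\<lambda>j. \<Sum>i\<le>N. d i / real (2 * i + 2 * j + 2)) j) \<le>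
        weight_moment d 0 / fact j" for N j
      by (rule fact_bound_euler(2)[OF norm_sine_coeff_le zero_less_one]) (rule
          weight_moment_partial_bound[OF d s])
    show "(\<lambda>N. sine_coeff (\<lambda>j. \<Sum>i\<le>N. d i / real (2 * i + 2 * j + 2)) j) \<longlonglongrightarrow> sine_coeff (weight_moment
        d) j" for j
      by (rule tendsto_sine_coeff[where m = "\<lambda>N j. \<Sum>i\<le>N. d i / real (2 * i + 2 * j + 2)", OF
          tendsto_weight_moment_partial[OF d s]])
  qed
  hence "(\<lambda>N. Re (\<Sum>i\<le>N. of_real (d i) * even_series (sine_coeff (power_moment i)) (of_real x))) \<longlonglongrightarrow>
      Re (even_series (sine_coeff (weight_moment d)) (of_real x))"
    unfolding even_series_sine_coeff_partial[THEN conjunct1] by (rule tendsto_Re)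
  thus ?thesis by (simp add: power_sine_def)
qed

text \<open>At positive multiples of 2 pi the constant part of the weight contributes nothing and
  every higher power contributes a negative amount, by \<open>power_sine_upper\<close>.\<close>

lemma even_series_weight_moment_cos_1:
  assumes d: "\<And>i. d i \<ge> 0" and s: "summable (\<lambda>i. d i / real (2 * i + 2))" and x: "x > 0" "cos x = 1"
  shows "Re (even_series (sine_coeff (weight_moment d)) (of_real x)) \<le> 0" "d 1 > 0 \<Longrightarrow>
      Re (even_series (sine_coeff (weight_moment d)) (of_real x)) < 0"
proof -
  have neg: "power_sine i x \<le> 0" for i
  proof (cases "i = 0")
    case True thus ?thesis using power_sine_0[of x] x by simp
  next
    case False
    thus ?thesis using power_sine_upper[of i x] x by (simp add: mult_less_0_iff)
  qed
  have neg1: "power_sine 1 x < 0" using power_sine_upper[of 1 x] x by (simp add: mult_less_0_iff)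
  have le: "Re (even_series (sine_coeff (weight_moment d)) (of_real x)) \<le> d 1 * power_sine 1 x"
  proof (rule LIMSEQ_le_const2[OF even_series_weight_moment_tendsto[OF d s]], intro exI allI impI)
    fix N :: nat assume "N \<ge> 1"
    hence "(\<Sum>i\<le>N. d i * power_sine i x) = d 1 * power_sine 1 x + (\<Sum>i\<in>{..N} - {1}. d i * power_sine
        i x)"
      by (intro sum.remove) auto
    also have "(\<Sum>i\<in>{..N} - {1}. d i * power_sine i x) \<le> 0"
      using d neg by (intro sum_nonpos mult_nonneg_nonpos) auto
    finally show "(\<Sum>i\<le>N. d i * power_sine i x) \<le> d 1 * power_sine 1 x" by simp
  qed
  also have "d 1 * power_sine 1 x \<le> 0" using d neg by (intro mult_nonneg_nonpos)
  finally show "Re (even_series (sine_coeff (weight_moment d)) (of_real x)) \<le> 0" .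
  show "Re (even_series (sine_coeff (weight_moment d)) (of_real x)) < 0" if "d 1 > 0"
    using le mult_pos_neg[OF that neg1] by linarith
qed

text \<open>At positive odd multiples of pi no power contributes a negative amount, by
  \<open>power_sine_lower\<close>, and the constant part contributes 2/x^2 times
  \<open>d 0\<close>.\<close>

lemma even_series_weight_moment_cos_minus_1:
  assumes d: "\<And>i. d i \<ge> 0" and s: "summable (\<lambda>i. d i / real (2 * i + 2))" and x: "x > 0" "cos x =
      -1" and d0: "d 0 > 0"
  shows "Re (even_series (sine_coeff (weight_moment d)) (of_real x)) > 0"
proof -
  have pos: "power_sine i x \<ge> 0" for i
    using power_sine_lower[of x i] x by (simp add: zero_le_mult_iff)
  have "x\<^sup>2 * power_sine 0 x > 0" using power_sine_0[of x] x by simp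
  hence "0 < d 0 * power_sine 0 x" using d0 x by (simp add: zero_less_mult_iff)
  also have "d 0 * power_sine 0 x \<le> Re (even_series (sine_coeff (weight_moment d)) (of_real x))"
  proof (rule LIMSEQ_le_const[OF even_series_weight_moment_tendsto[OF d s]], intro exI allI impI)
    fix N :: nat assume "N \<ge> 0"
    show "d 0 * power_sine 0 x \<le> (\<Sum>i\<le>N. d i * power_sine i x)"
      using d pos by (intro member_le_sum) auto
  qed
  finally show ?thesis .
qed

section \<open>The Struve weight and the recurrence of its moments\<close>

text \<open>The Taylor coefficients in \<open>t\<^sup>2\<close> of \<open>(1 - t\<^sup>2) powr (b - 1)\<close>.\<close>

definition struve_weight :: "real \<Rightarrow> nat \<Rightarrow> real" where
  "struve_weight b i = pochhammer (1 - b) i / fact i"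

lemma struve_weight_Suc: "real (Suc i) * struve_weight b (Suc i) =
    (1 - b + real i) * struve_weight b i"
  by (simp add: struve_weight_def pochhammer_Suc divide_simps)

lemma struve_weight_diff: "struve_weight b i - struve_weight b (Suc i) =
    b * (struve_weight b i / real (Suc i))"
  using struve_weight_Suc[of i b] by (simp add: field_simps)

lemma struve_weight_0: "struve_weight b 0 = 1" and struve_weight_1: "struve_weight b 1 = 1 - b"
  by (simp_all add: struve_weight_def)

lemma struve_weight_nonneg: "b \<le> 1 \<Longrightarrow> struve_weight b i \<ge> 0"
proof (induction i)
  case (Suc i)
  hence "real (Suc i) * struve_weight b (Suc i) \<ge> 0" unfolding struve_weight_Suc by simp
  thus ?case by (metis not_less of_nat_0_less_iff zero_le_mult_iff zero_less_Suc)
qed (simp add: struve_weight_0)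

text \<open>By \<open>struve_weight_diff\<close> the sums of w_i/(i + 1) telescope and stay below
  1/b. The weights decrease, and a positive limit would bound the harmonic series by this convergent
  one.\<close>

lemma struve_weight_facts:
  assumes b: "0 < b" "b \<le> 1"
  shows summable_struve_weight: "summable (\<lambda>i. struve_weight b i / real (2 * i + 2))"
    and struve_weight_tendsto_0: "struve_weight b \<longlonglongrightarrow> 0"
proof -
  have nn: "struve_weight b i \<ge> 0" for i using b(2) by (rule struve_weight_nonneg)
  have tele: "(\<Sum>i<n. struve_weight b i / real (Suc i)) = (1 - struve_weight b n) / b" for n
  proof (induction n)
    case 0 thus ?case by (simp add: struve_weight_0)
  next
    case (Suc n)
    have "(\<Sum>i<Suc n. struve_weight b i / real (Suc i)) =
        (1 - struve_weight b n) / b + (struve_weight b n - struve_weight b (Suc n)) / b"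
      using Suc.IH struve_weight_diff[of b n] b by simp
    thus ?case by (simp add: diff_divide_distrib)
  qed
  have s: "summable (\<lambda>i. struve_weight b i / real (Suc i))"
  proof (rule summableI_nonneg_bounded)
    show "(\<Sum>i<n. struve_weight b i / real (Suc i)) \<le> 1 / b" for n
      unfolding tele using nn[of n] b by (intro divide_right_mono) auto
  qed (use nn in auto)
  have "(\<lambda>i. struve_weight b i / real (2 * i + 2)) = (\<lambda>i. (1 / 2) * (struve_weight b i / real (Suc
      i)))"
    by (auto simp: field_simps)
  thus "summable (\<lambda>i. struve_weight b i / real (2 * i + 2))" using summable_mult[OF s, of "1 / 2"]
      by simp
  have "decseq (struve_weight b)"
  proof (rule decseq_SucI)
    fix i
    have "b * (struve_weight b i / real (Suc i)) \<ge> 0" using nn[of i] b by simp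
    thus "struve_weight b (Suc i) \<le> struve_weight b i" using struve_weight_diff[of b i] by linarith
  qed
  then obtain L where L: "struve_weight b \<longlonglongrightarrow> L" "\<forall>i. L \<le> struve_weight b i"
    using decseq_convergent[of "struve_weight b" 0] nn by blast
  have "L \<ge> 0" using LIMSEQ_le_const[OF L(1)] nn by blast
  moreover have "\<not> L > 0"
  proof
    assume "L > 0"
    have "summable (\<lambda>i. (1 / L) * (struve_weight b i / real (Suc i)))" using s
        by (rule summable_mult)
    moreover have "norm (inverse (real (Suc i))) \<le> (1 / L) * (struve_weight b i / real (Suc i))"
        for i
    proof -
      have "(1 / L) * (L / real (Suc i)) \<le> (1 / L) * (struve_weight b i / real (Suc i))"
        using L(2) \<open>L > 0\<close> by (intro mult_left_mono divide_right_mono) auto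
      moreover have "(1 / L) * (L / real (Suc i)) = norm (inverse (real (Suc i)))"
        using \<open>L > 0\<close> by (simp add: divide_inverse)
      ultimately show ?thesis by (simp only:)
    qed
    ultimately have "summable (\<lambda>i. inverse (real (Suc i)))"
      by (rule summable_comparison_test')
    hence "summable (\<lambda>i. inverse (real i))" by (subst (asm) summable_Suc_iff)
    thus False using not_summable_harmonic[where ?'a = real] by simp
  qed
  ultimately show "struve_weight b \<longlonglongrightarrow> 0" using L(1) by force
qed

text \<open>The moments are half the Beta values B(j + 1, b), and this is the functional equation of
  the Beta function, derived by telescoping series instead of integrals.\<close>

lemma weight_moment_struve_weight_rec:
  assumes b: "0 < b" "b \<le> 1"
  shows "(real j + 1) * weight_moment (struve_weight b) j =
      (real j + 1 + b) * weight_moment (struve_weight b) (Suc j)"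
proof -
  \<comment> \<open>The telescoping certificate: e (i + 1) - e i is the i-th term of twice the
    difference of the two sides. It vanishes at i = 0 and tends to 0, since the weights do.\<close>
  define e where "e i = struve_weight b i * real i / (real i + real j + 1)" for i
  have "(\<lambda>i. real i / (real i + real j + 1)) \<longlonglongrightarrow> 1" by real_asymp
  hence "(\<lambda>i. struve_weight b i * (real i / (real i + real j + 1))) \<longlonglongrightarrow> 0 * 1"
    by (intro tendsto_mult struve_weight_tendsto_0 b)
  hence "e \<longlonglongrightarrow> 0" by (simp add: e_def[abs_def])
  hence "(\<lambda>i. e (Suc i) - e i) sums (0 - e 0)" by (rule telescope_sums)
  hence s1: "(\<lambda>i. e (Suc i) - e i) sums 0" by (simp add: e_def)
  have sm: "summable (\<lambda>i. struve_weight b i / real (2 * i + 2 * j + 2))" for j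
    by (intro summable_weight_moment struve_weight_nonneg summable_struve_weight b)
  have s2: "(\<lambda>i. 2 * (real j + 1) * (struve_weight b i / real (2 * i + 2 * j + 2)) - 2 * (real j +
      1 + b) * (struve_weight b i / real (2 * i + 2 * Suc j + 2)))
     sums (2 * (real j + 1) * weight_moment (struve_weight b) j - 2 * (real j + 1 + b) *
         weight_moment (struve_weight b) (Suc j))"
    unfolding weight_moment_def by (intro sums_diff sums_mult summable_sums sm)
  have step: "e (Suc i) - e i = 2 * (real j + 1) * (struve_weight b i / real (2 * i + 2 * j + 2)) -
      2 * (real j + 1 + b) * (struve_weight b i / real (2 * i + 2 * Suc j + 2))" for i
  proof -
    define x where "x = real j + 1"
    have x: "x > 0" by (simp add: x_def)
    have "e (Suc i) = (real (Suc i) * struve_weight b (Suc i)) / (real i + x + 1)"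
      by (simp add: e_def x_def algebra_simps)
    hence "e (Suc i) - e i = (1 - b + real i) * struve_weight b i / (real i + x + 1) -
        struve_weight b i * real i / (real i + x)"
      unfolding struve_weight_Suc by (simp add: e_def x_def algebra_simps)
    also have "\<dots> = x * (struve_weight b i / (real i + x)) - (x + b) * (struve_weight b i / (real i
        + x + 1))"
    proof -
      have "real i + x \<noteq> 0" "real i + x + 1 \<noteq> 0" using x by linarith+
      thus ?thesis by (simp add: divide_simps) (simp add: algebra_simps)
    qed
    also have "struve_weight b i / (real i + x) = 2 * (struve_weight b i / real (2 * i + 2 * j +
        2))"
      by (simp add: x_def divide_simps)
    also have "struve_weight b i / (real i + x + 1) = 2 * (struve_weight b i / real (2 * i + 2 *
        Suc j + 2))"
      by (simp add: x_def divide_simps)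
    finally show ?thesis by (simp only: x_def mult_ac)
  qed
  have "(\<lambda>i. e (Suc i) - e i) sums (2 * (real j + 1) * weight_moment (struve_weight b) j - 2 *
      (real j + 1 + b) * weight_moment (struve_weight b) (Suc j))"
    unfolding step by (rule s2)
  hence "2 * (real j + 1) * weight_moment (struve_weight b) j - 2 * (real j + 1 + b) *
      weight_moment (struve_weight b) (Suc j) = 0"
    using sums_unique2[OF s1] by metis
  thus ?thesis unfolding mult.assoc by linarith
qed

subsection \<open>The Struve function\<close>

text \<open>The coefficient of x^(2j) in the series left after x powr (\<nu> + 1) is taken out of
  \<open>struve_H\<close>; the powers of 2 and 4 collect the halves of x.\<close>

definition struve_coeff :: "real \<Rightarrow> nat \<Rightarrow> real" where
  "struve_coeff \<nu> j = 2 powr (- \<nu> - 1) * ((-1) ^ j / (Gamma (real j + 3/2) * Gamma (real j + \<nu> +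
      3/2)) / 4 ^ j)"

definition struve_seq :: "real \<Rightarrow> nat \<Rightarrow> complex" where
  "struve_seq \<nu> j = of_real (struve_coeff \<nu> j)"

lemma struve_weight_0_pos: "struve_weight b 0 > 0"
  by (simp add: struve_weight_0)

lemma struve_coeff_rec:
  assumes "\<nu> > -3/2"
  shows "struve_coeff \<nu> (Suc j) * ((2 * real j + 3) * (2 * real j + 2 * \<nu> + 3)) =
      - struve_coeff \<nu> j"
proof -
  have 1: "Gamma (real j + 3/2 + 1) = (real j + 3/2) * Gamma (real j + 3/2)"
    by (rule Gamma_plus1) (auto dest: nonpos_Ints_nonpos)
  have 2: "Gamma (real j + \<nu> + 3/2 + 1) = (real j + \<nu> + 3/2) * Gamma (real j + \<nu> + 3/2)"
    using assms by (intro Gamma_plus1) (auto dest: nonpos_Ints_nonpos)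
  have p: "Gamma (real j + 3/2) > 0" "Gamma (real j + \<nu> + 3/2) > 0"
    using assms by (intro Gamma_real_pos; simp)+
  have e: "real (Suc j) + 3/2 = real j + 3/2 + 1" "real (Suc j) + \<nu> + 3/2 = real j + \<nu> + 3/2 + 1"
    by simp_all
  define A where "A = Gamma (real j + 3/2)"
  define B where "B = Gamma (real j + \<nu> + 3/2)"
  define P where "P = real j + 3/2"
  define Q where "Q = real j + \<nu> + 3/2"
  have nz: "A \<noteq> 0" "B \<noteq> 0" "P \<noteq> 0" "Q \<noteq> 0" using p assms unfolding A_def B_def P_def Q_def
      by linarith+
  have "struve_coeff \<nu> (Suc j) * ((2 * real j + 3) * (2 * real j + 2 * \<nu> + 3)) =
      2 powr (- \<nu> - 1) * ((-1) ^ Suc j / ((P * A) * (Q * B)) / 4 ^ Suc j) * ((2 * P) * (2 * Q))"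
    unfolding struve_coeff_def e 1 2 A_def[symmetric] B_def[symmetric]
        by (simp add: P_def Q_def algebra_simps)
  also have "\<dots> = - (2 powr (- \<nu> - 1) * ((-1) ^ j / (A * B) / 4 ^ j))"
    using nz by (simp add: field_simps)
  finally show ?thesis by (simp add: struve_coeff_def A_def B_def)
qed

lemma struve_coeff_0_pos: "\<nu> > -3/2 \<Longrightarrow> struve_coeff \<nu> 0 > 0"
  unfolding struve_coeff_def by (auto intro!: mult_pos_pos divide_pos_pos Gamma_real_pos)

lemma struve_coeff_nonzero: "\<nu> > -3/2 \<Longrightarrow> struve_coeff \<nu> j \<noteq> 0"
proof (induction j)
  case 0 thus ?case using struve_coeff_0_pos[of \<nu>] by simp
next
  case (Suc j)
  show ?case
  proof
    assume "struve_coeff \<nu> (Suc j) = 0"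
    hence "struve_coeff \<nu> j = 0" using struve_coeff_rec[OF Suc.prems, of j] by simp
    thus False using Suc by simp
  qed
qed

text \<open>Both sides satisfy the same first-order recurrence: the ratio of factorials supplies (2j
  + 3)(2j + 2) and the hypothesis on m trades 2j + 2 for 2j + 2\<nu> + 3. This yields the
  sine-transform representation without any integral.\<close>

lemma struve_coeff_eq_sine_coeff:
  assumes \<nu>: "\<nu> > -3/2" and m0: "m 0 \<noteq> 0"
    and m: "\<And>j. (2 * real j + 2) * m j = (2 * real j + 2 * \<nu> + 3) * m (Suc j)"
  shows "struve_seq \<nu> j = of_real (struve_coeff \<nu> 0 / m 0) * sine_coeff m j"
proof -
  have "struve_coeff \<nu> j = struve_coeff \<nu> 0 / m 0 * ((-1) ^ j * m j / fact (2 * j + 1))"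
  proof (induction j)
    case 0 thus ?case using m0 by simp
  next
    case (Suc j)
    define P where "P = 2 * real j + 3"
    define Q where "Q = 2 * real j + 2 * \<nu> + 3"
    define R where "R = 2 * real j + 2"
    have nz: "P \<noteq> 0" "Q \<noteq> 0" "R \<noteq> 0" using \<nu> by (auto simp: P_def Q_def R_def)
    have f: "fact (2 * Suc j + 1) = P * (R * fact (2 * j + 1) :: real)"
      by (simp add: P_def R_def algebra_simps)
    have "struve_coeff \<nu> (Suc j) = - struve_coeff \<nu> j / (P * Q)"
    proof -
      have "struve_coeff \<nu> (Suc j) * (P * Q) = - struve_coeff \<nu> j" using struve_coeff_rec[OF \<nu>, of
          j] by (simp only: P_def Q_def)
      thus ?thesis using nz by (simp only: eq_divide_eq mult_eq_0_iff if_False if_True simp_thms)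
    qed
    also have "\<dots> = - (struve_coeff \<nu> 0 / m 0 * ((-1) ^ j * m j / fact (2 * j + 1))) / (P * Q)"
      unfolding Suc.IH ..
    also have "m j = Q * m (Suc j) / R"
    proof -
      have "m j * R = Q * m (Suc j)" using m[of j] by (simp only: Q_def R_def mult.commute)
      thus ?thesis using nz by (simp only: eq_divide_eq if_True if_False simp_thms)
    qed
    also have "- (struve_coeff \<nu> 0 / m 0 * ((-1) ^ j * (Q * m (Suc j) / R) / fact (2 * j + 1))) /
        (P * Q)
        = struve_coeff \<nu> 0 / m 0 * ((-1) ^ Suc j * m (Suc j) / (P * (R * fact (2 * j + 1))))"
      using nz by (simp del: fact_Suc add: field_simps)
    finally show ?case unfolding f .
  qed
  thus ?thesis by (simp add: struve_seq_def sine_coeff_def)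
qed

lemma struve_seq_moment:
  assumes \<nu>: "-1/2 < \<nu>" "\<nu> \<le> 1/2"
  obtains \<kappa> where "\<kappa> > 0" "struve_seq \<nu> = (\<lambda>j. of_real \<kappa> * sine_coeff (weight_moment (struve_weight
      (\<nu> + 1/2))) j)"
proof -
  define m where "m = weight_moment (struve_weight (\<nu> + 1/2))"
  have b: "0 < \<nu> + 1/2" "\<nu> + 1/2 \<le> 1" using \<nu> by auto
  have m0: "m 0 > 0" unfolding m_def
    by (rule weight_moment_pos[OF struve_weight_nonneg[OF b(2)] summable_struve_weight[OF b]
        struve_weight_0_pos])
  have "(2 * real j + 2) * m j = (2 * real j + 2 * \<nu> + 3) * m (Suc j)" for j
    using weight_moment_struve_weight_rec[OF b, of j] by (simp add: m_def algebra_simps)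
  hence "struve_seq \<nu> j = of_real (struve_coeff \<nu> 0 / m 0) * sine_coeff m j" for j
    using \<nu> m0 by (intro struve_coeff_eq_sine_coeff) auto
  hence "struve_seq \<nu> = (\<lambda>j. of_real (struve_coeff \<nu> 0 / m 0) * sine_coeff m j)" by blast
  moreover have "struve_coeff \<nu> 0 / m 0 > 0" using struve_coeff_0_pos[of \<nu>] \<nu> m0 by simp
  ultimately show ?thesis using that unfolding m_def by blast
qed

text \<open>For \<nu> = -1/2 both factors of the moment recurrence are 2j + 2, so the constant
  sequence 1 solves it.\<close>

lemma struve_seq_sin:
  obtains \<kappa> where "\<kappa> > 0" "struve_seq (-1/2) = (\<lambda>j. of_real \<kappa> * sine_coeff (\<lambda>_. 1) j)"
proof -
  have "struve_seq (-1/2) j = of_real (struve_coeff (-1/2) 0 / 1) * sine_coeff (\<lambda>_. 1) j" for j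
    by (intro struve_coeff_eq_sine_coeff) auto
  hence "struve_seq (-1/2) = (\<lambda>j. of_real (struve_coeff (-1/2) 0) * sine_coeff (\<lambda>_. 1) j)" by auto
  thus ?thesis using that struve_coeff_0_pos[of "-1/2"] by simp
qed

lemma conv_radius_cmult: "conv_radius a = \<infinity> \<Longrightarrow> conv_radius (\<lambda>j. c * a j) = \<infinity>"
    for a :: "nat \<Rightarrow> complex"
  using conv_radius_lincomb[of a a c 0] by simp

lemma conv_radius_weight_moment_struve_weight:
  assumes "0 < b" "b \<le> 1"
  shows "conv_radius (sine_coeff (weight_moment (struve_weight b))) = \<infinity>"
  by (rule conv_radius_sine_coeff[of _ "weight_moment (struve_weight b) 0"]) (intro
      weight_moment_bound struve_weight_nonneg summable_struve_weight assms)

lemma struve_seq_euler_vmono: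
  assumes \<nu>: "\<nu> \<in> {-1/2..1/2}"
  shows "conv_radius (struve_seq \<nu>) = \<infinity>" "euler_vmono (struve_seq \<nu>)"
proof -
  have "conv_radius (struve_seq \<nu>) = \<infinity> \<and> euler_vmono (struve_seq \<nu>)"
  proof (cases "\<nu> = -1/2")
    case True
    obtain \<kappa> where k: "\<kappa> > 0" "struve_seq (-1/2) = (\<lambda>j. of_real \<kappa> * sine_coeff (\<lambda>_. 1) j)"
        by (rule struve_seq_sin)
    have "conv_radius (sine_coeff (\<lambda>_. 1)) = \<infinity>" by (rule conv_radius_sine_coeff[of _ 1]) simp
    thus ?thesis unfolding True k using euler_vmono_sin by (auto intro: euler_vmono_cmult
        conv_radius_cmult)
  next
    case False
    hence n: "-1/2 < \<nu>" "\<nu> \<le> 1/2" using \<nu> by auto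
    hence b: "0 < \<nu> + 1/2" "\<nu> + 1/2 \<le> 1" by auto
    obtain \<kappa> where k: "\<kappa> > 0" "struve_seq \<nu> = (\<lambda>j. of_real \<kappa> * sine_coeff (weight_moment
        (struve_weight (\<nu> + 1/2))) j)" using n by (rule struve_seq_moment)
    have "euler_vmono (sine_coeff (weight_moment (struve_weight (\<nu> + 1/2))))"
      by (rule euler_vmono_weight_moment[OF struve_weight_nonneg[OF b(2)] summable_struve_weight[OF
          b] struve_weight_0_pos])
    thus ?thesis unfolding k using conv_radius_weight_moment_struve_weight[OF b]
        by (auto intro: euler_vmono_cmult conv_radius_cmult)
  qed
  thus "conv_radius (struve_seq \<nu>) = \<infinity>" "euler_vmono (struve_seq \<nu>)" by auto
qed

lemma even_vmono_struve_seq: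
  assumes \<nu>: "\<nu> \<in> {-1/2..1/2}"
  shows "even_vmono (even_series (struve_seq \<nu>))" "even_vmono (even_series (euler_seq (\<nu> + 1)
      (struve_seq \<nu>)))"
  using even_vmono_euler_vmono[OF struve_seq_euler_vmono(1)[OF \<nu>] _ struve_seq_euler_vmono(2)[OF
      \<nu>], of "struve_coeff \<nu>"] struve_coeff_nonzero[of \<nu>] \<nu>
  by (auto simp: struve_seq_def)

lemma struve_entire_0:
  assumes \<nu>: "\<nu> \<in> {-1/2..1/2}"
  shows "struve_entire 0 \<nu> = even_series (struve_seq \<nu>)"
  unfolding struve_entire_def
proof (rule entire_extension_eqI)
  show "even_series (struve_seq \<nu>) holomorphic_on UNIV" by (intro holomorphic_even_series
      struve_seq_euler_vmono \<nu>)
  fix x :: real assume x: "x > 0"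
  define s where "s m = (-1) ^ m / (Gamma (real m + 3/2) * Gamma (real m + \<nu> + 3/2)) * (x / 2) ^ (2
      * m)" for m
  have c: "struve_coeff \<nu> m * (x\<^sup>2) ^ m = 2 powr (- \<nu> - 1) * s m" for m
    by (simp add: struve_coeff_def s_def power_divide power_mult)
  have sm: "summable (\<lambda>m. struve_coeff \<nu> m * (x\<^sup>2) ^ m)"
    using even_series_of_real(2)[OF struve_seq_euler_vmono(1)[OF \<nu>], of "struve_coeff \<nu>"]
        by (simp add: struve_seq_def)
  hence "summable (\<lambda>m. 2 powr (\<nu> + 1) * (2 powr (- \<nu> - 1) * s m))" unfolding c
      by (rule summable_mult)
  moreover have p: "2 powr (\<nu> + 1) * (2 powr (- \<nu> - 1) * t) = t" for t :: real
    by (simp flip: powr_add mult.assoc)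
  ultimately have s: "summable s" by simp
  have "even_series (struve_seq \<nu>) (of_real x) = of_real (\<Sum>m. struve_coeff \<nu> m * (x\<^sup>2) ^ m)"
    using even_series_of_real(1)[OF struve_seq_euler_vmono(1)[OF \<nu>], of "struve_coeff \<nu>"]
        by (simp add: struve_seq_def)
  also have "(\<Sum>m. struve_coeff \<nu> m * (x\<^sup>2) ^ m) = 2 powr (- \<nu> - 1) * suminf s"
    unfolding c using s by (rule suminf_mult)
  also have "\<dots> = x powr (real 0 - \<nu> - 1) * struve_H_deriv 0 \<nu> x"
  proof -
    have "x powr (- \<nu> - 1) * (x / 2) powr (\<nu> + 1) = x powr (- \<nu> - 1) * (x powr (\<nu> + 1) * 2 powr (-
        \<nu> - 1))"
      using x by (simp add: powr_divide powr_minus_divide[of 2 "\<nu> + 1", simplified])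
    also have "\<dots> = 2 powr (- \<nu> - 1)" using x by (simp flip: powr_add mult.assoc)
    finally have "x powr (- \<nu> - 1) * (x / 2) powr (\<nu> + 1) = 2 powr (- \<nu> - 1)" .
    thus ?thesis by (simp add: struve_H_def s_def[abs_def] flip: mult.assoc)
  qed
  finally show "even_series (struve_seq \<nu>) (of_real x) =
      of_real (x powr (real 0 - \<nu> - 1) * struve_H_deriv 0 \<nu> x)" .
qed

text \<open>Differentiating x^(\<nu>+1-n) g gives x^(\<nu>-n) ((\<nu> + 1 - n) g + x g'): the
  exponent of the removed power becomes the constant of the Euler transform.\<close>

lemma struve_entire_Suc:
  assumes \<nu>: "\<nu> > -3/2"
  shows "struve_entire (Suc n) \<nu> = (\<lambda>z. of_real (\<nu> + 1 - real n) * struve_entire n \<nu> z + z * deriv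
      (struve_entire n \<nu>) z)"
  unfolding struve_entire_def[of "Suc n"]
proof (rule entire_extension_eqI)
  have h: "struve_entire n \<nu> holomorphic_on UNIV" using \<nu> by (rule holomorphic_struve_entire)
  thus "(\<lambda>z. of_real (\<nu> + 1 - real n) * struve_entire n \<nu> z + z * deriv (struve_entire n \<nu>) z)
      holomorphic_on UNIV"
    by (intro holomorphic_intros holomorphic_deriv) auto
  fix x :: real assume x: "x > 0"
  have d: "deriv (struve_entire n \<nu>) (of_real x) = of_real (x powr (real n - \<nu> - 2) *
        ((real n - \<nu> - 1) * struve_H_deriv n \<nu> x + x * struve_H_deriv (Suc n) \<nu> x))"
    using struve_comb_entire_of_real[OF \<nu> x] struve_comb_entire_eq_deriv[OF \<nu>] by simp
  have "x powr (real n - \<nu> - 1) = x * x powr (real n - \<nu> - 2)"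
    using x powr_add[of x 1 "real n - \<nu> - 2"] by (simp add: algebra_simps)
  moreover have "x powr (real (Suc n) - \<nu> - 1) = x * (x * x powr (real n - \<nu> - 2))"
    using x powr_add[of x 2 "real n - \<nu> - 2"] by (simp add: algebra_simps power2_eq_square)
  ultimately have "(\<nu> + 1 - real n) * (x powr (real n - \<nu> - 1) * struve_H_deriv n \<nu> x) + x * (x
      powr (real n - \<nu> - 2) *
        ((real n - \<nu> - 1) * struve_H_deriv n \<nu> x + x * struve_H_deriv (Suc n) \<nu> x)) =
      x powr (real (Suc n) - \<nu> - 1) * struve_H_deriv (Suc n) \<nu> x"
    by (simp add: algebra_simps)
  thus "of_real (\<nu> + 1 - real n) * struve_entire n \<nu> (of_real x) + of_real x * deriv (struve_entire
      n \<nu>) (of_real x) =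
      of_real (x powr (real (Suc n) - \<nu> - 1) * struve_H_deriv (Suc n) \<nu> x)"
    unfolding d struve_entire_of_real[OF \<nu> x] by (simp only: flip: of_real_mult of_real_add)
qed

lemma struve_entire_1:
  assumes \<nu>: "\<nu> \<in> {-1/2..1/2}"
  shows "struve_entire 1 \<nu> = even_series (euler_seq (\<nu> + 1) (struve_seq \<nu>))"
  using struve_entire_Suc[of \<nu> 0] \<nu> even_series_euler[OF struve_seq_euler_vmono(1)[OF \<nu>], of "\<nu> +
      1"]
  by (auto simp: struve_entire_0)

text \<open>With T = z d/dz, the coefficient recurrence says (T + 1)(T + 2\<nu> + 1) f = (2\<nu> +
  1) c_0 - z^2 f, which is Struve's equation for the entire factor. Where f and f' vanish, only z^2
  f'' remains on the left.\<close>

lemma struve_ode: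
  assumes \<nu>: "\<nu> \<in> {-1/2..1/2}" and z: "even_series (struve_seq \<nu>) z =
      0" "deriv (even_series (struve_seq \<nu>)) z = 0"
  shows "z\<^sup>2 * deriv (deriv (even_series (struve_seq \<nu>))) z =
      of_real ((2 * \<nu> + 1) * struve_coeff \<nu> 0)"
proof -
  note r = struve_seq_euler_vmono(1)[OF \<nu>]
  define f where "f = even_series (struve_seq \<nu>)"
  define b where "b = euler_seq (2 * \<nu> + 1) (struve_seq \<nu>)"
  have rb: "conv_radius b = \<infinity>" unfolding b_def by (rule conv_radius_euler[OF r])
  have fd: "(f has_field_derivative deriv f w) (at w)" "(deriv f has_field_derivative deriv (deriv
      f) w) (at w)" for w
    using holomorphic_even_series[OF r, of UNIV] holomorphic_deriv[OF holomorphic_even_series[OF r,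
        of UNIV]]
    by (auto simp: holomorphic_derivI f_def)
  have Eb: "even_series b = (\<lambda>z. of_real (2 * \<nu> + 1) * f z + z * deriv f z)"
    unfolding b_def f_def using even_series_euler[OF r] by blast
  have db: "deriv (even_series b) z = of_real (2 * \<nu> + 1) * deriv f z + (1 * deriv f z + deriv
      (deriv f) z * z)"
    unfolding Eb by (rule DERIV_imp_deriv) (intro DERIV_add DERIV_cmult DERIV_mult DERIV_ident fd)
  have "even_series (euler_seq 1 b) z = z\<^sup>2 * deriv (deriv f) z"
    unfolding even_series_euler[OF rb] db using z by (simp add: Eb f_def[symmetric]
        power2_eq_square)
  moreover have "even_series (euler_seq 1 b) z = of_real ((2 * \<nu> + 1) * struve_coeff \<nu> 0) - z\<^sup>2 * f
      z"
  proof -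
    have s: "summable (\<lambda>j. euler_seq 1 b j * (z\<^sup>2) ^ j)"
        by (intro summable_even_series conv_radius_euler rb)
    have step: "euler_seq 1 b (Suc j) * (z\<^sup>2) ^ Suc j = - z\<^sup>2 * (struve_seq \<nu> j * (z\<^sup>2) ^ j)" for j
    proof -
      have "euler_seq 1 b (Suc j) = of_real (struve_coeff \<nu> (Suc j) * ((2 * real j + 3) * (2 * real
          j + 2 * \<nu> + 3)))"
        by (simp add: euler_seq_def b_def struve_seq_def algebra_simps)
      also have "\<dots> = - struve_seq \<nu> j" using struve_coeff_rec[of \<nu> j] \<nu>
          by (simp add: struve_seq_def)
      finally show ?thesis by simp
    qed
    have "even_series (euler_seq 1 b) z = (\<Sum>j. euler_seq 1 b (Suc j) * (z\<^sup>2) ^ Suc j) + euler_seq 1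
        b 0"
      unfolding even_series_def using suminf_split_head[OF s] by simp
    also have "\<dots> = - z\<^sup>2 * even_series (struve_seq \<nu>) z + euler_seq 1 b 0"
      unfolding step even_series_def by (subst suminf_mult[OF summable_even_series[OF r]]) simp
    also have "euler_seq 1 b 0 = of_real ((2 * \<nu> + 1) * struve_coeff \<nu> 0)"
        by (simp add: euler_seq_def b_def struve_seq_def)
    finally show ?thesis by (simp add: f_def)
  qed
  ultimately show ?thesis using z(1) by (simp add: f_def)
qed

section \<open>Adding a constant to the weight\<close>

lemma sums_power_moment_0: "(\<lambda>i. (if i = 0 then t else 0) / real (2 * i + 2 * j + 2)) sums (t *
    power_moment 0 j)"
  using sums_single[of 0 "\<lambda>i. t / real (2 * i + 2 * j + 2)"]
  by (simp add: power_moment_def if_distrib[of "\<lambda>x. x / _"] cong: if_cong)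

lemma weight_moment_power_moment_0: "weight_moment (\<lambda>i. if i = 0 then t else 0) j =
    t * power_moment 0 j"
  unfolding weight_moment_def using sums_unique[OF sums_power_moment_0] by simp

lemma weight_moment_add_power_moment_0:
  assumes d: "\<And>i. d i \<ge> 0" and s: "summable (\<lambda>i. d i / real (2 * i + 2))"
  shows "weight_moment (\<lambda>i. d i + (if i = 0 then t else 0)) j =
      weight_moment d j + t * power_moment 0 j"
    and "summable (\<lambda>i. (d i + (if i = 0 then t else 0)) / real (2 * i + 2))"
proof -
  have "(\<lambda>i. d i / real (2 * i + 2 * j + 2) + (if i = 0 then t else 0) / real (2 * i + 2 * j + 2))
      sums (weight_moment d j + t * power_moment 0 j)" for j
    unfolding weight_moment_def by (intro sums_add summable_sums summable_weight_moment[OF d s]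
        sums_power_moment_0)
  hence *: "(\<lambda>i. (d i + (if i = 0 then t else 0)) / real (2 * i + 2 * j + 2)) sums (weight_moment d
      j + t * power_moment 0 j)" for j
    by (simp only: add_divide_distrib)
  show "weight_moment (\<lambda>i. d i + (if i = 0 then t else 0)) j =
      weight_moment d j + t * power_moment 0 j"
    unfolding weight_moment_def[of "\<lambda>i. d i + (if i = 0 then t else 0)"] using sums_unique[OF *[of
        j]] by simp
  show "summable (\<lambda>i. (d i + (if i = 0 then t else 0)) / real (2 * i + 2))"
    using sums_summable[OF *[of 0]] by simp
qed

lemma even_vmono_weight_moment:
  assumes d: "\<And>i. d i \<ge> 0" and s: "summable (\<lambda>i. d i / real (2 * i + 2))" and d0: "d 0 > 0"
      and k: "\<kappa> > 0"
  shows "even_vmono (even_series (\<lambda>j. of_real \<kappa> * sine_coeff (weight_moment d) j))"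
proof (rule even_vmono_euler_vmono(1))
  have c: "conv_radius (sine_coeff (weight_moment d)) = \<infinity>"
    by (rule conv_radius_sine_coeff[of _ "weight_moment d 0"]) (rule weight_moment_bound[OF d s])
  thus "conv_radius (\<lambda>j. of_real \<kappa> * sine_coeff (weight_moment d) j) = \<infinity>"
      by (rule conv_radius_cmult)
  show "euler_vmono (\<lambda>j. of_real \<kappa> * sine_coeff (weight_moment d) j)"
      by (intro euler_vmono_cmult euler_vmono_weight_moment[OF d s d0] c)
  show "of_real \<kappa> * sine_coeff (weight_moment d) j = of_real (\<kappa> * ((-1) ^ j * weight_moment d j /
      fact (2 * j + 1)))" for j
    unfolding sine_coeff_def by (simp only: of_real_mult)
  have "weight_moment d j > 0" for j by (rule weight_moment_pos[OF d s d0])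
  hence "weight_moment d j \<noteq> 0" for j by (metis less_irrefl)
  thus "\<kappa> * ((-1) ^ 0 * weight_moment d 0 / fact (2 * 0 + 1)) \<noteq> 0" "\<kappa> * ((-1) ^ 1 * weight_moment d
      1 / fact (2 * 1 + 1)) \<noteq> 0"
    using k by auto
qed

section \<open>Orders and unboundedness of the zeros of the Struve function\<close>

text \<open>The inhomogeneity (2\<nu> + 1) c_0 of the differential equation is positive for \<nu> >
  -1/2.\<close>

lemma struve_seq_double_zero:
  assumes \<nu>: "-1/2 < \<nu>" "\<nu> \<le> 1/2" and x: "even_vmono.u (even_series (struve_seq \<nu>)) x =
      0" "even_vmono.u' (even_series (struve_seq \<nu>)) x = 0"
  shows "even_vmono.u'' (even_series (struve_seq \<nu>)) x > 0"
proof -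
  have n: "\<nu> \<in> {-1/2..1/2}" using \<nu> by auto
  interpret F: even_vmono "even_series (struve_seq \<nu>)" by (rule even_vmono_struve_seq(1)[OF n])
  have "(of_real x)\<^sup>2 * deriv (deriv (even_series (struve_seq \<nu>))) (of_real x) =
      complex_of_real ((2 * \<nu> + 1) * struve_coeff \<nu> 0)"
    by (rule struve_ode[OF n]) (simp_all add: F.of_u x)
  hence "complex_of_real (x\<^sup>2 * F.u'' x) = complex_of_real ((2 * \<nu> + 1) * struve_coeff \<nu> 0)"
    by (simp add: F.of_u)
  hence "x\<^sup>2 * F.u'' x = (2 * \<nu> + 1) * struve_coeff \<nu> 0" by (simp only: of_real_eq_iff)
  also have "\<dots> > 0" using \<nu> struve_coeff_0_pos[of \<nu>] by simp
  finally show ?thesis by (simp add: zero_less_mult_iff)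
qed

lemma Re_even_series_cmult: "conv_radius a = \<infinity> \<Longrightarrow> Re (even_series (\<lambda>j. of_real \<kappa> * a j) z) =
    \<kappa> * Re (even_series a z)"
  by (simp only: even_series_cmult Re_of_real_mult)

text \<open>Here y u(y) is a positive multiple of sin y, and sine and cosine have no common
  zero.\<close>

lemma struve_seq_sin_simple:
  assumes x: "even_vmono.u (even_series (struve_seq (-1/2))) x = 0"
  shows "even_vmono.u' (even_series (struve_seq (-1/2))) x \<noteq> 0"
proof
  assume x': "even_vmono.u' (even_series (struve_seq (-1/2))) x = 0"
  interpret F: even_vmono "even_series (struve_seq (-1/2))" by (rule even_vmono_struve_seq(1)) auto
  obtain \<kappa> where k: "\<kappa> > 0" "struve_seq (-1/2) = (\<lambda>j. of_real \<kappa> * sine_coeff (\<lambda>_. 1) j)"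
      by (rule struve_seq_sin)
  have c: "conv_radius (sine_coeff (\<lambda>_. 1)) = \<infinity>" by (rule conv_radius_sine_coeff[of _ 1]) simp
  have "F.u y = \<kappa> * Re (even_series (sine_coeff (\<lambda>_. 1)) (of_real y))" for y
    unfolding F.u_def unfolding k(2) by (rule Re_even_series_cmult[OF c])
  hence us: "y * F.u y = \<kappa> * sin y" for y using sin_even_series[of y]
      by (simp add: mult.left_commute)
  have "((\<lambda>y. y * F.u y) has_real_derivative 1 * F.u x + F.u' x * x) (at x)"
    by (intro DERIV_mult DERIV_ident F.u_deriv)
  moreover have "((\<lambda>y. y * F.u y) has_real_derivative \<kappa> * cos x) (at x)"
    unfolding us by (intro DERIV_cmult DERIV_sin)
  ultimately have "\<kappa> * cos x = 1 * F.u x + F.u' x * x" using DERIV_unique by blast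
  hence "cos x = 0" using x x' k by simp
  moreover have "sin x = 0" using us[of x] x k by simp
  ultimately show False using sin_cos_squared_add[of x] by simp
qed

text \<open>The transform of a constant weight is (1 - cos x)/x^2, hence nonnegative, while
  \<open>laguerre_perturb\<close> makes it nonpositive at a double zero. So cos x = 1 there; but at
  such a point the function itself is negative, because the coefficient 1 - b of t^2 in the weight
  is positive for \<nu> < 1/2.\<close>

lemma struve_seq_simple:
  assumes \<nu>: "\<nu> \<in> {-1/2..<1/2}" and u0: "even_vmono.u (even_series (struve_seq \<nu>)) x = 0"
  shows "even_vmono.u' (even_series (struve_seq \<nu>)) x \<noteq> 0"
proof (cases "\<nu> = -1/2")
  case True
  thus ?thesis using struve_seq_sin_simple[of x] u0 by simp
next
  case False
  hence n: "-1/2 < \<nu>" "\<nu> < 1/2" "\<nu> \<le> 1/2" "\<nu> \<in> {-1/2..1/2}" using \<nu> by auto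
  define b where "b = \<nu> + 1/2"
  have b: "0 < b" "b \<le> 1" "b < 1" using n by (auto simp: b_def)
  note d = struve_weight_nonneg[OF b(2)] and s = summable_struve_weight[OF b(1,2)]
  interpret F: even_vmono "even_series (struve_seq \<nu>)" by (rule even_vmono_struve_seq(1)[OF n(4)])
  obtain \<kappa> where k: "\<kappa> > 0" "struve_seq \<nu> = (\<lambda>j. of_real \<kappa> * sine_coeff (weight_moment
      (struve_weight b)) j)"
    unfolding b_def using n(1,3) by (rule struve_seq_moment)
  have c: "conv_radius (sine_coeff (weight_moment (struve_weight b))) = \<infinity>"
      by (intro conv_radius_weight_moment_struve_weight b)
  have pos: False if x: "x > 0" "F.u x = 0" "F.u' x = 0" for x
  proof -
    have "Re (even_series (sine_coeff (power_moment 0)) (of_real x)) \<le> 0"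
    proof (rule laguerre_perturb[OF F.even_vmono_axioms _ _ _ x(2,3) struve_seq_double_zero[OF
        n(1,3) x(2,3)]])
      show "even_series (sine_coeff (power_moment 0)) holomorphic_on UNIV"
          by (intro holomorphic_even_series conv_radius_power_moment)
      show "even_series (sine_coeff (power_moment 0)) (of_real y) \<in> \<real>" for y
          by (intro even_series_sine_coeff_real conv_radius_power_moment)
      fix \<epsilon> :: real assume e: "\<epsilon> > 0"
      \<comment> \<open>The transform is scaled by \<kappa>, so the constant \<epsilon>/\<kappa> in
        the weight produces the perturbation \<epsilon>.\<close>
      define d' where "d' = (\<lambda>i. struve_weight b i + (if i = 0 then \<epsilon> / \<kappa> else 0))"
      have "even_vmono (even_series (\<lambda>j. of_real \<kappa> * sine_coeff (weight_moment d') j))"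
      proof (rule even_vmono_weight_moment[OF _ _ _ k(1)])
        show "d' i \<ge> 0" for i using d[of i] e k by (simp add: d'_def)
        show "d' 0 > 0" using e k by (simp add: d'_def struve_weight_0 add_pos_pos)
        show "summable (\<lambda>i. d' i / real (2 * i + 2))" unfolding d'_def
            by (rule weight_moment_add_power_moment_0(2)[OF d s])
      qed
      also have "even_series (\<lambda>j. of_real \<kappa> * sine_coeff (weight_moment d') j) =
          (\<lambda>z. even_series (struve_seq \<nu>) z + of_real \<epsilon> * even_series (sine_coeff (power_moment 0))
          z)"
      proof
        fix z
        have "of_real \<kappa> * sine_coeff (weight_moment d') j =
            1 * struve_seq \<nu> j + of_real \<epsilon> * sine_coeff (power_moment 0) j" for j
        proof -
          have "weight_moment d' j = weight_moment (struve_weight b) j + \<epsilon> / \<kappa> * power_moment 0 j"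
              unfolding d'_def by (rule weight_moment_add_power_moment_0(1)[OF d s])
          hence "\<kappa> * weight_moment d' j = \<kappa> * weight_moment (struve_weight b) j + \<epsilon> * power_moment
              0 j" using k(1) by (simp add: algebra_simps)
          hence "\<kappa> * ((-1) ^ j * weight_moment d' j / fact (2 * j + 1)) =
              \<kappa> * ((-1) ^ j * weight_moment (struve_weight b) j / fact (2 * j + 1)) + \<epsilon> * ((-1) ^ j
              * power_moment 0 j / fact (2 * j + 1))"
            by (metis (no_types, opaque_lifting) distrib_left mult.left_commute
                times_divide_eq_right add_divide_distrib)
          thus ?thesis unfolding k(2) sine_coeff_def by (simp only: mult_1 flip: of_real_mult
              of_real_add)
        qed
        hence "even_series (\<lambda>j. of_real \<kappa> * sine_coeff (weight_moment d') j) z =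
            even_series (\<lambda>j. 1 * struve_seq \<nu> j + of_real \<epsilon> * sine_coeff (power_moment 0) j) z"
          by (simp only:)
        also have "\<dots> = 1 * even_series (struve_seq \<nu>) z + of_real \<epsilon> * even_series (sine_coeff
            (power_moment 0)) z"
          by (rule even_series_lincomb[OF struve_seq_euler_vmono(1)[OF n(4)]
              conv_radius_power_moment])
        finally show "even_series (\<lambda>j. of_real \<kappa> * sine_coeff (weight_moment d') j) z =
            even_series (struve_seq \<nu>) z + of_real \<epsilon> * even_series (sine_coeff (power_moment 0)) z"
            by simp
      qed
      finally show "even_vmono (\<lambda>z. even_series (struve_seq \<nu>) z + of_real \<epsilon> * even_series
          (sine_coeff (power_moment 0)) z)" .
    qed
    hence "x\<^sup>2 * power_sine 0 x \<le> 0" unfolding power_sine_def by (intro mult_nonneg_nonpos) auto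
    hence "cos x = 1" using power_sine_0[of x] cos_le_one[of x] by linarith
    hence "Re (even_series (sine_coeff (weight_moment (struve_weight b))) (of_real x)) < 0"
      using even_series_weight_moment_cos_1(2)[OF d s x(1)] b(3)
          by (simp add: struve_weight_1[simplified])
    moreover have "F.u x = \<kappa> * Re (even_series (sine_coeff (weight_moment (struve_weight b)))
        (of_real x))"
      unfolding F.u_def unfolding k(2) by (rule Re_even_series_cmult[OF c])
    ultimately show False using x(2) k(1) by simp
  qed
  show ?thesis
  proof
    assume u': "F.u' x = 0"
    have "x \<noteq> 0" using F.u_0 u0 by auto
    then consider "x > 0" | "- x > 0" by linarith
    thus False
    proof cases
      case 1 thus ?thesis using pos[of x] u0 u' by blast
    next
      case 2 thus ?thesis using pos[of "- x"] u0 u' by (simp add: F.u_minus)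
    qed
  qed
qed

text \<open>Zeros of order at most two are what \<open>euler_simple\<close> asks for, and this
  covers \<nu> = 1/2 as well, where simplicity fails.\<close>

lemma struve_seq_nondegenerate:
  assumes \<nu>: "\<nu> \<in> {-1/2..1/2}" and u: "even_vmono.u (even_series (struve_seq \<nu>)) x =
      0" "even_vmono.u' (even_series (struve_seq \<nu>)) x = 0"
  shows "even_vmono.u'' (even_series (struve_seq \<nu>)) x \<noteq> 0"
proof (cases "\<nu> = -1/2")
  case True thus ?thesis using struve_seq_simple[OF _ u(1)] u(2) by auto
next
  case False
  thus ?thesis using struve_seq_double_zero[OF _ _ u] \<nu> by auto
qed

text \<open>The weight is the constant 1, so y^2 u(y) is a multiple of 1 - cos y, whose derivative
  vanishes wherever it does.\<close>

lemma struve_seq_half_double: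
  assumes u: "even_vmono.u (even_series (struve_seq (1/2))) x = 0"
  shows "even_vmono.u' (even_series (struve_seq (1/2))) x = 0"
proof -
  interpret F: even_vmono "even_series (struve_seq (1/2))" by (rule even_vmono_struve_seq(1)) auto
  obtain \<kappa> where k: "\<kappa> > 0" "struve_seq (1/2) = (\<lambda>j. of_real \<kappa> * sine_coeff (weight_moment
      (struve_weight (1/2 + 1/2))) j)"
    by (rule struve_seq_moment[of "1/2"]) auto
  have "struve_weight (1/2 + 1/2) i = (if i = 0 then 1 else 0)" for i
    by (cases i) (simp_all add: struve_weight_def pochhammer_0_left)
  hence "weight_moment (struve_weight (1/2 + 1/2)) = weight_moment (\<lambda>i. if i = 0 then 1 else 0)"
      by presburger
  also have "\<dots> = power_moment 0" using weight_moment_power_moment_0[of 1] by auto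
  finally have k': "struve_seq (1/2) = (\<lambda>j. of_real \<kappa> * sine_coeff (power_moment 0) j)" using k(2)
      by simp
  have "F.u y = \<kappa> * power_sine 0 y" for y
    unfolding F.u_def power_sine_def unfolding k' by (rule Re_even_series_cmult[OF
        conv_radius_power_moment])
  hence us: "y\<^sup>2 * F.u y = \<kappa> * (1 - cos y)" for y using power_sine_0[of y]
      by (simp add: mult.left_commute)
  have x0: "x \<noteq> 0" using F.u_0 u by auto
  have "((\<lambda>y. y\<^sup>2 * F.u y) has_real_derivative (2 * x) * F.u x + F.u' x * x\<^sup>2) (at x)"
    by (intro DERIV_mult F.u_deriv) (auto intro!: derivative_eq_intros)
  moreover have "((\<lambda>y. y\<^sup>2 * F.u y) has_real_derivative \<kappa> * sin x) (at x)"
    unfolding us by (auto intro!: derivative_eq_intros)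
  ultimately have "\<kappa> * sin x = (2 * x) * F.u x + F.u' x * x\<^sup>2" using DERIV_unique by blast
  moreover have "cos x = 1" using us[of x] u k by simp
  hence "sin x = 0" using sin_cos_squared_add[of x] by simp
  ultimately show "F.u' x = 0" using u x0 by simp
qed

text \<open>The transform is nonpositive at 2 m pi and positive at (2m + 1) pi, so the intermediate
  value theorem gives a zero beyond any bound.\<close>

lemma struve_seq_zeros_unbounded:
  assumes \<nu>: "-1/2 < \<nu>" "\<nu> \<le> 1/2"
  shows "\<exists>x>B. even_vmono.u (even_series (struve_seq \<nu>)) x = 0"
proof -
  have n: "\<nu> \<in> {-1/2..1/2}" using \<nu> by auto
  define b where "b = \<nu> + 1/2"
  have b: "0 < b" "b \<le> 1" using \<nu> by (auto simp: b_def)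
  note d = struve_weight_nonneg[OF b(2)] and s = summable_struve_weight[OF b]
  interpret F: even_vmono "even_series (struve_seq \<nu>)" by (rule even_vmono_struve_seq(1)[OF n])
  obtain \<kappa> where k: "\<kappa> > 0" "struve_seq \<nu> = (\<lambda>j. of_real \<kappa> * sine_coeff (weight_moment
      (struve_weight b)) j)"
    unfolding b_def using \<nu> by (rule struve_seq_moment)
  have c: "conv_radius (sine_coeff (weight_moment (struve_weight b))) = \<infinity>"
      by (intro conv_radius_weight_moment_struve_weight b)
  have u: "F.u y = \<kappa> * Re (even_series (sine_coeff (weight_moment (struve_weight b))) (of_real y))"
      for y
    unfolding F.u_def unfolding k(2) by (rule Re_even_series_cmult[OF c])
  obtain m :: nat where m: "\<bar>B\<bar> < real m" using reals_Archimedean2 by blast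
  define a where "a = 2 * real m * pi"
  have m0: "real m > 0" using m by linarith
  have "real m * 1 < real m * (2 * pi)" using m0 pi_gt3 by (intro mult_strict_left_mono) auto
  hence aB: "a > B" "a > 0" using m by (auto simp: a_def)
  have ca: "cos a = 1" unfolding a_def by (rule cos_2npi)
  have "F.u a \<le> 0"
    unfolding u using even_series_weight_moment_cos_1(1)[OF d s aB(2) ca] k(1)
        by (simp add: mult_le_0_iff)
  moreover have "F.u (a + pi) \<ge> 0"
    unfolding u using even_series_weight_moment_cos_minus_1[OF d s _ _ struve_weight_0_pos, of "a +
        pi"] aB(2) ca k(1) pi_gt_zero by simp
  moreover have "continuous_on {a..a + pi} F.u"
    using F.u_deriv by (meson DERIV_isCont continuous_at_imp_continuous_on)
  ultimately obtain x where "a \<le> x" "F.u x = 0" using IVT'[of F.u a 0 "a + pi"] pi_ge_zero by auto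
  thus ?thesis using aB by (intro exI[of _ x]) auto
qed

text \<open>\<open>rolle_euler\<close> between two zeros of u beyond B; the maximum with 0 keeps
  them on the positive axis.\<close>

lemma euler_zeros_unbounded:
  fixes u :: "real \<Rightarrow> real"
  assumes z: "\<And>B. \<exists>x>B. u x = 0" and d: "\<And>x. (u has_real_derivative u' x) (at x)"
  shows "\<exists>x>B. c * u x + x * u' x = 0"
proof -
  obtain a where a: "a > max B 0" "u a = 0" using z by blast
  obtain b where b: "b > a" "u b = 0" using z by blast
  obtain y where "a < y" "c * u y + y * u' y = 0"
    using rolle_euler[of a b u u' c] a b d by auto
  thus ?thesis using a by (intro exI[of _ y]) auto
qed

theorem theorem3:
  fixes \<nu> :: real
  shows
    "(\<nu> \<in> {0<..1/2} \<longrightarrow>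
        infinite {z. struve_entire 2 \<nu> z = 0} \<and>
        all_zeros_real (struve_entire 2 \<nu>) \<and>
        (\<forall>z. struve_entire 2 \<nu> z = 0 \<longrightarrow> zorder (struve_entire 2 \<nu>) z = 1)) \<and>
     (\<nu> \<in> {0<..1/2} \<longrightarrow>
        interlacing (<) (real_zeros (struve_entire 1 \<nu>) \<inter> {0<..})
                        (real_zeros (struve_entire 2 \<nu>) \<inter> {0<..})) \<and>
     (\<nu> \<in> {-1/2..1/2} \<longrightarrow>
        all_zeros_real (struve_comb_entire 1 \<nu>) \<and>
        all_zeros_real (struve_entire 1 \<nu>) \<and>
        interlacing (<) (real_zeros (struve_comb_entire 1 \<nu>)) (real_zeros (struve_entire 1 \<nu>)) \<and>
        all_zeros_real (struve_comb_entire 0 \<nu>) \<and>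
        all_zeros_real (struve_entire 0 \<nu>) \<and>
        (if \<nu> = 1/2
         then interlacing lex_less (real_zeros_mult (struve_comb_entire 0 \<nu>))
                                   (real_zeros_mult (struve_entire 0 \<nu>))
         else interlacing (<) (real_zeros (struve_comb_entire 0 \<nu>))
                              (real_zeros (struve_entire 0 \<nu>))))"
proof (cases "\<nu> \<in> {-1/2..1/2}")
  case False
  thus ?thesis by auto
next
  case \<nu>: True
  have \<nu>': "\<nu> > -3/2" "\<nu> + 1 > 0" using \<nu> by auto
  interpret F: even_vmono "even_series (struve_seq \<nu>)" by (rule even_vmono_struve_seq(1)[OF \<nu>])
  interpret G: even_vmono "even_series (euler_seq (\<nu> + 1) (struve_seq \<nu>))"
      by (rule even_vmono_struve_seq(2)[OF \<nu>])
  note s0 = struve_entire_0[OF \<nu>] and s1 = struve_entire_1[OF \<nu>]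
  have G_eq: "even_series (euler_seq (\<nu> + 1) (struve_seq \<nu>)) =
      (\<lambda>z. of_real (\<nu> + 1) * even_series (struve_seq \<nu>) z + z * deriv (even_series (struve_seq \<nu>))
      z)"
    using even_series_euler[OF struve_seq_euler_vmono(1)[OF \<nu>]] by blast
  have Gu: "G.u x = (\<nu> + 1) * F.u x + x * F.u' x" for x
    unfolding G.u_def unfolding G_eq by (simp add: F.of_u)
  have Gu': "G.u' x = (\<nu> + 1 + 1) * F.u' x + x * F.u'' x" for x
    unfolding G.u'_def unfolding G_eq F.deriv_euler by (simp add: F.of_u)
  \<comment> \<open>The zeros for H' are simple even for \<nu> = 1/2, since
    \<open>euler_simple\<close> tolerates double zeros of the function it starts from.\<close>
  have G_simple: "G.u' x \<noteq> 0" if "G.u x = 0" for x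
    unfolding Gu' by (rule F.euler_simple[OF \<nu>'(2) struve_seq_nondegenerate[OF \<nu>]]) (use that in
        \<open>simp_all add: Gu\<close>)
  have c0: "struve_comb_entire 0 \<nu> = deriv (even_series (struve_seq \<nu>))"
    and c1: "struve_comb_entire 1 \<nu> = deriv (even_series (euler_seq (\<nu> + 1) (struve_seq \<nu>)))"
    using struve_comb_entire_eq_deriv[OF \<nu>'(1)] s0 s1 by auto
  have "\<nu> = 1/2 \<Longrightarrow> interlacing lex_less (real_zeros_mult (deriv (even_series (struve_seq \<nu>))))
      (real_zeros_mult (even_series (struve_seq \<nu>)))"
    using F.interlacing_double struve_seq_half_double struve_seq_nondegenerate[OF \<nu>] by blast
  moreover have "\<nu> \<noteq> 1/2 \<Longrightarrow> interlacing (<) (real_zeros (deriv (even_series (struve_seq \<nu>))))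
      (real_zeros (even_series (struve_seq \<nu>)))"
    using \<nu> by (intro F.interlacing_deriv struve_seq_simple) auto
  ultimately have part_c: "\<nu> \<in> {-1/2..1/2} \<longrightarrow>
        all_zeros_real (struve_comb_entire 1 \<nu>) \<and>
        all_zeros_real (struve_entire 1 \<nu>) \<and>
        interlacing (<) (real_zeros (struve_comb_entire 1 \<nu>)) (real_zeros (struve_entire 1 \<nu>)) \<and>
        all_zeros_real (struve_comb_entire 0 \<nu>) \<and>
        all_zeros_real (struve_entire 0 \<nu>) \<and>
        (if \<nu> = 1/2
         then interlacing lex_less (real_zeros_mult (struve_comb_entire 0 \<nu>))
                                   (real_zeros_mult (struve_entire 0 \<nu>))
         else interlacing (<) (real_zeros (struve_comb_entire 0 \<nu>))
                              (real_zeros (struve_entire 0 \<nu>)))"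
    unfolding s0 s1 c0 c1 using F.all_zeros_real G.all_zeros_real G.interlacing_deriv[OF G_simple]
        by simp
  \<comment> \<open>The constant of this second Euler transform is \<nu>; its positivity is what (a)
    and (b) draw from \<nu> > 0.\<close>
  have s2: "struve_entire 2 \<nu> = (\<lambda>z. of_real \<nu> * even_series (euler_seq (\<nu> + 1) (struve_seq \<nu>)) z +
      z * deriv (even_series (euler_seq (\<nu> + 1) (struve_seq \<nu>))) z)"
    using struve_entire_Suc[OF \<nu>'(1), of 1] unfolding s1 by (simp add: numeral_2_eq_2)
  have s2_real: "struve_entire 2 \<nu> (of_real x) = of_real (\<nu> * G.u x + x * G.u' x)" for x
    unfolding s2 by (simp add: G.of_u)
  have part_a: "infinite {z. struve_entire 2 \<nu> z = 0} \<and> all_zeros_real (struve_entire 2 \<nu>) \<and>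
        (\<forall>z. struve_entire 2 \<nu> z = 0 \<longrightarrow> zorder (struve_entire 2 \<nu>) z = 1)" if pos: "\<nu> > 0"
  proof (intro conjI allI impI)
    \<comment> \<open>Unboundedness of the zeros passes from H to H' and on to H'' by Rolle's
      theorem.\<close>
    have "\<exists>x>B. F.u x = 0" for B using pos \<nu> by (intro struve_seq_zeros_unbounded) auto
    hence "\<exists>x>B. G.u x = 0" for B unfolding Gu using F.u_deriv by (rule euler_zeros_unbounded)
    hence ub: "\<exists>x>B. \<nu> * G.u x + x * G.u' x = 0" for B using G.u_deriv
        by (rule euler_zeros_unbounded)
    show "infinite {z. struve_entire 2 \<nu> z = 0}"
    proof
      assume "finite {z. struve_entire 2 \<nu> z = 0}"
      hence "finite (Re ` {z. struve_entire 2 \<nu> z = 0})" by (rule finite_imageI)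
      then obtain B where B: "\<And>t. t \<in> Re ` {z. struve_entire 2 \<nu> z = 0} \<Longrightarrow> t \<le> B"
        using bdd_above_finite bdd_above.unfold by metis
      obtain x where x: "x > B" "\<nu> * G.u x + x * G.u' x = 0" using ub by blast
      have "x \<in> Re ` {z. struve_entire 2 \<nu> z = 0}"
        by (rule image_eqI[of _ _ "of_real x"]) (simp_all add: s2_real x(2) del: of_real_add
            of_real_mult)
      thus False using B x(1) by force
    qed
    show real: "all_zeros_real (struve_entire 2 \<nu>)"
      unfolding all_zeros_real_def s2 using G.euler_real_zero[OF pos] by blast
    fix z assume z: "struve_entire 2 \<nu> z = 0"
    hence "z \<in> \<real>" using real by (auto simp: all_zeros_real_def)
    then obtain x where x: "z = of_real x" by (auto elim: Reals_cases)
    have 0: "\<nu> * G.u x + x * G.u' x = 0" using z unfolding x s2_real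
        by (simp only: of_real_eq_0_iff)
    have "deriv (struve_entire 2 \<nu>) z = of_real ((\<nu> + 1) * G.u' x + x * G.u'' x)"
      unfolding s2 x G.deriv_euler by (simp add: G.of_u)
    moreover have "(\<nu> + 1) * G.u' x + x * G.u'' x \<noteq> 0"
      by (rule G.euler_simple[OF pos _ 0]) (use G_simple in blast)
    ultimately have d: "deriv (struve_entire 2 \<nu>) z \<noteq> 0" by (simp only: of_real_eq_0_iff simp_thms)
    show "zorder (struve_entire 2 \<nu>) z = 1"
      by (rule zorder_zero_eqI[OF holomorphic_struve_entire[OF \<nu>'(1)]]) (use z d in auto)
  qed
  have part_b: "interlacing (<) (real_zeros (struve_entire 1 \<nu>) \<inter> {0<..}) (real_zeros
      (struve_entire 2 \<nu>) \<inter> {0<..})"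
    if pos: "\<nu> > 0"
  proof -
    have "interlacing (<) {x \<in> {0<..}. \<nu> * G.u x + x * G.u' x = 0} {x \<in> {0<..}. G.u x = 0}"
    \<comment> \<open>This q is (\<nu> u + x u')/(x u) for the function u of H'; on the positive
      axis \<nu>/x decreases as well as u'/u.\<close>
    proof (rule interlacing_of_decreasing_quotient[where q = "\<lambda>x. \<nu> / x + G.u' x / G.u x"])
      show "\<exists>z. a < z \<and> z < b \<and> \<nu> * G.u z + z * G.u' z = 0"
        if "a \<in> {0<..}" "b \<in> {0<..}" "a < b" "G.u a = 0" "G.u b = 0" for a b
        using that by (intro rolle_euler G.u_deriv) auto
      show "\<nu> * G.u x + x * G.u' x \<noteq> 0" if "x \<in> {0<..}" "G.u x = 0" for x
        using that G_simple by auto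
      show "\<nu> / x + G.u' x / G.u x = 0" if "x \<in> {0<..}" "G.u x \<noteq> 0" "\<nu> * G.u x + x * G.u' x = 0"
          for x
        using that by (simp add: field_simps)
      show "\<exists>D. ((\<lambda>x. \<nu> / x + G.u' x / G.u x) has_real_derivative D) (at x) \<and> D < 0"
        if x: "x \<in> {0<..}" "G.u x \<noteq> 0" for x
      proof -
        obtain D where D: "((\<lambda>x. G.u' x / G.u x) has_real_derivative D) (at x)" "D < 0"
          using G.quotient_decreasing[OF x(2)] by blast
        have "((\<lambda>x. \<nu> / x) has_real_derivative - \<nu> / x\<^sup>2) (at x)"
          using x(1) by (auto intro!: derivative_eq_intros simp: power2_eq_square)
        hence "((\<lambda>x. \<nu> / x + G.u' x / G.u x) has_real_derivative - \<nu> / x\<^sup>2 + D) (at x)"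
          using D(1) by (rule DERIV_add)
        moreover have "- \<nu> / x\<^sup>2 + D < 0" using pos x(1) D(2)
            by (intro add_nonpos_neg divide_nonpos_nonneg) auto
        ultimately show ?thesis by blast
      qed
    qed auto
    moreover have "{x \<in> {0<..}. \<nu> * G.u x + x * G.u' x = 0} =
        real_zeros (struve_entire 2 \<nu>) \<inter> {0<..}"
      unfolding real_zeros_def s2_real of_real_eq_0_iff by auto
    moreover have "{x \<in> {0<..}. G.u x = 0} = real_zeros (struve_entire 1 \<nu>) \<inter> {0<..}"
      unfolding s1 G.real_zeros_eq by auto
    ultimately show ?thesis using interlacing_sym by simp
  qed
  show ?thesis using part_a part_b part_c by simp
qed

end
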